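(* Let $X$ be an infinite compact abelian group with Haar measure $\alpha$ (any positive normalization), and let $\hat X$ be its (discrete) dual group equipped with the dual Haar measure $\hat\alpha$ normalized as described in the context. For $0<p,q\le\infty$ let $C_{p,q}$ be the $(p,q)$-norm of the Fourier operator as defined in the context. Consider the regions $$R_1=\Big\{\Big(\tfrac1p,\tfrac1q\Big)\in[0,\infty)^2:\ \tfrac1p+\tfrac1q\le 1,\ \tfrac1q\le\tfrac12\Big\},$$ $$R_2=\Big\{\Big(\tfrac1p,\tfrac1q\Big)\in[0,\infty)^2:\ \tfrac1p+\tfrac1q> 1,\ \tfrac1p>\tfrac12\Big\},$$ $$R_3=\Big\{\Big(\tfrac1p,\tfrac1q\Big)\in[0,\infty)^2:\ \tfrac1p\le\tfrac12,\ \tfrac1q>\tfrac12\Big\}.$$ Then $$C_{p,q}=\begin{cases}\alpha(X)^{1-1/p-1/q} & \text{if } (1/p,1/q)\in R_1,\\ \infty & \text{if } (1/p,1/q)\in R_2\cup R_3.\end{cases}$$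
   Context: For a locally compact abelian group $X$ with Haar measure $\alpha$, $\hat X$ denotes the group of continuous homomorphisms $\gamma:X\to\mathbb T=\{z\in\mathbb C:|z|=1\}$ under pointwise multiplication, and the Fourier transform of $f\in L^1(X)$ is $\hat f(\gamma)=\int_X f(x)\overline{\gamma(x)}\,\alpha(dx)$. When $X$ is compact, $\hat X$ is discrete and its Haar measure $\hat\alpha$ is normalized to give mass $\alpha(X)^{-1}$ to each point (this is the normalization for which Fourier inversion and the Plancherel identity $\|f\|_2=\|\hat f\|_2$ hold). For $0<p<\infty$, $\|f\|_p=(\int|f|^p)^{1/p}$ (a quasi-norm if $p<1$), and $\|f\|_\infty$ is the essential supremum. For compact $X$ and $0<p\le\infty$, $C_{p,q}:=\sup\{\|\hat f\|_{L^q(\hat X,\hat\alpha)}: f\in L^1(X)\cap L^p(X),\ \|f\|_{L^p(X,\alpha)}=1\}$ (note $L^1\cap L^p=L^p$ if $p\ge1$ and $=L^1$ if $p<1$). *)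

theory Defs
  imports "HOL-Analysis.Analysis"
begin

definition haar_measure :: "'a::{topological_ab_group_add,t2_space} measure \<Rightarrow> bool" where
  "haar_measure M \<longleftrightarrow>
     sets M = sets borel \<and>
     emeasure M UNIV < \<infinity> \<and> emeasure M UNIV > 0 \<and>
     (\<forall>A\<in>sets borel. \<forall>g. emeasure M ((+) g ` A) = emeasure M A) \<and>
     (\<forall>A\<in>sets borel. emeasure M A = (INF U\<in>{U. open U \<and> A \<subseteq> U}. emeasure M U)) \<and>
     (\<forall>U. open U \<longrightarrow> emeasure M U = (SUP K\<in>{K. compact K \<and> K \<subseteq> U}. emeasure M K))"

definition characters :: "('a::{topological_ab_group_add} \<Rightarrow> complex) set" where
  "characters = {\<gamma>. continuous_on UNIV \<gamma> \<and> (\<forall>x. norm (\<gamma> x) = 1) \<and>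
                     (\<forall>x y. \<gamma> (x + y) = \<gamma> x * \<gamma> y)}"

definition dual_measure :: "'a::topological_ab_group_add measure \<Rightarrow> ('a \<Rightarrow> complex) measure" where
  "dual_measure M = density (count_space characters) (\<lambda>_. ennreal (1 / measure M UNIV))"

definition fourier :: "'a measure \<Rightarrow> ('a \<Rightarrow> complex) \<Rightarrow> ('a \<Rightarrow> complex) \<Rightarrow> complex" where
  "fourier M f \<gamma> = (LINT x|M. f x * cnj (\<gamma> x))"

text \<open>L^p (quasi-)norm, parametrised by s = 1/p \<ge> 0 (s = 0 means p = \<infinity>, essential supremum).\<close>
definition lpnorm :: "'b measure \<Rightarrow> real \<Rightarrow> ('b \<Rightarrow> complex) \<Rightarrow> ennreal" where
  "lpnorm M s f =
     (if s = 0 then Inf {c. AE x in M. ennreal (norm (f x)) \<le> c}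
      else (let I = (\<integral>\<^sup>+ x. ennreal (norm (f x) powr (1 / s)) \<partial>M)
            in if I = \<infinity> then \<infinity> else ennreal (enn2real I powr s)))"

definition fourier_pq_norm :: "'a::topological_ab_group_add measure \<Rightarrow> real \<Rightarrow> real \<Rightarrow> ennreal" where
  "fourier_pq_norm M s t =
     Sup {lpnorm (dual_measure M) t (fourier M f) | f.
            f \<in> borel_measurable M \<and> integrable M f \<and> lpnorm M s f = 1}"

end

theory Submission
  imports Defs "HOL-Complex_Analysis.Complex_Analysis"
begin

text \<open>On \<open>R\<^sub>1\<close> the upper bound is the Hausdorff--Young inequality (Riesz--Thorin between the trivial
  \<open>L\<^sup>1 \<rightarrow> \<ell>\<^sup>\<infinity>\<close> bound and Bessel's inequality) followed by Jensen's inequality, and constants attain it.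
  Off \<open>R\<^sub>1\<close> one needs functions whose transform is bounded below on many characters.
  For \<open>1/p > 1\<close> indicators of small open sets suffice; for \<open>1/2 < 1/p \<le> 1\<close> the Fejer-type kernels
  \<open>|\<Sum>\<^bsub>\<gamma>\<in>A\<^esub> \<gamma>|\<^sup>2/|A|\<close> with \<open>A\<close> a long progression or a large finite subgroup of the dual; for
  \<open>1/q > 1/2\<close> Rudin--Shapiro polynomials.  The last two require the dual to be infinite.  This follows from
  a Peter--Weyl type uniqueness theorem: were some nonzero continuous function orthogonal to all
  characters, the power method would produce a convolution idempotent with the same property, and a
  minimal such idempotent is, up to a factor, itself a character.\<close>

section \<open>Interpolation\<close>

text \<open>The group may fail to be metrizable and its dual may be uncountable. Hence convolution
  is confined to continuous functions, for which iterated integrals can be exchanged, and sums over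
  the dual are controlled through finite sets of characters. Interpolation is done for finite
  matrices, where the analytic family is a finite sum of entire functions; general functions enter
  as limits of simple ones.

  The spectral argument rests on two facts. The value of \<open>f \<star> adj f\<close> at 0 is the
  squared L2 norm of f, so norms of powers of k are values of other powers; and convolution maps L2
  into bounded functions, so L2 convergence improves to uniform convergence. Minimal idempotents
  exist because a nonzero idempotent has squared norm at least 1/\<alpha>.

  With N the number of characters involved, the kernels of the middle range give a quotient of order
  N^(s+t-1), the Rudin-Shapiro polynomials one of order N^(t-1/2); the signs of these exponents draw
  the boundary of the region.\<close>

lemma three_lines:
  fixes F :: "complex \<Rightarrow> complex" and \<theta> :: real
  assumes hol: "F holomorphic_on UNIV"
    and bdd: "\<And>z. 0 \<le> Re z \<Longrightarrow> Re z \<le> 1 \<Longrightarrow> norm (F z) \<le> K"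
    and edge: "\<And>z. Re z = 0 \<or> Re z = 1 \<Longrightarrow> norm (F z) \<le> 1"
    and \<theta>: "0 \<le> \<theta>" "\<theta> \<le> 1"
  shows "norm (F (of_real \<theta>)) \<le> 1"
proof -
  have K0: "K \<ge> 0" using bdd[of 0] norm_ge_zero[of "F 0"] by (simp del: norm_ge_zero)
  have *: "norm (F (of_real \<theta>)) \<le> exp \<epsilon>" if e: "\<epsilon> > 0" for \<epsilon> :: real
  proof -
    \<comment> \<open>At z = x + iy the factor has modulus exp(\<epsilon>(x^2 - y^2 - 1)): at most 1
      on the strip, with Gaussian decay in y. A bounded rectangle then suffices for the maximum
      principle, at the price of at most exp \<epsilon> at the point \<theta>.\<close>
    define G where "G = (\<lambda>z. F z * exp (of_real \<epsilon> * (z^2 - 1)))"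
    have nG: "norm (G z) = norm (F z) * exp (\<epsilon> * ((Re z)^2 - (Im z)^2 - 1))" for z
      by (simp add: G_def norm_mult power2_eq_square)
    \<comment> \<open>The height gives \<epsilon> R^2 \<ge> \<epsilon> R \<ge> |K|, so the decay
      outweighs the bound K on the horizontal sides; the summand 1 ensures R \<le> R^2.\<close>
    define R where "R = \<bar>K\<bar> / \<epsilon> + 1"
    have R: "R \<ge> 1" using e by (simp add: R_def)
    have KR: "K * exp (- (\<epsilon> * R^2)) \<le> 1"
    proof -
      have "\<bar>K\<bar> \<le> \<epsilon> * R" using e by (simp add: R_def field_simps)
      also have "\<dots> \<le> \<epsilon> * R^2" using R e by (simp add: power2_eq_square)
      also have "\<dots> \<le> exp (\<epsilon> * R^2)" using exp_ge_add_one_self[of "\<epsilon> * R^2"] by linarith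
      finally show ?thesis by (simp add: exp_minus field_simps)
    qed
    define S where "S = cbox (Complex 0 (-R)) (Complex 1 R)"
    have "norm (G (of_real \<theta>)) \<le> 1"
    proof (rule maximum_modulus_frontier[where S=S and f=G])
      have G: "G holomorphic_on UNIV"
        unfolding G_def by (intro holomorphic_intros hol)
      show "G holomorphic_on interior S"
        using G holomorphic_on_subset by blast
      show "continuous_on (closure S) G"
        using G holomorphic_on_imp_continuous_on holomorphic_on_subset by blast
      show "bounded S" by (simp add: S_def)
      show "of_real \<theta> \<in> S" using \<theta> R by (simp add: S_def in_cbox_complex_iff)
      show "norm (G z) \<le> 1" if "z \<in> frontier S" for z
      proof -
        have cl: "0 \<le> Re z" "Re z \<le> 1" "-R \<le> Im z" "Im z \<le> R"
          using that by (auto simp: S_def frontier_def in_cbox_complex_iff)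
        have nint: "\<not> (0 < Re z \<and> Re z < 1 \<and> -R < Im z \<and> Im z < R)"
          using that unfolding S_def frontier_def
          by (auto simp: interior_cbox in_box_complex_iff)
        have sq1: "(Re z)^2 \<le> 1" using cl by (simp add: power_le_one)
        show ?thesis
        proof (cases "Re z = 0 \<or> Re z = 1")
          case True
          have "exp (\<epsilon> * ((Re z)^2 - (Im z)^2 - 1)) \<le> 1"
            using e sq1 zero_le_power2[of "Im z"] by (subst exp_le_one_iff, intro mult_nonneg_nonpos, simp) linarith
          then show ?thesis unfolding nG using edge[OF True] by (simp add: mult_le_one)
        next
          case False
          then have "Im z = R \<or> Im z = -R" using nint cl by auto
          then have "(Im z)^2 = R^2" by auto
          then have "\<epsilon> * ((Re z)^2 - (Im z)^2 - 1) \<le> - (\<epsilon> * R^2)"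
            using e sq1 by (simp add: algebra_simps)
          then have "norm (G z) \<le> K * exp (- (\<epsilon> * R^2))"
            unfolding nG using bdd[OF cl(1,2)] K0 by (intro mult_mono) auto
          then show ?thesis using KR by linarith
        qed
      qed
    qed
    then have "norm (F (of_real \<theta>)) * exp (\<epsilon> * (\<theta>^2 - 1)) \<le> 1"
      by (simp add: nG)
    then have "norm (F (of_real \<theta>)) \<le> exp (\<epsilon> * (1 - \<theta>^2))"
      by (simp add: exp_minus field_simps algebra_simps exp_diff)
    also have "\<dots> \<le> exp \<epsilon>" using e by simp
    finally show ?thesis .
  qed
  have "((\<lambda>\<epsilon>::real. exp \<epsilon>) \<longlongrightarrow> exp 0) (at_right 0)"
    by (intro tendsto_intros)
  then show ?thesis
    by (intro tendsto_lowerbound[of _ "1::real" "at_right 0"])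
       (auto simp: eventually_at_right_less intro!: * eventually_at_rightI[of 0 1])
qed

text \<open>Division by the zero-free entire function M0^(1-z) M1^z, whose modulus is M0 on the left
  edge and M1 on the right one, reduces to edge bounds 1.\<close>

lemma three_lines_powr:
  fixes F :: "complex \<Rightarrow> complex" and \<theta> :: real
  assumes hol: "F holomorphic_on UNIV"
    and bdd: "\<And>z. 0 \<le> Re z \<Longrightarrow> Re z \<le> 1 \<Longrightarrow> norm (F z) \<le> K"
    and M: "M0 > 0" "M1 > 0"
    and e0: "\<And>z. Re z = 0 \<Longrightarrow> norm (F z) \<le> M0"
    and e1: "\<And>z. Re z = 1 \<Longrightarrow> norm (F z) \<le> M1"
    and \<theta>: "0 \<le> \<theta>" "\<theta> \<le> 1"
  shows "norm (F (of_real \<theta>)) \<le> M0 powr (1 - \<theta>) * M1 powr \<theta>"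
proof -
  have K0: "K \<ge> 0" using bdd[of 0] norm_ge_zero[of "F 0"] by (simp del: norm_ge_zero)
  define E where "E = (\<lambda>z::complex. exp (- (of_real (ln M0) * (1 - z) + of_real (ln M1) * z)))"
  have nE: "norm (E z) = exp (- (ln M0 * (1 - Re z) + ln M1 * Re z))" for z :: complex
    by (simp add: E_def)
  have nE': "norm (E z) = inverse (M0 powr (1 - Re z) * M1 powr (Re z))" for z
    unfolding nE using M by (simp add: powr_def exp_minus[symmetric] exp_add[symmetric] exp_diff exp_add field_simps)
  have "norm (F (of_real \<theta>) * E (of_real \<theta>)) \<le> 1"
  proof (rule three_lines[where F = "\<lambda>z. F z * E z" and K = "K * exp (\<bar>ln M0\<bar> + \<bar>ln M1\<bar>)"])
    show "(\<lambda>z. F z * E z) holomorphic_on UNIV"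
      unfolding E_def by (intro holomorphic_intros hol)
    show "norm (F z * E z) \<le> K * exp (\<bar>ln M0\<bar> + \<bar>ln M1\<bar>)" if z: "0 \<le> Re z" "Re z \<le> 1" for z :: complex
    proof -
      have "\<bar>ln M0 * (1 - Re z)\<bar> \<le> \<bar>ln M0\<bar>" "\<bar>ln M1 * Re z\<bar> \<le> \<bar>ln M1\<bar>"
        using z by (auto simp: abs_mult intro!: mult_left_le)
      then have "norm (E z) \<le> exp (\<bar>ln M0\<bar> + \<bar>ln M1\<bar>)"
        unfolding nE by (subst exp_le_cancel_iff) linarith
      then show ?thesis
        unfolding norm_mult using bdd[OF z] K0 by (intro mult_mono) auto
    qed
    show "norm (F z * E z) \<le> 1" if "Re z = 0 \<or> Re z = 1" for z
      using that e0[of z] e1[of z] M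
      by (auto simp: norm_mult nE' field_simps)
  qed (use \<theta> in auto)
  then show ?thesis using M by (simp add: norm_mult nE' field_simps)
qed

text \<open>The value at \<open>w = 0\<close> is 0 for every \<open>z\<close>.\<close>
definition cpowr :: "complex \<Rightarrow> complex \<Rightarrow> complex" where
  "cpowr w z = of_real (norm w) powr z * sgn w"

lemma holomorphic_cpowr: "g holomorphic_on S \<Longrightarrow> (\<lambda>z. cpowr w (g z)) holomorphic_on S"
  unfolding cpowr_def powr_def
  by (cases "w = 0") (auto intro!: holomorphic_intros)

lemma norm_cpowr: "norm (cpowr w z) = norm w powr Re z"
  by (cases "w = 0") (auto simp: cpowr_def norm_mult norm_powr_real_powr norm_sgn)

lemma cpowr_1: "cpowr w 1 = w"
  by (auto simp: cpowr_def sgn_eq)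

text \<open>Supplies the bound on the whole strip that the three lines theorem presupposes. The
  maximum with 1 handles bases below 1, whose powers decrease in the exponent.\<close>

lemma powr_le_max1:
  fixes a :: real
  assumes "a \<ge> 0" "x \<le> b" "x \<ge> 0"
  shows "a powr x \<le> max 1 a powr b"
proof -
  have "a powr x \<le> max 1 a powr x" using assms by (intro powr_mono2) auto
  also have "\<dots> \<le> max 1 a powr b" using assms by (intro powr_mono) auto
  finally show ?thesis .
qed

text \<open>Riesz--Thorin interpolation between \<open>L\<^sup>1 \<rightarrow> \<ell>\<^sup>\<infinity>\<close> and \<open>L\<^sup>2 \<rightarrow> \<ell>\<^sup>2\<close> for a finite matrix:
  the bilinear form is tested against \<open>|x|\<^bsup>p(1-z/2)\<^esup> sgn x\<close> and \<open>|X|\<^bsup>q(1-z/2)\<^esup> sgn X\<close>, which on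
  the line \<open>Re z = \<theta>\<close>, \<open>\<theta> = 2/q\<close>, recovers \<open>x\<close> and the extremiser of the dual norm.\<close>
lemma riesz_thorin_finite_normalized:
  fixes c :: "'j \<Rightarrow> 'g \<Rightarrow> complex" and w :: "'j \<Rightarrow> real" and t al :: real
  assumes al: "al > 0" and t: "0 < t" "t \<le> 1/2"
    and b0: "\<And>x g. g \<in> A \<Longrightarrow> norm (\<Sum>j\<in>J. x j * c j g) \<le> (\<Sum>j\<in>J. w j * norm (x j))"
    and b1: "\<And>x. (\<Sum>g\<in>A. (norm (\<Sum>j\<in>J. x j * c j g))^2) \<le> al * (\<Sum>j\<in>J. w j * (norm (x j))^2)"
    and nrm: "(\<Sum>j\<in>J. w j * norm (x j) powr (1 / (1 - t))) \<le> 1"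
  shows "(\<Sum>g\<in>A. norm (\<Sum>j\<in>J. x j * c j g) powr (1 / t)) \<le> al"
proof -
  define p q where "p = 1 / (1 - t)" and "q = 1 / t"
  have pq: "p > 0" "q > 0" "p * (1 - t) = 1" "q * (1 - t) = q - 1" "p > 1"
    using t by (auto simp: p_def q_def field_simps)
  define X where "X = (\<lambda>g. \<Sum>j\<in>J. x j * c j g)"
  define S where "S = (\<Sum>g\<in>A. norm (X g) powr q)"
  have S0: "S \<ge> 0" unfolding S_def by (intro sum_nonneg) auto
  define xz where "xz = (\<lambda>z j. cpowr (x j) (of_real p * (1 - z/2)))"
  define yz where "yz = (\<lambda>z g. cpowr (cnj (X g)) (of_real q * (1 - z/2)))"
  define F where "F = (\<lambda>z. \<Sum>g\<in>A. (\<Sum>j\<in>J. xz z j * c j g) * yz z g)"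
  have nx: "norm (xz z j) = norm (x j) powr (p * (1 - Re z/2))" for z j
    by (simp add: xz_def norm_cpowr)
  have ny: "norm (yz z g) = norm (X g) powr (q * (1 - Re z/2))" for z g
    by (simp add: yz_def norm_cpowr)
  have Sle: "S \<le> al"
  proof (cases "S = 0")
    case True then show ?thesis using al by simp
  next
    case False
    then have Sp: "S > 0" using S0 by simp
    have hol: "F holomorphic_on UNIV"
      unfolding F_def xz_def yz_def by (intro holomorphic_intros holomorphic_cpowr) auto
    have bdd: "norm (F z) \<le> (\<Sum>g\<in>A. (\<Sum>j\<in>J. (max 1 (norm (x j)) powr p) * norm (c j g)) * (max 1 (norm (X g)) powr q))"
      if z: "0 \<le> Re z" "Re z \<le> 1" for z
    proof -
      have 1: "norm (xz z j) \<le> max 1 (norm (x j)) powr p" for j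
        unfolding nx using z pq by (intro powr_le_max1) (auto simp: mult_left_le)
      have 2: "norm (yz z g) \<le> max 1 (norm (X g)) powr q" for g
        unfolding ny using z pq by (intro powr_le_max1) (auto simp: mult_left_le)
      show ?thesis unfolding F_def
        by (intro sum_norm_le order_trans[OF norm_mult_ineq] mult_mono 2)
           (auto simp: norm_mult intro!: sum_norm_le mult_mono 1 sum_nonneg)
    qed
    have nx0: "(\<Sum>j\<in>J. w j * norm (xz z j)) \<le> 1" if "Re z = 0" for z
      using nrm that by (simp add: nx p_def)
    \<comment> \<open>Left edge, the endpoint from L1 to sup: the inner sums are at most 1, and the
      moduli of \<open>yz\<close> add up to S.\<close>
    have e0: "norm (F z) \<le> S" if z: "Re z = 0" for z
    proof -
      have "norm (F z) \<le> (\<Sum>g\<in>A. 1 * norm (yz z g))"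
        unfolding F_def using nx0[OF z]
        by (intro sum_norm_le order_trans[OF norm_mult_ineq] mult_mono)
           (auto intro: order_trans[OF b0])
      also have "\<dots> = S" by (simp add: S_def ny z)
      finally show ?thesis .
    qed
    \<comment> \<open>Right edge, the L2 endpoint: the exponents p and q are halved, so the squared
      moduli of \<open>xz\<close> have weighted sum at most 1 and those of \<open>yz\<close> have
      sum S. Cauchy-Schwarz finishes.\<close>
    have e1: "norm (F z) \<le> sqrt (al * S)" if z: "Re z = 1" for z
    proof -
      have half: "(a powr (r/2))^2 = a powr r" if "a \<ge> 0" for a r :: real
        by (simp add: power2_eq_square powr_add[symmetric])
      have "(\<Sum>j\<in>J. w j * (norm (xz z j))^2) = (\<Sum>j\<in>J. w j * norm (x j) powr p)"
        by (simp add: nx z half)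
      also have "\<dots> \<le> 1" using nrm by (simp add: p_def)
      finally have xx: "(\<Sum>g\<in>A. (norm (\<Sum>j\<in>J. xz z j * c j g))^2) \<le> al"
        using b1[of "xz z"] al by (auto intro: order_trans mult_left_le)
      have yy: "(\<Sum>g\<in>A. (norm (yz z g))^2) = S"
        by (simp add: ny z half S_def)
      have "norm (F z) \<le> (\<Sum>g\<in>A. norm (\<Sum>j\<in>J. xz z j * c j g) * norm (yz z g))"
        unfolding F_def by (intro sum_norm_le norm_mult_ineq)
      also have "\<dots> \<le> (\<Sum>g\<in>A. \<bar>norm (\<Sum>j\<in>J. xz z j * c j g)\<bar> * \<bar>norm (yz z g)\<bar>)" by simp
      also have "\<dots> \<le> L2_set (\<lambda>g. norm (\<Sum>j\<in>J. xz z j * c j g)) A * L2_set (\<lambda>g. norm (yz z g)) A"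
        by (rule L2_set_mult_ineq)
      also have "\<dots> = sqrt (\<Sum>g\<in>A. (norm (\<Sum>j\<in>J. xz z j * c j g))^2) * sqrt S"
        by (simp add: L2_set_def yy)
      also have "\<dots> \<le> sqrt al * sqrt S"
        using xx S0 by (intro mult_right_mono) auto
      finally show ?thesis by (simp add: real_sqrt_mult)
    qed
    have "norm (F (of_real (2*t))) \<le> S powr (1 - 2*t) * (sqrt (al * S)) powr (2*t)"
      by (rule three_lines_powr[OF hol bdd]) (use e0 e1 t Sp al in auto)
    moreover have "F (of_real (2*t)) = of_real S"
    proof -
      have "xz (of_real (2*t)) j = x j" for j
      proof -
        have "complex_of_real p * (1 - complex_of_real (2*t)/2) = of_real (p * (1 - t))" by simp
        then show ?thesis unfolding xz_def using pq by (simp add: cpowr_1)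
      qed
      moreover have "X g * yz (of_real (2*t)) g = of_real (norm (X g) powr q)" for g
      proof (cases "X g = 0")
        case False
        have "complex_of_real q * (1 - complex_of_real (2*t)/2) = of_real (q - 1)" (is "?l = _")
          using pq(4) by (metis (no_types, lifting) mult_2 add_divide_distrib of_real_1 of_real_diff of_real_mult
              field_sum_of_halves mult.commute nonzero_mult_div_cancel_left of_real_numeral zero_neq_numeral)
        then have "yz (of_real (2*t)) g = of_real (norm (X g) powr (q - 1)) * sgn (cnj (X g))"
          unfolding yz_def cpowr_def \<open>?l = _\<close> by (simp add: powr_of_real del: of_real_diff)
        moreover have "X g * sgn (cnj (X g)) = of_real (norm (X g))"
          using False by (simp add: sgn_eq complex_norm_square[symmetric] field_simps power2_eq_square)
        ultimately have "X g * yz (of_real (2*t)) g = of_real (norm (X g) powr (q - 1) * norm (X g))"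
          by (metis mult.left_commute of_real_mult)
        also have "norm (X g) powr (q - 1) * norm (X g) = norm (X g) powr q"
          using False by (simp add: powr_diff)
        finally show ?thesis .
      qed (simp add: yz_def cpowr_def)
      ultimately show ?thesis by (simp add: F_def S_def X_def)
    qed
    \<comment> \<open>S stands on both sides; on the right its total exponent is 1 - t, so division
      leaves S^t \<le> al^t.\<close>
    ultimately have "S \<le> S powr (1 - 2*t) * (sqrt (al * S)) powr (2*t)" using Sp by simp
    also have "(sqrt (al * S)) powr (2*t) = (al * S) powr t"
      using al Sp by (simp add: powr_half_sqrt[symmetric] powr_powr)
    also have "S powr (1 - 2*t) * (al * S) powr t = al powr t * (S powr (1 - 2*t) * S powr t)"
      using al Sp by (simp add: powr_mult)
    also have "S powr (1 - 2*t) * S powr t = S powr (1 - t)"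
      using Sp by (simp add: powr_add[symmetric])
    also have "S powr (1 - t) = S / S powr t"
      using Sp by (simp add: powr_diff)
    finally have "S powr t \<le> al powr t" using Sp by (simp add: field_simps)
    then show ?thesis using t al S0 by (meson powr_less_mono2 not_le less_imp_le)
  qed
  then show ?thesis by (simp add: S_def X_def q_def)
qed

text \<open>Homogeneity: x is divided by \<open>I powr (1 - t)\<close>. Since I is only a positive
  upper bound, x = 0 needs no separate treatment.\<close>

lemma riesz_thorin_finite:
  fixes c :: "'j \<Rightarrow> 'g \<Rightarrow> complex" and w :: "'j \<Rightarrow> real" and t al :: real
  assumes al: "al > 0" and t: "0 < t" "t \<le> 1/2"
    and b0: "\<And>x g. g \<in> A \<Longrightarrow> norm (\<Sum>j\<in>J. x j * c j g) \<le> (\<Sum>j\<in>J. w j * norm (x j))"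
    and b1: "\<And>x. (\<Sum>g\<in>A. (norm (\<Sum>j\<in>J. x j * c j g))^2) \<le> al * (\<Sum>j\<in>J. w j * (norm (x j))^2)"
    and I: "(\<Sum>j\<in>J. w j * norm (x j) powr (1 / (1 - t))) \<le> I" "I > 0"
  shows "(\<Sum>g\<in>A. norm (\<Sum>j\<in>J. x j * c j g) powr (1 / t)) \<le> al * I powr ((1 - t) / t)"
proof -
  define r where "r = I powr (1 - t)"
  have r: "r > 0" using I by (simp add: r_def)
  have "(\<Sum>g\<in>A. norm (\<Sum>j\<in>J. (x j / of_real r) * c j g) powr (1 / t)) \<le> al"
  proof (rule riesz_thorin_finite_normalized[OF al t b0 b1])
    have "norm (x j / of_real r) powr (1 / (1 - t)) = norm (x j) powr (1 / (1 - t)) / I" for j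
      using r I t by (simp add: norm_divide powr_divide r_def powr_powr)
    then have "(\<Sum>j\<in>J. w j * norm (x j / of_real r) powr (1 / (1 - t))) = (\<Sum>j\<in>J. w j * norm (x j) powr (1 / (1 - t))) / I"
      by (simp add: sum_divide_distrib)
    also have "\<dots> \<le> 1" using I by simp
    finally show "(\<Sum>j\<in>J. w j * norm (x j / of_real r) powr (1 / (1 - t))) \<le> 1" .
  qed auto
  also have "(\<Sum>g\<in>A. norm (\<Sum>j\<in>J. (x j / of_real r) * c j g) powr (1 / t))
      = (\<Sum>g\<in>A. norm (\<Sum>j\<in>J. x j * c j g) powr (1 / t)) / r powr (1/t)"
    using r by (simp add: sum_divide_distrib[symmetric] norm_divide powr_divide)
  finally show ?thesis using r I
    by (simp add: r_def powr_powr field_simps)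
qed

section \<open>Convolution on a compact group\<close>

locale compact_haar =
  fixes M :: "'a::{topological_ab_group_add,t2_space} measure"
  assumes compact_UNIV: "compact (UNIV :: 'a set)"
    and haar: "haar_measure M"
begin

abbreviation total_mass :: real ("\<alpha>") where "\<alpha> \<equiv> measure M UNIV"

section \<open>Invariant integration on the group\<close>

lemma sets_M [measurable_cong]: "sets M = sets borel"
  and emeasure_UNIV_finite: "emeasure M UNIV < \<infinity>"
  and emeasure_UNIV_pos: "emeasure M UNIV > 0"
  and emeasure_translate: "A \<in> sets borel \<Longrightarrow> emeasure M ((+) g ` A) = emeasure M A"
  and outer_regular: "A \<in> sets borel \<Longrightarrow> emeasure M A = (INF U\<in>{U. open U \<and> A \<subseteq> U}. emeasure M U)"
proof -
  note h = haar[unfolded haar_measure_def]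
  note h1 = conjunct2[OF h] note h2 = conjunct2[OF h1] note h3 = conjunct2[OF h2] note h4 = conjunct2[OF h3]
  show "sets M = sets borel" by (rule conjunct1[OF h])
  show "emeasure M UNIV < \<infinity>" by (rule conjunct1[OF h1])
  show "emeasure M UNIV > 0" by (rule conjunct1[OF h2])
  show "emeasure M ((+) g ` A) = emeasure M A" if "A \<in> sets borel"
    using conjunct1[OF h3] that by blast
  show "emeasure M A = (INF U\<in>{U. open U \<and> A \<subseteq> U}. emeasure M U)" if "A \<in> sets borel"
    using conjunct1[OF h4] that by (rule bspec)
qed

lemma space_M [simp]: "space M = UNIV"
  using sets_eq_imp_space_eq[OF sets_M] by simp

sublocale finite_measure M
  using emeasure_UNIV_finite by (intro finite_measureI) simp

lemma mass_pos: "\<alpha> > 0"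
  using emeasure_UNIV_finite emeasure_UNIV_pos by (simp add: measure_def enn2real_positive_iff)

lemma borel_measurable_M: "borel_measurable M = borel_measurable borel"
  by (rule measurable_cong_sets) (auto simp: sets_M)

lemma continuous_measurable:
  fixes f :: "'a \<Rightarrow> 'b::topological_space"
  shows "continuous_on UNIV f \<Longrightarrow> f \<in> borel_measurable M"
  unfolding borel_measurable_M by (rule borel_measurable_continuous_onI)

lemma measurable_translate: "(+) g \<in> measurable M M"
proof -
  have "(+) g \<in> measurable borel borel"
    by (intro borel_measurable_continuous_onI continuous_intros)
  then show ?thesis
    using measurable_cong_sets[OF sets_M sets_M] by blast
qed

lemma distr_translate: "distr M M ((+) g) = M"
proof (rule measure_eqI)
  fix A assume "A \<in> sets (distr M M ((+) g))"
  then have A: "A \<in> sets borel" by (simp add: sets_M)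
  have "(+) g -` A = (+) (-g) ` A"
    by (force simp: image_iff)
  moreover have "emeasure M ((+) (-g) ` A) = emeasure M A"
    using A by (rule emeasure_translate)
  ultimately show "emeasure (distr M M ((+) g)) A = emeasure M A"
    using A measurable_translate by (simp add: emeasure_distr sets_M)
qed simp

lemma integral_translate:
  fixes f :: "'a \<Rightarrow> 'b::{banach, second_countable_topology}"
  assumes "f \<in> borel_measurable M"
  shows "(LINT x|M. f (x + g)) = (LINT x|M. f x)"
proof -
  have "(LINT x|M. f x) = (LINT x|distr M M ((+) g). f x)" by (simp only: distr_translate)
  also have "\<dots> = (LINT x|M. f (g + x))" by (rule integral_distr[OF measurable_translate assms])
  finally show ?thesis by (simp add: add.commute)
qed

lemma continuous_bounded:
  fixes f :: "'a \<Rightarrow> 'b::real_normed_vector"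
  assumes "continuous_on UNIV f"
  obtains B where "B > 0" "\<And>x. norm (f x) \<le> B"
  using compact_imp_bounded[OF compact_continuous_image[OF assms compact_UNIV]]
  by (auto simp: bounded_pos)

lemma integrable_continuous:
  fixes f :: "'a \<Rightarrow> 'b::{banach, second_countable_topology}"
  assumes "continuous_on UNIV f"
  shows "integrable M f"
proof -
  obtain B where "\<And>x. norm (f x) \<le> B" using continuous_bounded[OF assms] by blast
  then show ?thesis by (intro integrable_const_bound[of _ B] continuous_measurable assms) auto
qed

lemma norm_integral_le:
  fixes f :: "'a \<Rightarrow> 'b::{banach, second_countable_topology}"
  assumes "integrable M f" "\<And>x. norm (f x) \<le> e"
  shows "norm (LINT x|M. f x) \<le> e * \<alpha>"
proof -
  have "norm (LINT x|M. f x) \<le> (LINT x|M. norm (f x))" by simp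
  also have "\<dots> \<le> (LINT x|M. e)" using assms by (intro integral_mono) auto
  finally show ?thesis by (simp add: mult.commute)
qed

lemma norm_integral_diff_le:
  fixes f g :: "'a \<Rightarrow> 'b::{banach, second_countable_topology}"
  assumes "integrable M f" "integrable M g" "\<And>x. norm (f x - g x) \<le> e"
  shows "norm ((LINT x|M. f x) - (LINT x|M. g x)) \<le> e * \<alpha>"
  using norm_integral_le[of "\<lambda>x. f x - g x" e] assms by simp

text \<open>Tube lemma: compactness in the second variable makes continuity in the first one
  uniform.\<close>

lemma uniform_neighbourhood:
  fixes F :: "'a \<times> 'a \<Rightarrow> complex"
  assumes F: "continuous_on UNIV F" and e: "e > 0"
  shows "\<exists>X0. x0 \<in> X0 \<and> open X0 \<and> (\<forall>x\<in>X0. \<forall>y. norm (F (x, y) - F (x0, y)) \<le> e)"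
proof -
  have "continuous_on (UNIV \<times> UNIV) F" using F by simp
  then show ?thesis
    by (rule continuous_on_prod_compactE[OF _ compact_UNIV UNIV_I e])
      (intro exI conjI, assumption, assumption, simp add: dist_norm)
qed

lemma continuous_parametric_integral:
  fixes F :: "'a \<times> 'a \<Rightarrow> complex"
  assumes "continuous_on UNIV F"
  shows "continuous_on UNIV (\<lambda>x. LINT y|M. F (x, y))"
proof (simp add: continuous_on_def, intro allI tendstoI)
  fix x0 :: 'a and e :: real assume e: "e > 0"
  define d where "d = e / (2 * \<alpha>)"
  have d: "d > 0" using e mass_pos by (simp add: d_def)
  have sect: "continuous_on UNIV (\<lambda>y. F (x, y))" for x
    by (intro continuous_on_compose2[OF assms] continuous_intros) auto
  obtain X0 where X0: "x0 \<in> X0" "open X0" "\<And>x y. x \<in> X0 \<Longrightarrow> norm (F (x, y) - F (x0, y)) \<le> d"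
    using uniform_neighbourhood[OF assms d, of x0] by blast
  have "dist (LINT y|M. F (x, y)) (LINT y|M. F (x0, y)) < e" if "x \<in> X0" for x
  proof -
    have "dist (LINT y|M. F (x, y)) (LINT y|M. F (x0, y)) \<le> d * \<alpha>"
      unfolding dist_norm using X0(3)[OF that]
      by (intro norm_integral_diff_le integrable_continuous sect) auto
    also have "\<dots> < e" using e mass_pos by (simp add: d_def)
    finally show ?thesis .
  qed
  then show "\<forall>\<^sub>F x in at x0. dist (LINT y|M. F (x, y)) (LINT y|M. F (x0, y)) < e"
    using X0 eventually_at_topological by blast
qed

text \<open>The group need not be second countable, so the Borel sets of the product may exceed the product
  \<open>\<sigma>\<close>-algebra and the library version of Fubini's theorem does not apply.  By compactness \<open>F\<close> is
  uniformly close to a function \<open>\<Sum>\<^sub>i 1\<^bsub>B i\<^esub>(x) F(d i, y)\<close>.\<close>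
lemma fubini_continuous:
  fixes F :: "'a \<times> 'a \<Rightarrow> complex"
  assumes F: "continuous_on UNIV F"
  shows "(LINT x|M. LINT y|M. F (x, y)) = (LINT y|M. LINT x|M. F (x, y))"
proof -
  have sect1: "continuous_on UNIV (\<lambda>y. F (x, y))" for x
    by (intro continuous_on_compose2[OF F] continuous_intros) auto
  have sect2: "continuous_on UNIV (\<lambda>x. F (x, y))" for y
    by (intro continuous_on_compose2[OF F] continuous_intros) auto
  have par1: "continuous_on UNIV (\<lambda>x. LINT y|M. F (x, y))"
    by (rule continuous_parametric_integral[OF F])
  have "continuous_on UNIV (\<lambda>p. F (snd p, fst p))"
    by (intro continuous_on_compose2[OF F] continuous_intros) auto
  from continuous_parametric_integral[OF this]
  have par2: "continuous_on UNIV (\<lambda>y. LINT x|M. F (x, y))" by simp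
  have small: "norm ((LINT x|M. LINT y|M. F (x, y)) - (LINT y|M. LINT x|M. F (x, y))) \<le> e * (2 * \<alpha> * \<alpha>)"
    if e: "e > 0" for e
  proof -
    obtain X where X: "\<And>x. x \<in> X x" "\<And>x. open (X x)"
      "\<And>x0 x y. x \<in> X x0 \<Longrightarrow> norm (F (x, y) - F (x0, y)) \<le> e"
      using uniform_neighbourhood[OF F e] by metis
    obtain D where D: "finite D" "UNIV = (\<Union>x\<in>D. X x)"
      using compactE_image[OF compact_UNIV, of UNIV X] X by (metis UNIV_I UN_I UNIV_eq_I subsetI top.extremum_unique)
    obtain d and n :: nat where d: "D = d ` {i. i < n}"
      using finite_imp_nat_seg_image_inj_on[OF D(1)] by blast
    \<comment> \<open>Making the cover disjoint leaves exactly one nonzero summand of G at each x,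
      sampled at the centre of the first covering set that contains x.\<close>
    define B where "B = (\<lambda>i. X (d i) - (\<Union>j<i. X (d j)))"
    have B_meas: "B i \<in> sets M" for i
      unfolding B_def sets_M using X by (intro sets.Diff sets.finite_UN) auto
    define G where "G = (\<lambda>x y. \<Sum>i<n. of_real (indicat_real (B i) x) * F (d i, y))"
    have close: "norm (F (x, y) - G x y) \<le> e" for x y
    proof -
      define i where "i = (LEAST i. i < n \<and> x \<in> X (d i))"
      have "\<exists>i. i < n \<and> x \<in> X (d i)" using D(2) d by blast
      from LeastI_ex[OF this] have i: "i < n" "x \<in> X (d i)" unfolding i_def by auto
      have not: "x \<notin> X (d j)" if "j < i" for j
        using not_less_Least[of j "\<lambda>i. i < n \<and> x \<in> X (d i)"] that i(1) unfolding i_def by auto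
      have "x \<in> B j \<longleftrightarrow> j = i" if "j < n" for j
        using i not by (auto simp: B_def intro: linorder_cases[of i j])
      then have "G x y = (\<Sum>j<n. if j = i then F (d j, y) else 0)"
        unfolding G_def by (intro sum.cong) (auto simp: indicator_def)
      also have "\<dots> = F (d i, y)" using i by simp
      finally show ?thesis using X(3)[OF i(2)] by simp
    qed
    have intG: "integrable M (\<lambda>x. of_real (indicat_real (B i) x) * c)" for i and c :: complex
      using B_meas by (intro integrable_mult_left integrable_of_real) (auto simp: less_top[symmetric])
    have G1: "(LINT y|M. G x y) = (\<Sum>i<n. of_real (indicat_real (B i) x) * (LINT y|M. F (d i, y)))" for x
      unfolding G_def by (subst Bochner_Integration.integral_sum)
        (auto intro!: integrable_mult_right[OF integrable_continuous[OF sect1]])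
    have G2: "(LINT x|M. G x y) = (\<Sum>i<n. of_real (measure M (B i)) * F (d i, y))" for y
      unfolding G_def using intG B_meas by (subst Bochner_Integration.integral_sum) auto
    have iG1: "integrable M (\<lambda>x. LINT y|M. G x y)"
      unfolding G1 by (intro Bochner_Integration.integrable_sum intG)
    have iG2: "integrable M (\<lambda>y. LINT x|M. G x y)"
      unfolding G2 by (intro Bochner_Integration.integrable_sum integrable_mult_right integrable_continuous sect1)
    have GG: "(LINT x|M. LINT y|M. G x y) = (LINT y|M. LINT x|M. G x y)"
      unfolding G1 G2 using intG B_meas
      by (subst (1 2) Bochner_Integration.integral_sum) (auto intro!: integrable_mult_right[OF integrable_continuous] sect1 par1 continuous_intros)
    have iGx: "integrable M (\<lambda>y. G x y)" for x
      unfolding G_def by (intro Bochner_Integration.integrable_sum integrable_mult_right integrable_continuous sect1)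
    have iGy: "integrable M (\<lambda>x. G x y)" for y
      unfolding G_def by (intro Bochner_Integration.integrable_sum intG)
    have a1: "norm ((LINT x|M. LINT y|M. F (x, y)) - (LINT x|M. LINT y|M. G x y)) \<le> (e * \<alpha>) * \<alpha>"
      by (intro norm_integral_diff_le integrable_continuous par1 iG1 sect1 iGx close)
    have a2: "norm ((LINT y|M. LINT x|M. F (x, y)) - (LINT y|M. LINT x|M. G x y)) \<le> (e * \<alpha>) * \<alpha>"
      by (intro norm_integral_diff_le integrable_continuous par2 iG2 sect2 iGy close)
    have "norm ((LINT x|M. LINT y|M. F (x, y)) - (LINT y|M. LINT x|M. F (x, y))) \<le> (e * \<alpha>) * \<alpha> + (e * \<alpha>) * \<alpha>"
      using norm_triangle_mono[OF a1 a2[unfolded norm_minus_commute]] GG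
        norm_triangle_le[OF add_mono[OF a1 a2[unfolded norm_minus_commute[of "LINT y|M. LINT x|M. F (x, y)"]]]] by simp
    then show ?thesis by (simp add: algebra_simps)
  qed
  have "norm ((LINT x|M. LINT y|M. F (x, y)) - (LINT y|M. LINT x|M. F (x, y))) \<le> 0"
  proof (rule field_le_epsilon)
    fix e :: real assume "e > 0"
    then show "norm ((LINT x|M. LINT y|M. F (x, y)) - (LINT y|M. LINT x|M. F (x, y))) \<le> 0 + e"
      using small[of "e / (2 * \<alpha> * \<alpha>)"] mass_pos by simp
  qed
  then show ?thesis by simp
qed

lemma continuous_compose:
  "continuous_on UNIV f \<Longrightarrow> continuous_on S g \<Longrightarrow> continuous_on S (\<lambda>x. f (g x))"
  by (rule continuous_on_compose2[of UNIV f]) auto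

text \<open>f (y - x) is integrated over both variables: the inner integral over y is that of f, the
  inner integral over x that of f (- x). Fubini yields invariance under inversion without uniqueness
  of Haar measure.\<close>

lemma integral_uminus:
  fixes f :: "'a \<Rightarrow> complex"
  assumes f: "continuous_on UNIV f"
  shows "(LINT x|M. f (- x)) = (LINT x|M. f x)"
proof -
  have c1: "continuous_on UNIV (\<lambda>p :: 'a \<times> 'a. f (snd p - fst p))"
    by (intro continuous_compose[OF f] continuous_intros)
  have c2: "continuous_on UNIV (\<lambda>x. f (- x))"
    by (intro continuous_compose[OF f] continuous_intros)
  have "(LINT y|M. f (y - x)) = (LINT y|M. f y)" for x
    using integral_translate[OF continuous_measurable[OF f], of "-x"] by simp
  moreover have "(LINT x|M. f (y - x)) = (LINT x|M. f (- x))" for y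
    using integral_translate[OF continuous_measurable[OF c2], of "-y"] by simp
  ultimately have "of_real \<alpha> * (LINT x|M. f x) = of_real \<alpha> * (LINT x|M. f (- x))"
    using fubini_continuous[OF c1] by (simp add: scaleR_conv_of_real)
  then show ?thesis using mass_pos by simp
qed

lemma integral_minus_translate:
  fixes f :: "'a \<Rightarrow> complex"
  assumes f: "continuous_on UNIV f"
  shows "(LINT x|M. f (g - x)) = (LINT x|M. f x)"
proof -
  have c2: "continuous_on UNIV (\<lambda>x. f (- x))"
    by (intro continuous_compose[OF f] continuous_intros)
  show ?thesis
    using integral_translate[OF continuous_measurable[OF c2], of "-g"] integral_uminus[OF f] by simp
qed

section \<open>The convolution algebra of continuous functions\<close>

definition conv :: "('a \<Rightarrow> complex) \<Rightarrow> ('a \<Rightarrow> complex) \<Rightarrow> 'a \<Rightarrow> complex" (infixl "\<star>" 75) where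
  "(f \<star> g) x = (LINT y|M. f (x - y) * g y)"

text \<open>The involution of the convolution algebra, corresponding to complex conjugation of the
  transform; \<open>adj f = f\<close> makes convolution by f a self-adjoint operator.\<close>

definition adj :: "('a \<Rightarrow> complex) \<Rightarrow> 'a \<Rightarrow> complex" where
  "adj f x = cnj (f (- x))"

text \<open>Kept squared because in this form it is a value of a convolution and adds up when a
  self-adjoint idempotent splits.\<close>

definition sqnorm :: "('a \<Rightarrow> complex) \<Rightarrow> real" where
  "sqnorm f = (LINT x|M. (norm (f x))\<^sup>2)"

abbreviation continuous_fun :: "('a \<Rightarrow> complex) \<Rightarrow> bool" where
  "continuous_fun f \<equiv> continuous_on UNIV f"

lemma continuous_conv [continuous_intros]:
  assumes f: "continuous_fun f" and g: "continuous_fun g"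
  shows "continuous_fun (f \<star> g)"
proof -
  have "continuous_on UNIV (\<lambda>p. f (fst p - snd p) * g (snd p))"
    by (intro continuous_intros continuous_compose[OF f] continuous_compose[OF g])
  from continuous_parametric_integral[OF this] show ?thesis
    by (simp add: conv_def[abs_def])
qed

lemma continuous_adj [continuous_intros]:
  assumes f: "continuous_fun f"
  shows "continuous_fun (adj f)"
  unfolding adj_def[abs_def] by (intro continuous_intros continuous_compose[OF f])

lemma conv_commute:
  assumes f: "continuous_fun f" and g: "continuous_fun g"
  shows "f \<star> g = g \<star> f"
proof
  fix x
  have c: "continuous_fun (\<lambda>y. f (x - y) * g y)"
    by (intro continuous_intros continuous_compose[OF f] continuous_compose[OF g])
  show "(f \<star> g) x = (g \<star> f) x"
    unfolding conv_def using integral_minus_translate[OF c, of x] by (simp add: mult.commute)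
qed

lemma conv_assoc:
  assumes f: "continuous_fun f" and g: "continuous_fun g" and h: "continuous_fun h"
  shows "f \<star> g \<star> h = f \<star> (g \<star> h)"
proof
  fix x
  have c: "continuous_on UNIV (\<lambda>p. f (x - fst p) * (g (fst p - snd p) * h (snd p)))"
    by (intro continuous_intros continuous_compose[OF f] continuous_compose[OF g] continuous_compose[OF h])
  have c2: "continuous_fun (\<lambda>y. f (x - y) * g (y - z))" for z
    by (intro continuous_intros continuous_compose[OF f] continuous_compose[OF g])
  have "(f \<star> (g \<star> h)) x = (LINT y|M. LINT z|M. f (x - y) * (g (y - z) * h z))"
    by (simp add: conv_def)
  also have "\<dots> = (LINT z|M. LINT y|M. f (x - y) * (g (y - z) * h z))"
    using fubini_continuous[OF c] by simp
  also have "\<dots> = (LINT z|M. (LINT y|M. f (x - y) * g (y - z)) * h z)"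
    by (simp flip: mult.assoc)
  also have "\<dots> = (LINT z|M. (LINT y|M. f (x - z - y) * g y) * h z)"
  proof -
    have "(LINT y|M. f (x - y) * g (y - z)) = (LINT y|M. f (x - z - y) * g y)" for z
      using integral_translate[OF continuous_measurable[OF c2], of z z] by (simp add: diff_diff_eq add.commute)
    then show ?thesis by simp
  qed
  also have "\<dots> = (f \<star> g \<star> h) x" by (simp add: conv_def)
  finally show "(f \<star> g \<star> h) x = (f \<star> (g \<star> h)) x" by simp
qed

lemma adj_adj [simp]: "adj (adj f) = f"
  by (simp add: adj_def fun_eq_iff)

lemma adj_conv:
  assumes f: "continuous_fun f" and g: "continuous_fun g"
  shows "adj (f \<star> g) = adj f \<star> adj g"
proof
  fix x
  have c: "continuous_fun (\<lambda>y. cnj (f (- x - y) * g y))"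
    by (intro continuous_intros continuous_compose[OF f] continuous_compose[OF g])
  have "adj (f \<star> g) x = (LINT y|M. cnj (f (- x - y) * g y))"
    unfolding adj_def conv_def by (rule Bochner_Integration.integral_cnj[symmetric])
  also have "\<dots> = (LINT y|M. cnj (f (- x - (- y)) * g (- y)))"
    by (rule integral_uminus[OF c, symmetric])
  also have "\<dots> = (adj f \<star> adj g) x"
    by (simp add: adj_def conv_def)
  finally show "adj (f \<star> g) x = (adj f \<star> adj g) x" .
qed

lemma integrable_power2_norm:
  "continuous_fun f \<Longrightarrow> integrable M (\<lambda>x. (norm (f x))\<^sup>2)"
  by (intro integrable_continuous continuous_intros)

lemma sqnorm_nonneg: "sqnorm f \<ge> 0"
  by (simp add: sqnorm_def)

lemma of_real_sqnorm:
  "continuous_fun f \<Longrightarrow> complex_of_real (sqnorm f) = (LINT x|M. of_real ((norm (f x))\<^sup>2))"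
  unfolding sqnorm_def by (intro integral_of_real[symmetric] integrable_continuous continuous_intros)

lemma conv_adj_0:
  assumes f: "continuous_fun f"
  shows "(f \<star> adj f) 0 = of_real (sqnorm f)"
proof -
  have c: "continuous_fun (\<lambda>y. of_real ((norm (f y))\<^sup>2))"
    by (intro continuous_intros f)
  have "(f \<star> adj f) 0 = (LINT y|M. of_real ((norm (f (- y)))\<^sup>2))"
    by (simp add: conv_def adj_def complex_norm_square flip: of_real_power)
  also have "\<dots> = (LINT y|M. of_real ((norm (f y))\<^sup>2))"
    using integral_uminus[OF c] by simp
  also have "\<dots> = of_real (sqnorm f)"
    by (rule of_real_sqnorm[OF f, symmetric])
  finally show ?thesis .
qed

lemma cauchy_schwarz:
  assumes f: "continuous_fun f" and g: "continuous_fun g"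
  shows "(norm (LINT x|M. f x * g x))\<^sup>2 \<le> sqnorm f * sqnorm g"
proof -
  define C where "C = (LINT x|M. norm (f x) * norm (g x))"
  have i: "integrable M (\<lambda>x. norm (f x) * norm (g x))"
    by (intro integrable_continuous continuous_intros f g)
  have C0: "C \<ge> 0" by (simp add: C_def)
  have "norm (LINT x|M. f x * g x) \<le> (LINT x|M. norm (f x * g x))" by simp
  then have nC: "norm (LINT x|M. f x * g x) \<le> C" by (simp add: C_def norm_mult)
  \<comment> \<open>A quadratic polynomial in t that is never negative. Its minimum is at C /
    \<open>sqnorm g\<close>; if the leading coefficient vanishes, the remaining linear function is
    bounded below only if C = 0.\<close>
  have q: "0 \<le> sqnorm f - 2 * t * C + t\<^sup>2 * sqnorm g" for t
  proof -
    have "0 \<le> (LINT x|M. (norm (f x) - t * norm (g x))\<^sup>2)" by simp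
    also have "\<dots> = (LINT x|M. (norm (f x))\<^sup>2 - (2 * t) * (norm (f x) * norm (g x)) + t\<^sup>2 * (norm (g x))\<^sup>2)"
      by (intro Bochner_Integration.integral_cong) (auto simp: power2_diff power_mult_distrib algebra_simps)
    also have "\<dots> = sqnorm f - 2 * t * C + t\<^sup>2 * sqnorm g"
      using i integrable_power2_norm[OF f] integrable_power2_norm[OF g]
      by (simp add: sqnorm_def C_def)
    finally show ?thesis .
  qed
  have "C\<^sup>2 \<le> sqnorm f * sqnorm g"
  proof (cases "sqnorm g = 0")
    case True
    have "C = 0"
    proof (rule ccontr)
      assume "C \<noteq> 0"
      then show False using q[of "(sqnorm f + 1) / (2 * C)"] True by (simp add: field_simps)
    qed
    then show ?thesis using True by simp
  next
    case False
    then have "sqnorm g > 0" using sqnorm_nonneg[of g] by simp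
    then show ?thesis using q[of "C / sqnorm g"] by (simp add: field_simps power2_eq_square)
  qed
  moreover have "(norm (LINT x|M. f x * g x))\<^sup>2 \<le> C\<^sup>2"
    using nC by (intro power_mono) auto
  ultimately show ?thesis by linarith
qed

lemma sqnorm_reflect:
  assumes f: "continuous_fun f"
  shows "sqnorm (\<lambda>y. f (x - y)) = sqnorm f"
proof -
  have c: "continuous_fun (\<lambda>y. of_real ((norm (f y))\<^sup>2))"
    by (intro continuous_intros f)
  have "continuous_fun (\<lambda>y. f (x - y))"
    by (intro continuous_compose[OF f] continuous_intros)
  then have "(complex_of_real (sqnorm (\<lambda>y. f (x - y)))) = of_real (sqnorm f)"
    unfolding of_real_sqnorm[OF f] using integral_minus_translate[OF c] by (simp only: of_real_sqnorm)
  then show ?thesis by simp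
qed

text \<open>Cauchy-Schwarz for each x. The bound does not depend on x, so convolution turns L2
  estimates into sup norm estimates.\<close>

lemma norm_conv_le:
  assumes f: "continuous_fun f" and g: "continuous_fun g"
  shows "(norm ((f \<star> g) x))\<^sup>2 \<le> sqnorm f * sqnorm g"
proof -
  have "continuous_fun (\<lambda>y. f (x - y))"
    by (intro continuous_compose[OF f] continuous_intros)
  from cauchy_schwarz[OF this g] show ?thesis
    by (simp add: conv_def sqnorm_reflect[OF f])
qed

lemma sqnorm_conv_le:
  assumes f: "continuous_fun f" and g: "continuous_fun g"
  shows "sqnorm (f \<star> g) \<le> \<alpha> * (sqnorm f * sqnorm g)"
proof -
  have "norm (sqnorm (f \<star> g)) \<le> (sqnorm f * sqnorm g) * \<alpha>"
    unfolding sqnorm_def[of "f \<star> g"]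
    using norm_conv_le[OF f g] by (intro norm_integral_le integrable_power2_norm continuous_intros f g) auto
  then show ?thesis by (simp add: mult.commute)
qed

text \<open>A nonempty open set has positive measure because finitely many translates of it cover the group.\<close>
lemma open_measure_pos:
  assumes U: "open U" "x0 \<in> U"
  shows "measure M U > 0"
proof (rule ccontr)
  assume "\<not> measure M U > 0"
  then have 0: "measure M U = 0" using measure_nonneg[of M U] by linarith
  have Um: "U \<in> sets borel" using U by auto
  have *: "emeasure M ((+) g ` U) = 0" for g
    using emeasure_translate[OF Um] 0 by (simp add: emeasure_eq_measure)
  have op: "open ((+) g ` U)" for g
  proof -
    have "(+) g ` U = (\<lambda>x. x - g) -` U" by (force simp: image_iff)
    then show ?thesis using U by (auto intro!: open_vimage continuous_intros)
  qed
  have "UNIV \<subseteq> (\<Union>g\<in>UNIV. (+) g ` U)"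
  proof
    fix x show "x \<in> (\<Union>g\<in>UNIV. (+) g ` U)"
      using U(2) by (auto intro!: exI[of _ "x - x0"] image_eqI[of _ _ x0])
  qed
  then obtain D where D: "finite D" "UNIV \<subseteq> (\<Union>g\<in>D. (+) g ` U)"
    using compactE_image[OF compact_UNIV, of UNIV "\<lambda>g. (+) g ` U"] op by metis
  have "emeasure M UNIV \<le> emeasure M (\<Union>g\<in>D. (+) g ` U)"
    using D op by (intro emeasure_mono) (auto simp: sets_M intro!: sets.finite_UN)
  also have "\<dots> \<le> (\<Sum>g\<in>D. emeasure M ((+) g ` U))"
    using D op by (intro emeasure_subadditive_finite) (auto simp: sets_M)
  also have "\<dots> = 0" using * by simp
  finally show False using mass_pos by (simp add: emeasure_eq_measure)
qed

text \<open>The set where f does not vanish is open and null, and nonempty open sets are not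
  null.\<close>

lemma continuous_sqnorm_0:
  assumes f: "continuous_fun f" and 0: "sqnorm f = 0"
  shows "f x = 0"
proof (rule ccontr)
  assume "f x \<noteq> 0"
  have "(AE x in M. (norm (f x))\<^sup>2 = 0)"
    using 0 integrable_power2_norm[OF f] unfolding sqnorm_def
    by (subst (asm) integral_nonneg_eq_0_iff_AE) auto
  then have "AE x in M. f x = 0" by simp
  moreover have op: "open (f -` (- {0}))" by (intro open_vimage f) auto
  ultimately have "emeasure M (f -` (- {0})) = 0"
    by (subst (asm) AE_iff_measurable[of "f -` (- {0})"]) (auto simp: sets_M)
  moreover have "measure M (f -` (- {0})) > 0"
    using open_measure_pos[OF op, of x] \<open>f x \<noteq> 0\<close> by simp
  ultimately show False by (simp add: measure_def)
qed

lemma sqnorm_pos: "continuous_fun f \<Longrightarrow> f \<noteq> (\<lambda>_. 0) \<Longrightarrow> sqnorm f > 0"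
  using continuous_sqnorm_0[of f] sqnorm_nonneg[of f] by (auto simp: fun_eq_iff less_le)

section \<open>The top spectral projection of a convolution operator\<close>

lemma conv_scale_left: "(\<lambda>x. c * f x) \<star> g = (\<lambda>x. c * (f \<star> g) x)"
  by (simp add: conv_def fun_eq_iff mult.assoc)

lemma conv_scale_right: "f \<star> (\<lambda>x. c * g x) = (\<lambda>x. c * (f \<star> g) x)"
  by (simp add: conv_def fun_eq_iff mult.left_commute)

lemma conv_integrand:
  assumes "continuous_fun f" "continuous_fun g"
  shows "integrable M (\<lambda>y. f (x - y) * g y)"
  by (intro integrable_continuous continuous_intros continuous_compose[OF assms(1)] assms)

lemma conv_add_left:
  assumes "continuous_fun f" "continuous_fun g" "continuous_fun h"
  shows "(\<lambda>x. f x + g x) \<star> h = (\<lambda>x. (f \<star> h) x + (g \<star> h) x)"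
  using assms by (simp add: conv_def fun_eq_iff distrib_right conv_integrand)

lemma conv_diff_left:
  assumes "continuous_fun f" "continuous_fun g" "continuous_fun h"
  shows "(\<lambda>x. f x - g x) \<star> h = (\<lambda>x. (f \<star> h) x - (g \<star> h) x)"
  using assms by (simp add: conv_def fun_eq_iff left_diff_distrib conv_integrand)

lemma conv_add_right:
  assumes "continuous_fun f" "continuous_fun g" "continuous_fun h"
  shows "f \<star> (\<lambda>x. g x + h x) = (\<lambda>x. (f \<star> g) x + (f \<star> h) x)"
  using assms by (simp add: conv_def fun_eq_iff distrib_left conv_integrand)

lemma conv_diff_right:
  assumes "continuous_fun f" "continuous_fun g" "continuous_fun h"
  shows "f \<star> (\<lambda>x. g x - h x) = (\<lambda>x. (f \<star> g) x - (f \<star> h) x)"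
  using assms by (simp add: conv_def fun_eq_iff right_diff_distrib conv_integrand)

lemma tendsto_integral_uniform:
  fixes f :: "nat \<Rightarrow> 'a \<Rightarrow> complex"
  assumes lim: "uniform_limit UNIV f l sequentially"
    and int: "\<And>n. integrable M (f n)" "integrable M l"
  shows "(\<lambda>n. LINT x|M. f n x) \<longlonglongrightarrow> (LINT x|M. l x)"
proof (rule tendstoI)
  fix e :: real assume e: "e > 0"
  define d where "d = e / (2 * \<alpha>)"
  have d: "d > 0" "d * \<alpha> < e" using e mass_pos by (auto simp: d_def)
  have "\<forall>\<^sub>F n in sequentially. \<forall>x. dist (f n x) (l x) < d"
    using uniform_limitD[OF lim d(1)] by simp
  then show "\<forall>\<^sub>F n in sequentially. dist (LINT x|M. f n x) (LINT x|M. l x) < e"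
  proof eventually_elim
    case (elim n)
    have "norm ((LINT x|M. f n x) - (LINT x|M. l x)) \<le> d * \<alpha>"
      using elim by (intro norm_integral_diff_le int) (auto simp: dist_norm less_imp_le)
    then show ?case using d by (simp add: dist_norm)
  qed
qed

lemma tendsto_conv:
  assumes f: "uniform_limit UNIV f l sequentially" "\<And>n. continuous_fun (f n)" "continuous_fun l"
    and g: "uniform_limit UNIV g m sequentially" "\<And>n. continuous_fun (g n)" "continuous_fun m"
  shows "(\<lambda>n. (f n \<star> g n) x) \<longlonglongrightarrow> (l \<star> m) x"
  unfolding conv_def
proof (rule tendsto_integral_uniform[OF _ conv_integrand conv_integrand])
  have 1: "uniform_limit UNIV (\<lambda>n y. f n (x - y)) (\<lambda>y. l (x - y)) sequentially"
    by (rule uniform_limit_compose'[OF f(1)]) simp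
  have "continuous_fun (\<lambda>y. l (x - y))"
    by (intro continuous_compose[OF f(3)] continuous_intros)
  then have 2: "bounded (range (\<lambda>y. l (x - y)))" "bounded (range m)"
    using compact_imp_bounded compact_continuous_image compact_UNIV g(3) by blast+
  show "uniform_limit UNIV (\<lambda>n y. f n (x - y) * g n y) (\<lambda>y. l (x - y) * m y) sequentially"
    by (rule uniform_lim_mult[OF 1 g(1) 2])
qed (use f g in auto)

text \<open>Makes \<open>sqnorm\<close> behave like a trace: on self-adjoint idempotents it agrees
  with a linear functional, evaluation at 0.\<close>

lemma idempotent_value_0:
  assumes "continuous_fun e" "e \<star> e = e" "adj e = e"
  shows "e 0 = of_real (sqnorm e)"
  using conv_adj_0[OF assms(1)] assms by simp

text \<open>From e = e \<star> e and submultiplicativity up to the factor \<alpha>, one factor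
  \<open>sqnorm e\<close> cancels. This gap is what produces minimal idempotents.\<close>

lemma idempotent_sqnorm_ge:
  assumes "continuous_fun e" "e \<star> e = e" "e \<noteq> (\<lambda>_. 0)"
  shows "sqnorm e \<ge> 1 / \<alpha>"
  using sqnorm_conv_le[OF assms(1,1)] sqnorm_pos[OF assms(1,3)] mass_pos assms(2)
  by (simp add: field_simps)

text \<open>The power method: with \<open>c\<^sub>n = \<parallel>k\<^bsup>\<star>(n+1)\<^esup>\<parallel>\<^sub>2\<^sup>2\<close> and \<open>\<rho> = lim c\<^bsub>n+1\<^esub>/c\<^sub>n\<close>, the normalised even convolution
  powers of \<open>k\<close> converge uniformly to the spectral projection \<open>e\<close> of \<open>k \<star> k\<close> at its top eigenvalue \<open>\<rho>\<close>.
  Log-convexity of \<open>c\<close> makes the sequence Cauchy; submultiplicativity keeps the limit away from 0.\<close>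
lemma top_spectral_projection:
  assumes k: "continuous_fun k" "adj k = k" "k \<noteq> (\<lambda>_. 0)"
  obtains \<rho> :: real and e where "\<rho> > 0" "continuous_fun e" "e \<star> e = e" "adj e = e" "e \<noteq> (\<lambda>_. 0)"
    "k \<star> k \<star> e = (\<lambda>x. of_real \<rho> * e x)"
proof -
  \<comment> \<open>\<open>u n\<close> is the convolution power of order n + 1. Hence indices add
    with an extra 1, and the odd index 2n + 1 denotes the even power 2n + 2.\<close>
  define u where "u = (\<lambda>n. ((\<star>) k ^^ n) k)"
  have u0: "u 0 = k" and uS: "u (Suc n) = k \<star> u n" for n by (simp_all add: u_def)
  have uc [continuous_intros]: "continuous_fun (u n)" for n
    by (induction n) (auto simp: u0 uS intro!: continuous_intros k)
  have uu: "u m \<star> u n = u (m + n + 1)" for m n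
    by (induction m) (auto simp: u0 uS conv_assoc k uc)
  have ua: "adj (u n) = u n" for n
    by (induction n) (auto simp: u0 uS adj_conv k uc)
  define c where "c = (\<lambda>n. sqnorm (u n))"
  have cval: "u (2 * n + 1) 0 = of_real (c n)" for n
    using conv_adj_0[OF uc, of n] by (simp add: ua uu c_def mult_2)
  have logconv: "(c (Suc n))\<^sup>2 \<le> c n * c (Suc (Suc n))" for n
  proof -
    have "(norm ((u n \<star> u (Suc (Suc n))) 0))\<^sup>2 \<le> c n * c (Suc (Suc n))"
      unfolding c_def by (intro norm_conv_le uc)
    also have "(u n \<star> u (Suc (Suc n))) 0 = of_real (c (Suc n))"
      using cval[of "Suc n"] by (simp add: uu mult_2)
    finally show ?thesis by simp
  qed
  have c_pos: "c n > 0 \<and> c (Suc n) > 0" for n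
  proof (induction n)
    case 0
    have "c 0 > 0" using sqnorm_pos[OF k(1,3)] by (simp add: c_def u0)
    moreover have "u 1 0 = of_real (c 0)" using cval[of 0] by simp
    ultimately have "u 1 \<noteq> (\<lambda>_. 0)" by auto
    then have "c 1 > 0" using sqnorm_pos[OF uc] by (simp add: c_def)
    then show ?case using \<open>c 0 > 0\<close> by simp
  next
    case (Suc n)
    then have "0 < c n * c (Suc (Suc n))"
      using logconv[of n] by (smt (verit) zero_less_power)
    then show ?case using Suc by (simp add: zero_less_mult_iff)
  qed
  then have cp: "c n > 0" for n by blast
  have submult: "c (m + n + 1) \<le> \<alpha> * (c m * c n)" for m n
    using sqnorm_conv_le[OF uc uc, of m n] by (simp add: uu c_def)
  define r where "r = (\<lambda>n. c (Suc n) / c n)"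
  have r_inc: "incseq r"
    using logconv cp by (intro incseq_SucI) (simp add: r_def field_simps power2_eq_square)
  have r_bd: "r n \<le> \<alpha> * c 0" for n
    using submult[of 0 n] cp[of n] by (simp add: r_def field_simps)
  obtain \<rho> where \<rho>: "r \<longlonglongrightarrow> \<rho>" "\<And>n. r n \<le> \<rho>"
    using incseq_convergent[OF r_inc] r_bd by blast
  have "r 0 > 0" using cp by (simp add: r_def)
  then have \<rho>_pos: "\<rho> > 0" using \<rho>(2)[of 0] by linarith
  \<comment> \<open>The squared norms divided by their growth rate. The ratios of c never exceed
    \<rho>, so b decreases.\<close>
  define b where "b = (\<lambda>n. c n / \<rho> ^ (n + 1))"
  have b_pos: "b n > 0" for n using cp \<rho>_pos by (simp add: b_def)
  have b_ratio: "b (Suc n) / b n = r n / \<rho>" for n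
    using cp[of n] \<rho>_pos by (simp add: b_def r_def field_simps)
  have b_dec: "b (Suc n) \<le> b n" for n
  proof -
    have "b (Suc n) / b n \<le> 1" unfolding b_ratio using \<rho>(2)[of n] \<rho>_pos by simp
    then show ?thesis using b_pos[of n] by (simp add: field_simps)
  qed
  have b_ratio1: "(\<lambda>n. b (Suc n) / b n) \<longlonglongrightarrow> 1"
    unfolding b_ratio using tendsto_divide[OF \<rho>(1) tendsto_const[of \<rho>]] \<rho>_pos by simp
  have b_ratio_j: "(\<lambda>n. b (n + j) / b n) \<longlonglongrightarrow> 1" for j
  proof (induction j)
    case 0
    then show ?case using b_pos by (simp add: less_imp_neq[THEN not_sym])
  next
    case (Suc j)
    have "(\<lambda>n. (b (Suc (n + j)) / b (n + j)) * (b (n + j) / b n)) \<longlonglongrightarrow> 1 * 1"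
      by (intro tendsto_mult Suc LIMSEQ_ignore_initial_segment[OF b_ratio1])
    moreover have "(b (Suc (n + j)) / b (n + j)) * (b (n + j) / b n) = b (n + Suc j) / b n" for n
      using b_pos[of "n + j"] by simp
    ultimately show ?case by (simp only: mult_1)
  qed
  have b_submult: "b (m + n + 1) \<le> \<alpha> * b n * b m" for m n
  proof -
    have "b (m + n + 1) \<le> \<alpha> * (c m * c n) / \<rho> ^ (m + n + 1 + 1)"
      unfolding b_def using submult \<rho>_pos by (intro divide_right_mono) auto
    also have "\<dots> = \<alpha> * b n * b m" by (simp add: b_def power_add mult_ac)
    finally show ?thesis .
  qed
  \<comment> \<open>As m tends to infinity, b (m + n + 1) / b m \<le> \<alpha> b n becomes 1 \<le>
    \<alpha> b n. The limit \<beta>, which will be e 0, is therefore positive.\<close>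
  have b_ge: "b n \<ge> 1 / \<alpha>" for n
  proof -
    have "b (m + (n + 1)) / b m \<le> \<alpha> * b n" for m
      using b_submult[of m n] b_pos[of m] by (simp add: field_simps)
    then have "1 \<le> \<alpha> * b n" using LIMSEQ_le_const2[OF b_ratio_j[of "n + 1"]] by blast
    then show ?thesis using mass_pos by (simp add: field_simps)
  qed
  obtain \<beta> where \<beta>: "b \<longlonglongrightarrow> \<beta>"
    using decseq_convergent[of b 0] b_dec b_pos by (metis decseq_SucI less_imp_le)
  have \<beta>_pos: "\<beta> > 0"
  proof -
    have "\<beta> \<ge> 1 / \<alpha>" by (rule LIMSEQ_le_const[OF \<beta>]) (use b_ge in auto)
    then show ?thesis using mass_pos by (smt (verit) divide_pos_pos)
  qed
  define v where "v = (\<lambda>n x. of_real (1 / \<rho> ^ (n + 1)) * u (2 * n + 1) x)"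
  have vc [continuous_intros]: "continuous_fun (v n)" for n
    unfolding v_def by (intro continuous_intros)
  have va: "adj (v n) = v n" for n
    using ua[of "2 * n + 1"] by (simp add: v_def adj_def fun_eq_iff)
  have vv: "v m \<star> v n = v (m + n + 1)" for m n
  proof -
    have "v m \<star> v n = (\<lambda>x. of_real (1 / \<rho> ^ (m + 1)) * (of_real (1 / \<rho> ^ (n + 1)) * u (2 * (m + n + 1) + 1) x))"
      unfolding v_def conv_scale_left conv_scale_right uu by (simp add: algebra_simps)
    then show ?thesis by (simp add: v_def fun_eq_iff power_add)
  qed
  have v0: "v n 0 = of_real (b n)" for n
    using cval[of n] by (simp add: v_def b_def)
  \<comment> \<open>All three terms converge, to \<beta>, \<beta> and 2\<beta>, so their combination
    tends to 0 and v is Cauchy in L2.\<close>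
  have v_diff: "sqnorm (\<lambda>x. v m x - v n x) = b (2 * m + 1) + b (2 * n + 1) - 2 * b (m + n + 1)" for m n
  proof -
    have ad: "adj (\<lambda>x. v m x - v n x) = (\<lambda>x. v m x - v n x)"
      using va[of m] va[of n] by (simp add: adj_def fun_eq_iff)
    have cd: "continuous_fun (\<lambda>x. v m x - v n x)" by (intro continuous_intros)
    have "complex_of_real (sqnorm (\<lambda>x. v m x - v n x)) = ((\<lambda>x. v m x - v n x) \<star> (\<lambda>x. v m x - v n x)) 0"
      using conv_adj_0[OF cd] by (simp add: ad)
    also have "\<dots> = v (m + m + 1) 0 - v (m + n + 1) 0 - (v (n + m + 1) 0 - v (n + n + 1) 0)"
      by (simp only: conv_diff_left[OF vc vc cd] conv_diff_right[OF vc vc vc] vv)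
    also have "\<dots> = of_real (b (2 * m + 1) + b (2 * n + 1) - 2 * b (m + n + 1))"
      unfolding v0 mult_2[of m] mult_2[of n] add.commute[of n m] by simp
    finally show ?thesis by (simp only: of_real_eq_iff)
  qed
  have Kv: "k \<star> k \<star> v n = (\<lambda>x. of_real \<rho> * v (Suc n) x)" for n
  proof -
    have "k \<star> k = u 1" by (simp add: u0 uS)
    then have "k \<star> k \<star> v n = (\<lambda>x. of_real (1 / \<rho> ^ (n + 1)) * u (2 * Suc n + 1) x)"
      unfolding v_def conv_scale_right by (simp add: uu)
    then show ?thesis using \<rho>_pos by (simp add: v_def fun_eq_iff)
  qed
  have kk: "continuous_fun (k \<star> k)" by (intro continuous_intros k)
  \<comment> \<open>Convolution with k \<star> k multiplies by \<rho> and shifts the index by one,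
    so the sup distance at the shifted indices is controlled by the L2 distance at the original
    ones.\<close>
  have v_close: "(norm (v (Suc m) x - v (Suc n) x))\<^sup>2 \<le> sqnorm (k \<star> k) / \<rho>\<^sup>2 * (b (2 * m + 1) + b (2 * n + 1) - 2 * b (m + n + 1))"
    for m n x
  proof -
    have cd: "continuous_fun (\<lambda>x. v m x - v n x)" by (intro continuous_intros)
    have "(k \<star> k \<star> (\<lambda>x. v m x - v n x)) x = of_real \<rho> * (v (Suc m) x - v (Suc n) x)"
      by (simp only: conv_diff_right[OF kk vc vc] Kv right_diff_distrib)
    then have "\<rho>\<^sup>2 * (norm (v (Suc m) x - v (Suc n) x))\<^sup>2 = (norm ((k \<star> k \<star> (\<lambda>x. v m x - v n x)) x))\<^sup>2"
      using \<rho>_pos by (simp add: norm_mult power_mult_distrib)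
    also have "\<dots> \<le> sqnorm (k \<star> k) * sqnorm (\<lambda>x. v m x - v n x)"
      by (rule norm_conv_le[OF kk cd])
    finally show ?thesis using \<rho>_pos by (simp add: v_diff field_simps)
  qed
  have "uniformly_Cauchy_on UNIV (\<lambda>n. v (Suc n))"
  proof (rule uniformly_Cauchy_onI)
    fix \<epsilon> :: real assume \<epsilon>: "\<epsilon> > 0"
    define Q where "Q = sqnorm (k \<star> k) / \<rho>\<^sup>2"
    \<comment> \<open>With each b within d/4 of \<beta> the combination of four terms is at most d,
      and Q d \<le> \<epsilon>^2 / 2. Dividing by Q + 1 also allows Q = 0.\<close>
    define d where "d = \<epsilon>\<^sup>2 / (Q + 1) / 2"
    have q: "Q \<ge> 0" using sqnorm_nonneg by (simp add: Q_def)
    then have d: "d > 0" using \<epsilon> by (simp add: d_def)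
    obtain N where N: "\<And>n. n \<ge> N \<Longrightarrow> \<bar>b n - \<beta>\<bar> < d / 4"
      using LIMSEQ_D[OF \<beta>, of "d / 4"] d by auto
    show "\<exists>N. \<forall>x\<in>UNIV. \<forall>m\<ge>N. \<forall>n\<ge>N. dist (v (Suc m) x) (v (Suc n) x) < \<epsilon>"
    proof (intro exI[of _ N] ballI allI impI)
      fix x m n assume mn: "m \<ge> N" "n \<ge> N"
      have "b (2 * m + 1) + b (2 * n + 1) - 2 * b (m + n + 1) \<le> d"
        using N[of "2 * m + 1"] N[of "2 * n + 1"] N[of "m + n + 1"] mn by linarith
      then have "(norm (v (Suc m) x - v (Suc n) x))\<^sup>2 \<le> Q * d"
        using v_close[of m x n] q unfolding Q_def by (meson mult_left_mono order_trans)
      also have "\<dots> < \<epsilon>\<^sup>2"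
      proof -
        have "Q * d \<le> (Q + 1) * d" using d by (intro mult_right_mono) auto
        also have "\<dots> = \<epsilon>\<^sup>2 / 2"
        proof -
          have "Q + 1 \<noteq> 0" using q by simp
          then show ?thesis unfolding d_def by (metis nonzero_mult_div_cancel_left times_divide_eq_right)
        qed
        also have "\<dots> < \<epsilon>\<^sup>2" using \<epsilon> by simp
        finally show ?thesis .
      qed
      finally show "dist (v (Suc m) x) (v (Suc n) x) < \<epsilon>"
        using \<epsilon> by (simp add: dist_norm power_less_imp_less_base)
    qed
  qed
  then obtain e where ulim: "uniform_limit UNIV (\<lambda>n. v (Suc n)) e sequentially"
    using Cauchy_uniformly_convergent unfolding uniformly_convergent_on_def by blast
  have ec: "continuous_fun e"
    by (rule uniform_limit_theorem[OF always_eventually ulim]) (simp_all add: vc)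
  have plim: "(\<lambda>n. v (Suc n) x) \<longlonglongrightarrow> e x" for x
    using tendsto_uniform_limitI[OF ulim] by simp
  have plim': "(\<lambda>n. v n x) \<longlonglongrightarrow> e x" for x
    by (rule LIMSEQ_imp_Suc[OF plim])
  show ?thesis
  proof (rule that[OF \<rho>_pos ec])
    show "e \<star> e = e"
    proof
      fix x
      have "(\<lambda>n. (v (Suc n) \<star> v (Suc n)) x) \<longlonglongrightarrow> (e \<star> e) x"
        by (rule tendsto_conv[OF ulim vc ec ulim vc ec])
      moreover have "(\<lambda>n. (v (Suc n) \<star> v (Suc n)) x) \<longlonglongrightarrow> e x"
      proof -
        \<comment> \<open>The square of \<open>v (Suc n)\<close> is v at index 2n + 3, so it runs
          through a subsequence of the same convergent sequence.\<close>
        have "strict_mono (\<lambda>n. Suc n + Suc n + 1)" by (simp add: strict_mono_def)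
        from LIMSEQ_subseq_LIMSEQ[OF plim'[of x] this] show ?thesis
          by (simp add: vv o_def)
      qed
      ultimately show "(e \<star> e) x = e x" by (rule LIMSEQ_unique)
    qed
    show "adj e = e"
    proof
      fix x
      have "(\<lambda>n. adj (v n) x) \<longlonglongrightarrow> adj e x"
        unfolding adj_def by (intro tendsto_intros plim')
      from LIMSEQ_unique[OF this[unfolded va] plim'] show "adj e x = e x" .
    qed
    have "e 0 = of_real \<beta>"
      by (rule LIMSEQ_unique[OF plim'[of 0, unfolded v0] tendsto_of_real[OF \<beta>]])
    then show "e \<noteq> (\<lambda>_. 0)" using \<beta>_pos by auto
    show "k \<star> k \<star> e = (\<lambda>x. of_real \<rho> * e x)"
    proof
      fix x
      have "(\<lambda>n. (k \<star> k \<star> v (Suc n)) x) \<longlonglongrightarrow> (k \<star> k \<star> e) x"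
        by (rule tendsto_conv[OF uniform_limit_const kk kk ulim vc ec])
      moreover have "(\<lambda>n. (k \<star> k \<star> v (Suc n)) x) \<longlonglongrightarrow> of_real \<rho> * e x"
        unfolding Kv by (rule tendsto_mult[OF tendsto_const LIMSEQ_Suc[OF plim]])
      ultimately show "(k \<star> k \<star> e) x = of_real \<rho> * e x" by (rule LIMSEQ_unique)
    qed
  qed
qed

section \<open>Characters\<close>

lemma char_continuous: "(\<gamma> :: 'a \<Rightarrow> complex) \<in> characters \<Longrightarrow> continuous_fun \<gamma>"
  and char_norm: "(\<gamma> :: 'a \<Rightarrow> complex) \<in> characters \<Longrightarrow> norm (\<gamma> x) = 1"
  and char_add: "(\<gamma> :: 'a \<Rightarrow> complex) \<in> characters \<Longrightarrow> \<gamma> (x + y) = \<gamma> x * \<gamma> y"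
  by (auto simp: characters_def)

lemma char_cnj:
  fixes \<gamma> :: "'a \<Rightarrow> complex"
  assumes "\<gamma> \<in> characters"
  shows "\<gamma> x * cnj (\<gamma> x) = 1"
  using complex_norm_square[of "\<gamma> x"] char_norm[OF assms] by simp

lemma char_0:
  fixes \<gamma> :: "'a \<Rightarrow> complex"
  assumes "\<gamma> \<in> characters"
  shows "\<gamma> 0 = 1"
  using char_add[OF assms, of 0 0] char_norm[OF assms, of 0] by auto

lemma char_uminus:
  fixes \<gamma> :: "'a \<Rightarrow> complex"
  assumes "\<gamma> \<in> characters"
  shows "\<gamma> (- x) = cnj (\<gamma> x)"
proof -
  have "\<gamma> x * \<gamma> (- x) = \<gamma> x * cnj (\<gamma> x)"
    using char_add[OF assms, of x "- x"] char_0[OF assms] char_cnj[OF assms, of x] by simp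
  moreover have "\<gamma> x \<noteq> 0" using char_norm[OF assms, of x] by auto
  ultimately show ?thesis by simp
qed

text \<open>Characters are eigenfunctions of every convolution operator, the eigenvalue being the
  Fourier coefficient. Multiplicativity of the transform and orthogonality of characters both follow
  from this.\<close>

lemma char_conv:
  assumes "\<gamma> \<in> characters"
  shows "\<gamma> \<star> f = (\<lambda>x. \<gamma> x * fourier M f \<gamma>)"
proof
  fix x
  have "\<gamma> (x - y) * f y = \<gamma> x * (f y * cnj (\<gamma> y))" for y
    using char_add[OF assms, of x "- y"] by (simp add: char_uminus[OF assms])
  then show "(\<gamma> \<star> f) x = \<gamma> x * fourier M f \<gamma>"
    unfolding conv_def fourier_def by (simp only: integral_mult_right_zero)
qed

lemma fourier_conv:
  assumes \<gamma>: "\<gamma> \<in> characters" and f: "continuous_fun f" and g: "continuous_fun g"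
  shows "fourier M (f \<star> g) \<gamma> = fourier M f \<gamma> * fourier M g \<gamma>"
proof -
  note c = char_continuous[OF \<gamma>]
  have "(\<gamma> \<star> (f \<star> g)) 0 = (\<gamma> \<star> f \<star> g) 0" using conv_assoc[OF c f g] by simp
  also have "\<dots> = ((\<lambda>x. fourier M f \<gamma> * \<gamma> x) \<star> g) 0"
    by (simp add: char_conv[OF \<gamma>] mult.commute)
  also have "\<dots> = fourier M f \<gamma> * (\<gamma> \<star> g) 0" by (simp only: conv_scale_left)
  finally show ?thesis by (simp add: char_conv[OF \<gamma>] char_0[OF \<gamma>])
qed

lemma fourier_scale: "fourier M (\<lambda>x. c * f x) \<gamma> = c * fourier M f \<gamma>"
  by (simp add: fourier_def mult.assoc)

lemma fourier_integrand:
  assumes "integrable M f" "\<gamma> \<in> characters"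
  shows "integrable M (\<lambda>x. f x * cnj (\<gamma> x))"
proof (rule Bochner_Integration.integrable_bound[OF assms(1)])
  have "(\<lambda>x. cnj (\<gamma> x)) \<in> borel_measurable M"
    by (intro continuous_measurable continuous_intros char_continuous assms)
  then show "(\<lambda>x. f x * cnj (\<gamma> x)) \<in> borel_measurable M"
    using borel_measurable_times[OF borel_measurable_integrable[OF assms(1)]] by blast
qed (simp add: norm_mult char_norm assms)

lemma fourier_diff:
  assumes "integrable M f" "integrable M g" "\<gamma> \<in> characters"
  shows "fourier M (\<lambda>x. f x - g x) \<gamma> = fourier M f \<gamma> - fourier M g \<gamma>"
  using fourier_integrand[OF assms(1,3)] fourier_integrand[OF assms(2,3)]
  by (simp add: fourier_def left_diff_distrib)

lemma fourier_sum:
  assumes "\<And>i. i \<in> I \<Longrightarrow> integrable M (f i)" "\<gamma> \<in> characters"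
  shows "fourier M (\<lambda>x. \<Sum>i\<in>I. f i x) \<gamma> = (\<Sum>i\<in>I. fourier M (f i) \<gamma>)"
  using fourier_integrand[OF assms(1,2)]
  by (simp add: fourier_def sum_distrib_right Bochner_Integration.integral_sum)

section \<open>Idempotents orthogonal to all characters\<close>

lemma conv_translate: "(\<lambda>x. f (x + a)) \<star> g = (\<lambda>x. (f \<star> g) (x + a))"
  by (simp add: conv_def fun_eq_iff algebra_simps)

text \<open>This set turns out to be empty.\<close>
definition ghost_idempotents :: "('a \<Rightarrow> complex) set" where
  "ghost_idempotents = {e. continuous_fun e \<and> e \<star> e = e \<and> adj e = e \<and> e \<noteq> (\<lambda>_. 0) \<and>
     (\<forall>\<gamma>\<in>characters. fourier M e \<gamma> = 0)}"

text \<open>\<rho> times the transform of e is the transform of k \<star> k \<star> e, a product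
  with a vanishing factor; so the spectral projection inherits orthogonality to all
  characters.\<close>

lemma ghost_from_kernel:
  assumes k: "continuous_fun k" "adj k = k" "k \<noteq> (\<lambda>_. 0)" "\<And>\<gamma>. \<gamma> \<in> characters \<Longrightarrow> fourier M k \<gamma> = 0"
  obtains \<rho> :: real and e where "e \<in> ghost_idempotents" "k \<star> k \<star> e = (\<lambda>x. of_real \<rho> * e x)" "\<rho> > 0"
proof -
  obtain \<rho> :: real and e where e: "\<rho> > 0" "continuous_fun e" "e \<star> e = e" "adj e = e" "e \<noteq> (\<lambda>_. 0)"
    "k \<star> k \<star> e = (\<lambda>x. of_real \<rho> * e x)"
    using top_spectral_projection[OF k(1-3)] by metis
  have "fourier M e \<gamma> = 0" if \<gamma>: "\<gamma> \<in> characters" for \<gamma>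
  proof -
    have "of_real \<rho> * fourier M e \<gamma> = fourier M (k \<star> k \<star> e) \<gamma>"
      unfolding e(6) by (rule fourier_scale[symmetric])
    also have "\<dots> = 0"
      using \<gamma> k e(2) by (simp add: fourier_conv continuous_conv)
    finally show ?thesis using e(1) by simp
  qed
  then show ?thesis using that e by (auto simp: ghost_idempotents_def)
qed

text \<open>An element with \<open>sqnorm\<close> within 1/\<alpha> of the infimum is minimal: a
  different e' below it would split off the idempotent e - e', costing at least 1/\<alpha>, and so
  e' would fall below the infimum.\<close>

lemma ghost_idempotents_minimal:
  assumes "ghost_idempotents \<noteq> {}"
  obtains e where "e \<in> ghost_idempotents"
    "\<And>e'. e' \<in> ghost_idempotents \<Longrightarrow> e \<star> e' = e' \<Longrightarrow> e' = e"
proof -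
  let ?S = "sqnorm ` ghost_idempotents"
  have bdd: "bdd_below ?S" using sqnorm_nonneg by (intro bdd_belowI[of _ 0]) auto
  have "Inf ?S < Inf ?S + 1 / \<alpha>" using mass_pos by simp
  then obtain e where e: "e \<in> ghost_idempotents" "sqnorm e < Inf ?S + 1 / \<alpha>"
    using cInf_lessD[of ?S] assms by blast
  have "e' = e" if e': "e' \<in> ghost_idempotents" "e \<star> e' = e'" for e'
  proof (rule ccontr)
    assume ne: "e' \<noteq> e"
    define d where "d = (\<lambda>x. e x - e' x)"
    have E: "continuous_fun e" "e \<star> e = e" "adj e = e" and E': "continuous_fun e'" "e' \<star> e' = e'" "adj e' = e'"
      using e e' by (auto simp: ghost_idempotents_def)
    have comm: "e' \<star> e = e'" using conv_commute[OF E'(1) E(1)] e'(2) by simp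
    have dc: "continuous_fun d" unfolding d_def by (intro continuous_intros E E')
    have dd: "d \<star> d = d"
      using E E' e'(2) comm dc[unfolded d_def] by (simp add: d_def conv_diff_left conv_diff_right)
    have da: "adj d = d"
      using fun_cong[OF E(3)] fun_cong[OF E'(3)] by (simp add: d_def adj_def fun_eq_iff)
    have dn: "d \<noteq> (\<lambda>_. 0)" using ne by (metis d_def eq_iff_diff_eq_0 ext)
    have "complex_of_real (sqnorm e) = of_real (sqnorm e' + sqnorm d)"
      using idempotent_value_0[OF E] idempotent_value_0[OF E'] idempotent_value_0[OF dc dd da]
      by (simp add: d_def algebra_simps)
    then have "sqnorm e = sqnorm e' + sqnorm d" by (simp only: of_real_eq_iff)
    moreover have "sqnorm d \<ge> 1 / \<alpha>" by (rule idempotent_sqnorm_ge[OF dc dd dn])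
    moreover have "sqnorm e' \<ge> Inf ?S" using e'(1) bdd by (intro cInf_lower) auto
    ultimately show False using e(2) by linarith
  qed
  then show ?thesis using that e(1) by blast
qed

text \<open>The modulus attains its maximum at some z; comparison with z + a gives modulus at most 1
  at every a, and the same bound at - a forces equality.\<close>

lemma bounded_multiplicative_character:
  assumes c: "continuous_fun \<psi>" and m: "\<And>x y. \<psi> (x + y) = \<psi> x * \<psi> y" and 1: "\<psi> 0 = 1"
  shows "\<psi> \<in> characters"
proof -
  have "continuous_on UNIV (\<lambda>x. norm (\<psi> x))" by (intro continuous_intros c)
  then obtain z where z: "\<And>x. norm (\<psi> x) \<le> norm (\<psi> z)"
    using continuous_attains_sup[OF compact_UNIV] by auto
  have zp: "norm (\<psi> z) > 0" using z[of 0] 1 by auto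
  have le: "norm (\<psi> a) \<le> 1" for a
  proof -
    have "norm (\<psi> z) * norm (\<psi> a) \<le> norm (\<psi> z)" using z[of "z + a"] by (simp add: m norm_mult)
    then show ?thesis using zp by simp
  qed
  have "norm (\<psi> a) = 1" for a
  proof -
    have "norm (\<psi> a) * norm (\<psi> (- a)) = 1" using m[of a "- a"] 1 by (simp flip: norm_mult)
    then show ?thesis using le[of a] le[of "- a"]
      by (metis antisym mult.commute mult_left_le norm_ge_zero)
  qed
  then show ?thesis using c m by (simp add: characters_def)
qed

text \<open>For a minimal e, the self-adjoint elements of the ideal of all k with e \<star> k = k
  are real multiples of e. Translates of e lie in this ideal, so they are multiples of e, and e / e
  0 is a character. Its Fourier coefficient of e is \<alpha> e 0, which is not 0.\<close>

lemma ghost_idempotents_empty: "ghost_idempotents = {}"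
proof (rule ccontr)
  assume "ghost_idempotents \<noteq> {}"
  then obtain e where e: "e \<in> ghost_idempotents"
    "\<And>e'. e' \<in> ghost_idempotents \<Longrightarrow> e \<star> e' = e' \<Longrightarrow> e' = e"
    using ghost_idempotents_minimal by blast
  have ec: "continuous_fun e" and ee: "e \<star> e = e" and ea: "adj e = e" and en: "e \<noteq> (\<lambda>_. 0)"
    and ef: "\<And>\<gamma>. \<gamma> \<in> characters \<Longrightarrow> fourier M e \<gamma> = 0"
    using e(1) by (auto simp: ghost_idempotents_def)
  \<comment> \<open>The spectral projection obtained from k is again orthogonal to all characters
    and lies below e, so by minimality it is e. As k \<star> k is fixed by e, the eigenvalue
    equation becomes k \<star> k = \<rho> e.\<close>
  have square: "\<exists>r::real. k \<star> k = (\<lambda>x. of_real r * e x)"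
    if k: "continuous_fun k" "adj k = k" "e \<star> k = k" for k
  proof (cases "k = (\<lambda>_. 0)")
    case True
    then show ?thesis by (intro exI[of _ 0]) (simp add: conv_def fun_eq_iff)
  next
    case False
    have "fourier M k \<gamma> = 0" if "\<gamma> \<in> characters" for \<gamma>
      using fourier_conv[OF that ec k(1)] ef[OF that] k(3) by simp
    then obtain \<rho> :: real and e' where e': "e' \<in> ghost_idempotents"
      "k \<star> k \<star> e' = (\<lambda>x. of_real \<rho> * e' x)" "\<rho> > 0"
      using ghost_from_kernel[OF k(1,2) False] by metis
    have c': "continuous_fun e'" using e'(1) by (simp add: ghost_idempotents_def)
    have kc: "continuous_fun (k \<star> k)" by (intro continuous_intros k)
    have "(\<lambda>x. of_real \<rho> * (e \<star> e') x) = e \<star> (k \<star> k \<star> e')"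
      unfolding e'(2) conv_scale_right ..
    also have "\<dots> = k \<star> k \<star> e'"
      by (simp add: conv_assoc[symmetric] ec k c' kc continuous_conv)
    finally have "e \<star> e' = e'" using e'(3) unfolding e'(2) by (simp add: fun_eq_iff)
    then have "e' = e" using e(2) e'(1) by blast
    moreover have "k \<star> k \<star> e = k \<star> k"
      using conv_assoc[OF k(1,1) ec] conv_commute[OF k(1) ec] k(3) by simp
    ultimately show ?thesis using e'(2) by auto
  qed
  \<comment> \<open>Polarisation with e: the square of k + e is k \<star> k + 2k + e, and both
    squares are already multiples of e.\<close>
  have linear: "\<exists>r::real. k = (\<lambda>x. of_real r * e x)"
    if k: "continuous_fun k" "adj k = k" "e \<star> k = k" for k
  proof -
    define l where "l = (\<lambda>x. k x + e x)"
    have lc: "continuous_fun l" unfolding l_def by (intro continuous_intros k ec)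
    have "adj l = l" using fun_cong[OF k(2)] fun_cong[OF ea] by (simp add: l_def adj_def fun_eq_iff)
    moreover have "e \<star> l = l" using k ee ec by (simp add: l_def conv_add_right)
    ultimately obtain r2 :: real where r2: "l \<star> l = (\<lambda>x. of_real r2 * e x)" using square[OF lc] by blast
    obtain r1 :: real where r1: "k \<star> k = (\<lambda>x. of_real r1 * e x)" using square[OF k] by blast
    have ke: "k \<star> e = k" using conv_commute[OF k(1) ec] k(3) by simp
    have "l \<star> l = (\<lambda>x. (k \<star> k) x + k x + (k x + e x))"
      using lc[unfolded l_def] k ec ee ke by (simp add: l_def conv_add_left conv_add_right)
    then have "2 * k x = of_real (r2 - r1 - 1) * e x" for x
      using fun_cong[OF r1, of x] fun_cong[OF r2, of x] by (simp add: algebra_simps)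
    then have "k = (\<lambda>x. of_real ((r2 - r1 - 1) / 2) * e x)"
      by (auto simp: fun_eq_iff field_simps)
    then show ?thesis by blast
  qed
  have e0: "e 0 \<noteq> 0" using idempotent_value_0[OF ec ee ea] sqnorm_pos[OF ec en] by simp
  have ea': "cnj (e (- x)) = e x" for x using fun_cong[OF ea, of x] by (simp add: adj_def)
  have trans: "\<exists>c. \<forall>x. e (x + a) = c * e x" for a
  proof -
    have tc: "continuous_fun (\<lambda>x. e (x + b))" for b by (intro continuous_compose[OF ec] continuous_intros)
    have te: "e \<star> (\<lambda>x. e (x + b)) = (\<lambda>x. e (x + b))" for b
      using conv_commute[OF ec tc, of b] conv_translate[of e b e] ee by simp
    have ta: "cnj (e (- x + b)) = e (x + (- b))" for x b
      using ea'[of "x - b"] by simp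
    \<comment> \<open>\<open>linear\<close> covers self-adjoint elements only. The adjoint of the
      translate by a is the translate by - a, so their sum and \<i> times their difference are
      self-adjoint; the two recombine to the translate by a.\<close>
    obtain r1 :: real where r1: "(\<lambda>x. e (x + a) + e (x + (- a))) = (\<lambda>x. of_real r1 * e x)"
    proof -
      have "adj (\<lambda>x. e (x + a) + e (x + (- a))) = (\<lambda>x. e (x + a) + e (x + (- a)))"
        using ta[of _ a] ta[of _ "- a"] by (simp add: adj_def fun_eq_iff add.commute)
      moreover have "e \<star> (\<lambda>x. e (x + a) + e (x + (- a))) = (\<lambda>x. e (x + a) + e (x + (- a)))"
        unfolding conv_add_right[OF ec tc tc] te ..
      ultimately show ?thesis
        using linear[of "\<lambda>x. e (x + a) + e (x + (- a))"] that
          continuous_on_mult_left[OF continuous_on_diff[OF tc[of a] tc[of "- a"]]] continuous_on_add[OF tc[of a] tc[of "- a"]] by blast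
    qed
    obtain r2 :: real where r2: "(\<lambda>x. \<i> * (e (x + a) - e (x + (- a)))) = (\<lambda>x. of_real r2 * e x)"
    proof -
      have "adj (\<lambda>x. \<i> * (e (x + a) - e (x + (- a)))) = (\<lambda>x. \<i> * (e (x + a) - e (x + (- a))))"
        using ta[of _ a] ta[of _ "- a"] by (simp add: adj_def fun_eq_iff algebra_simps)
      moreover have "e \<star> (\<lambda>x. \<i> * (e (x + a) - e (x + (- a)))) = (\<lambda>x. \<i> * (e (x + a) - e (x + (- a))))"
        unfolding conv_scale_right conv_diff_right[OF ec tc tc] te ..
      ultimately show ?thesis
        using linear[of "\<lambda>x. \<i> * (e (x + a) - e (x + (- a)))"] that
          continuous_on_mult_left[OF continuous_on_diff[OF tc[of a] tc[of "- a"]]] continuous_on_add[OF tc[of a] tc[of "- a"]] by blast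
    qed
    have "e (x + a) = ((of_real r1 - \<i> * of_real r2) / 2) * e x" for x
    proof -
      have "2 * e (x + a) = (e (x + a) + e (x + (- a))) - \<i> * (\<i> * (e (x + a) - e (x + (- a))))"
        by (simp add: algebra_simps)
      also have "\<dots> = of_real r1 * e x - \<i> * (of_real r2 * e x)"
        using fun_cong[OF r1, of x] fun_cong[OF r2, of x] by simp
      finally show ?thesis by (simp add: field_simps)
    qed
    then show ?thesis by blast
  qed
  define \<psi> where "\<psi> = (\<lambda>x. e x / e 0)"
  have mult: "e (x + a) = \<psi> a * e x" for x a
  proof -
    obtain c where c: "\<And>x. e (x + a) = c * e x" using trans by blast
    have "c = \<psi> a" using c[of 0] e0 by (simp add: \<psi>_def)
    then show ?thesis using c by simp
  qed
  have "\<psi> \<in> characters"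
  proof (rule bounded_multiplicative_character)
    show "continuous_fun \<psi>" unfolding \<psi>_def using e0 by (intro continuous_intros ec) auto
    show "\<psi> (x + y) = \<psi> x * \<psi> y" for x y
      using mult[of x y] by (simp add: \<psi>_def mult.commute)
    show "\<psi> 0 = 1" using e0 by (simp add: \<psi>_def)
  qed
  moreover from this have "fourier M e \<psi> = e 0 * of_real \<alpha>"
  proof -
    have "e x * cnj (\<psi> x) = e 0" for x
      using char_cnj[OF \<open>\<psi> \<in> characters\<close>, of x] e0 by (simp add: \<psi>_def field_simps)
    then show ?thesis by (simp add: fourier_def scaleR_conv_of_real)
  qed
  ultimately show False using ef[of \<psi>] e0 mass_pos by simp
qed

text \<open>The power method wants a self-adjoint kernel. h \<star> \<open>adj h\<close> is one, it
  is nonzero since its value at 0 is the squared norm of h, and its transform vanishes with that of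
  h.\<close>

theorem fourier_uniqueness:
  assumes h: "continuous_fun h" and 0: "\<And>\<gamma>. \<gamma> \<in> characters \<Longrightarrow> fourier M h \<gamma> = 0"
  shows "h = (\<lambda>_. 0)"
proof (rule ccontr)
  assume "h \<noteq> (\<lambda>_. 0)"
  define k where "k = h \<star> adj h"
  have kc: "continuous_fun k" unfolding k_def by (intro continuous_intros h)
  have "adj k = k"
    unfolding k_def by (simp add: adj_conv h continuous_adj conv_commute)
  moreover have "k 0 \<noteq> 0"
    using conv_adj_0[OF h] sqnorm_pos[OF h \<open>h \<noteq> _\<close>] by (simp add: k_def)
  then have "k \<noteq> (\<lambda>_. 0)" by auto
  moreover have "fourier M k \<gamma> = 0" if "\<gamma> \<in> characters" for \<gamma>
    unfolding k_def using fourier_conv[OF that h continuous_adj[OF h]] 0[OF that] by simp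
  ultimately show False using ghost_from_kernel[OF kc] ghost_idempotents_empty by blast
qed

text \<open>By commutativity \<gamma> \<star> \<delta> is a multiple of \<gamma> and of \<delta>.
  Comparison at 0 and at a point where the two differ annihilates the factor.\<close>

lemma fourier_char:
  assumes \<gamma>: "\<gamma> \<in> characters" and \<delta>: "\<delta> \<in> characters"
  shows "fourier M \<gamma> \<delta> = (if \<gamma> = \<delta> then of_real \<alpha> else 0)"
proof (cases "\<gamma> = \<delta>")
  case True
  then show ?thesis by (simp add: fourier_def char_cnj[OF \<delta>] scaleR_conv_of_real)
next
  case False
  then obtain a where a: "\<gamma> a \<noteq> \<delta> a" by auto
  have "(\<lambda>x. \<delta> x * fourier M \<gamma> \<delta>) = (\<lambda>x. \<gamma> x * fourier M \<delta> \<gamma>)"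
    using char_conv[OF \<gamma>, of \<delta>] char_conv[OF \<delta>, of \<gamma>]
      conv_commute[OF char_continuous[OF \<gamma>] char_continuous[OF \<delta>]] by simp
  then have eq: "\<delta> x * fourier M \<gamma> \<delta> = \<gamma> x * fourier M \<delta> \<gamma>" for x by (rule fun_cong)
  then have "fourier M \<gamma> \<delta> = fourier M \<delta> \<gamma>" using eq[of 0] by (simp add: char_0 \<gamma> \<delta>)
  then show ?thesis using eq[of a] a False by auto
qed

text \<open>All points have the same mass and infinitely many share a finite total, so points are
  null; outer regularity provides the neighbourhood.\<close>

lemma small_open_set:
  assumes inf: "infinite (UNIV :: 'a set)" and \<epsilon>: "\<epsilon> > 0"
  obtains U where "open U" "(0::'a) \<in> U" "measure M U < \<epsilon>"
proof -
  have pt: "measure M {x} = measure M {0}" for x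
    using emeasure_translate[of "{0}" x] by (simp add: measure_def)
  have "measure M {0} = 0"
  proof (rule ccontr)
    assume "measure M {0} \<noteq> 0"
    then have p: "measure M {0} > 0" using measure_nonneg[of M "{0}"] by linarith
    obtain n :: nat where n: "real n * measure M {0} > \<alpha>"
      using reals_Archimedean3[OF p] by blast
    obtain T :: "'a set" where T: "finite T" "card T = n"
      using infinite_arbitrarily_large[OF inf] by blast
    have "measure M T = (\<Sum>x\<in>T. measure M {x})"
      using T(1) by (intro finite_measure_eq_sum_singleton) (auto simp: sets_M)
    also have "\<dots> = (\<Sum>x\<in>T. measure M {0})" by (intro sum.cong refl pt)
    also have "\<dots> = real n * measure M {0}" using T by simp
    finally show False using n finite_measure_mono[of T UNIV] by (simp add: sets_M)
  qed
  then have "emeasure M {0} = 0" by (simp add: emeasure_eq_measure)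
  then have "(INF U\<in>{U. open U \<and> {0} \<subseteq> U}. emeasure M U) < ennreal \<epsilon>"
    using outer_regular[of "{0}"] \<epsilon> by simp
  then obtain U where "open U" "0 \<in> U" "emeasure M U < ennreal \<epsilon>"
    by (auto simp: INF_less_iff)
  then show ?thesis using that by (auto simp: emeasure_eq_measure ennreal_less_iff)
qed

lemma bump_function:
  assumes U: "open U" "(0::'a) \<in> U"
  obtains g :: "'a \<Rightarrow> real" where "continuous_on UNIV g" "g 0 = 1" "\<And>x. 0 \<le> g x" "\<And>x. g x \<le> 1"
    "\<And>x. x \<notin> U \<Longrightarrow> g x = 0"
proof -
  have "normal_space (euclidean :: 'a topology)"
  proof (rule compact_Hausdorff_or_regular_imp_normal_space)
    show "compact_space (euclidean :: 'a topology)" using compact_UNIV by (simp add: compact_space_def)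
    show "Hausdorff_space (euclidean :: 'a topology) \<or> regular_space (euclidean :: 'a topology)"
      using hausdorff by (auto simp: Hausdorff_space_def disjnt_def)
  qed
  moreover have "closedin euclidean (- U)" "closedin euclidean {0::'a}" "disjnt (- U) {0}"
    using U by (auto simp: disjnt_def closed_closedin[symmetric])
  ultimately obtain g where g: "continuous_map euclidean (top_of_set {0..1::real}) g"
    "g ` (- U) \<subseteq> {0}" "g ` {0} \<subseteq> {1}"
    using Urysohn_lemma[of euclidean "- U" "{0}" 0 1] by auto
  have "continuous_on UNIV g" "range g \<subseteq> {0..1}"
    using g(1) by (auto simp: continuous_map_in_subtopology)
  then show ?thesis using that[of g] g(2,3) by (auto simp: image_subset_iff)
qed

text \<open>With only n characters, uniqueness would make a continuous f equal to its finite Fourier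
  sum. A bump with value 1 at 0 and support in a small U has coefficients too small for n of them to
  add up to 1 at 0.\<close>

theorem infinite_characters:
  assumes inf: "infinite (UNIV :: 'a set)"
  shows "infinite (characters :: ('a \<Rightarrow> complex) set)"
proof
  assume fin: "finite (characters :: ('a \<Rightarrow> complex) set)"
  define n where "n = card (characters :: ('a \<Rightarrow> complex) set)"
  have "\<alpha> / (real n + 1) > 0" using mass_pos by simp
  then obtain U where U: "open U" "(0::'a) \<in> U" "measure M U < \<alpha> / (real n + 1)"
    using small_open_set[OF inf] by blast
  obtain g :: "'a \<Rightarrow> real" where g: "continuous_on UNIV g" "g 0 = 1" "\<And>x. 0 \<le> g x" "\<And>x. g x \<le> 1"
    "\<And>x. x \<notin> U \<Longrightarrow> g x = 0"
    using bump_function[OF U(1,2)] by metis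
  define f where "f = (\<lambda>x. complex_of_real (g x))"
  have fc: "continuous_fun f" unfolding f_def by (intro continuous_intros g)
  have fU: "norm (fourier M f \<gamma>) \<le> measure M U" if \<gamma>: "\<gamma> \<in> characters" for \<gamma>
  proof -
    have "norm (fourier M f \<gamma>) \<le> (LINT x|M. norm (f x * cnj (\<gamma> x)))"
      unfolding fourier_def by (rule integral_norm_bound)
    also have "\<dots> \<le> (LINT x|M. indicat_real U x)"
      using fourier_integrand[OF integrable_continuous[OF fc] \<gamma>] U(1) g
      by (intro integral_mono integrable_norm)
         (auto simp: norm_mult char_norm[OF \<gamma>] f_def sets_M less_top[symmetric] split: split_indicator)
    also have "\<dots> = measure M U" by simp
    finally show ?thesis .
  qed
  define c where "c = (\<lambda>\<gamma>. fourier M f \<gamma> / of_real \<alpha>)"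
  define h where "h = (\<lambda>x. f x - (\<Sum>\<gamma>\<in>characters. c \<gamma> * \<gamma> x))"
  have sc: "continuous_fun (\<lambda>x. c * \<gamma> x)" if "\<gamma> \<in> characters" for c \<gamma>
    by (intro continuous_intros char_continuous that)
  have hc: "continuous_fun h" unfolding h_def by (intro continuous_intros fc char_continuous)
  have "fourier M h \<delta> = 0" if \<delta>: "\<delta> \<in> characters" for \<delta>
  proof -
    have "fourier M h \<delta> = fourier M f \<delta> - (\<Sum>\<gamma>\<in>characters. c \<gamma> * fourier M \<gamma> \<delta>)"
      unfolding h_def using \<delta> sc
      by (subst fourier_diff) (auto simp: fourier_sum fourier_scale integrable_continuous fc intro!: integrable_continuous)
    also have "\<dots> = fourier M f \<delta> - (\<Sum>\<gamma>\<in>characters. if \<gamma> = \<delta> then fourier M f \<gamma> else 0)"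
      using mass_pos \<delta> by (intro arg_cong2[of _ _ _ _ "(-)"] sum.cong) (auto simp: fourier_char c_def)
    also have "\<dots> = 0" using fin \<delta> by simp
    finally show ?thesis .
  qed
  then have "h 0 = 0" using fourier_uniqueness[OF hc] by simp
  then have "1 = (\<Sum>\<gamma>\<in>characters. c \<gamma> * \<gamma> 0)"
    using g(2) by (simp add: h_def f_def)
  then have "1 = norm (\<Sum>\<gamma>\<in>characters. c \<gamma> * \<gamma> 0)"
    by (metis norm_one)
  also have "\<dots> \<le> (\<Sum>\<gamma>\<in>(characters :: ('a \<Rightarrow> complex) set). measure M U / \<alpha>)"
    using mass_pos fU by (intro sum_norm_le) (auto simp: c_def norm_mult norm_divide char_norm divide_right_mono)
  also have "\<dots> = real n * measure M U / \<alpha>" by (simp add: n_def)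
  also have "\<dots> < 1"
  proof -
    have "real n * measure M U \<le> (real n + 1) * measure M U" by (intro mult_right_mono) auto
    also have "\<dots> < \<alpha>" using U(3) by (simp add: field_simps)
    finally show ?thesis using mass_pos by simp
  qed
  finally show False by simp
qed

end

section \<open>The Hausdorff--Young inequality\<close>

lemma lpnorm_le:
  assumes "s > 0" "C \<ge> 0" "(\<integral>\<^sup>+x. ennreal (norm (f x) powr (1 / s)) \<partial>N) \<le> ennreal C"
  shows "lpnorm N s f \<le> ennreal (C powr s)"
proof -
  have fin: "(\<integral>\<^sup>+x. ennreal (norm (f x) powr (1 / s)) \<partial>N) \<noteq> \<infinity>"
    using assms(3) by (auto simp: top_unique)
  have "enn2real (\<integral>\<^sup>+x. ennreal (norm (f x) powr (1 / s)) \<partial>N) \<le> C"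
    using assms by (simp add: enn2real_leI)
  then show ?thesis
    using assms(1) fin by (simp add: lpnorm_def Let_def ennreal_leI powr_mono2)
qed

lemma lpnorm_ge:
  assumes "s > 0" "C \<ge> 0" "ennreal C \<le> (\<integral>\<^sup>+x. ennreal (norm (f x) powr (1 / s)) \<partial>N)"
  shows "ennreal (C powr s) \<le> lpnorm N s f"
proof (cases "(\<integral>\<^sup>+x. ennreal (norm (f x) powr (1 / s)) \<partial>N) = \<infinity>")
  case True
  then show ?thesis using assms(1) by (simp add: lpnorm_def)
next
  case False
  then have "C \<le> enn2real (\<integral>\<^sup>+x. ennreal (norm (f x) powr (1 / s)) \<partial>N)"
    using assms by (metis enn2real_ennreal enn2real_mono infinity_ennreal_def less_top)
  then show ?thesis
    using assms False by (simp add: lpnorm_def Let_def ennreal_leI powr_mono2)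
qed

text \<open>Bounded finite partial sums make a nonnegative family summable over any index set, so
  estimates on the dual need only finite sets of characters.\<close>

lemma nn_integral_count_space_le:
  fixes g :: "'b \<Rightarrow> real"
  assumes g: "\<And>x. x \<in> S \<Longrightarrow> g x \<ge> 0" and B: "\<And>A. finite A \<Longrightarrow> A \<subseteq> S \<Longrightarrow> sum g A \<le> B"
  shows "(\<integral>\<^sup>+x. ennreal (g x) \<partial>count_space S) \<le> ennreal B"
proof -
  have sm: "g summable_on S"
    using g B by (intro nonneg_bdd_above_summable_on bdd_aboveI[of _ B]) auto
  then have as: "Infinite_Set_Sum.abs_summable_on g S"
    using abs_summable_equivalent summable_on_iff_abs_summable_on_real by blast
  have "(\<integral>\<^sup>+x. ennreal (g x) \<partial>count_space S) = ennreal (infsetsum g S)"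
    using as g by (rule nn_integral_conv_infsetsum)
  also have "infsetsum g S = infsum g S" using as by (rule infsetsum_infsum)
  also have "\<dots> \<le> B" using sm B by (rule infsum_le_finite_sums)
  finally show ?thesis by (simp add: ennreal_leI)
qed

lemma nn_integral_count_space_ge:
  assumes "finite A" "A \<subseteq> S"
  shows "(\<Sum>x\<in>A. g x) \<le> (\<integral>\<^sup>+x. g x \<partial>count_space S)"
proof -
  have "(\<Sum>x\<in>A. g x) = (\<integral>\<^sup>+x. g x * indicator A x \<partial>count_space S)"
    using assms by (subst nn_integral_count_space'[of A]) (auto intro!: sum.cong)
  also have "\<dots> \<le> (\<integral>\<^sup>+x. g x \<partial>count_space S)"
    by (intro nn_integral_mono) (auto simp: indicator_def)
  finally show ?thesis .
qed

text \<open>The tangent at 1 to a concave power. Integrated, it gives Jensen's inequality.\<close>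

lemma bernoulli_powr:
  fixes a r :: real
  assumes "a \<ge> 0" "0 \<le> r" "r \<le> 1"
  shows "a powr r \<le> (1 - r) + r * a"
proof (cases "a = 0")
  case False
  then show ?thesis using Youngs_inequality_0[of r "1 - r" a 1] assms by simp
qed (use assms in auto)

context compact_haar
begin

section \<open>Norms on the dual and Bessel's inequality\<close>

lemma nn_integral_dual:
  "(\<integral>\<^sup>+\<gamma>. g \<gamma> \<partial>dual_measure M) = ennreal (1 / \<alpha>) * (\<integral>\<^sup>+\<gamma>. g \<gamma> \<partial>count_space characters)"
  unfolding dual_measure_def by (subst nn_integral_density) (auto simp: nn_integral_cmult)

text \<open>Each character carries positive mass, so essential suprema on the dual are plain
  suprema.\<close>

lemma AE_dual: "(AE \<gamma> in dual_measure M. P \<gamma>) \<longleftrightarrow> (\<forall>\<gamma>\<in>characters. P \<gamma>)"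
  unfolding dual_measure_def using mass_pos by (subst AE_density) (auto simp: AE_count_space)

lemma lpnorm_dual_le:
  assumes "t > 0" "\<And>A. finite A \<Longrightarrow> A \<subseteq> characters \<Longrightarrow> (\<Sum>\<gamma>\<in>A. norm (F \<gamma>) powr (1 / t)) \<le> \<alpha> * C" "C \<ge> 0"
  shows "lpnorm (dual_measure M) t F \<le> ennreal (C powr t)"
proof (rule lpnorm_le[OF assms(1,3)])
  have "(\<integral>\<^sup>+\<gamma>. ennreal (norm (F \<gamma>) powr (1 / t)) \<partial>dual_measure M) \<le> ennreal (1 / \<alpha>) * ennreal (\<alpha> * C)"
    unfolding nn_integral_dual using assms(2)
    by (intro mult_left_mono nn_integral_count_space_le) auto
  also have "\<dots> = ennreal C" using mass_pos assms(3) by (simp flip: ennreal_mult)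
  finally show "(\<integral>\<^sup>+\<gamma>. ennreal (norm (F \<gamma>) powr (1 / t)) \<partial>dual_measure M) \<le> ennreal C" .
qed

lemma lpnorm_dual_ge:
  assumes A: "finite A" "A \<subseteq> characters" "A \<noteq> {}" and d: "d > 0" and t: "t \<ge> 0"
    and F: "\<And>\<gamma>. \<gamma> \<in> A \<Longrightarrow> d \<le> norm (F \<gamma>)"
  shows "ennreal (d * (card A / \<alpha>) powr t) \<le> lpnorm (dual_measure M) t F"
proof (cases "t = 0")
  case True
  have "ennreal d \<le> c" if "AE \<gamma> in dual_measure M. ennreal (norm (F \<gamma>)) \<le> c" for c
  proof -
    obtain \<gamma> where "\<gamma> \<in> A" using A by auto
    then have "ennreal (norm (F \<gamma>)) \<le> c" using that A unfolding AE_dual by auto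
    moreover have "ennreal d \<le> ennreal (norm (F \<gamma>))" using F[OF \<open>\<gamma> \<in> A\<close>] by (rule ennreal_leI)
    ultimately show ?thesis by (rule order_trans[rotated])
  qed
  moreover have "card A > 0" using A by (simp add: card_gt_0_iff)
  ultimately show ?thesis using True mass_pos by (auto simp: lpnorm_def intro!: Inf_greatest)
next
  case False
  then have t: "t > 0" using t by simp
  define C where "C = card A / \<alpha> * d powr (1 / t)"
  have C: "C \<ge> 0" using mass_pos by (simp add: C_def)
  have "ennreal C = ennreal (1 / \<alpha>) * ennreal (\<Sum>\<gamma>\<in>A. d powr (1 / t))"
    using mass_pos by (simp add: C_def flip: ennreal_mult)
  also have "\<dots> \<le> ennreal (1 / \<alpha>) * (\<Sum>\<gamma>\<in>A. ennreal (norm (F \<gamma>) powr (1 / t)))"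
  proof -
    have "(\<Sum>\<gamma>\<in>A. d powr (1 / t)) \<le> (\<Sum>\<gamma>\<in>A. norm (F \<gamma>) powr (1 / t))"
      using F d t by (intro sum_mono powr_mono2) auto
    then show ?thesis by (intro mult_left_mono) (simp_all add: ennreal_leI)
  qed
  also have "\<dots> \<le> (\<integral>\<^sup>+\<gamma>. ennreal (norm (F \<gamma>) powr (1 / t)) \<partial>dual_measure M)"
    unfolding nn_integral_dual by (intro mult_left_mono nn_integral_count_space_ge A) auto
  finally have "ennreal (C powr t) \<le> lpnorm (dual_measure M) t F"
    by (rule lpnorm_ge[OF t C])
  also have "C powr t = d * (card A / \<alpha>) powr t"
  proof -
    have "1 / t * t = 1" using t by simp
    then show ?thesis
      using d powr_mult[of "card A / \<alpha>" "d powr (1 / t)" t] by (simp add: C_def powr_powr del: times_divide_eq_left)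
  qed
  finally show ?thesis .
qed

lemma integrable_bounded_measurable:
  fixes f :: "'a \<Rightarrow> 'b::{banach, second_countable_topology}"
  assumes "f \<in> borel_measurable M" "\<And>x. norm (f x) \<le> B"
  shows "integrable M f"
  using assms by (intro integrable_const_bound[of _ B]) auto

lemma norm_fourier_le:
  assumes "integrable M f" "\<gamma> \<in> characters"
  shows "norm (fourier M f \<gamma>) \<le> (LINT x|M. norm (f x))"
proof -
  have "norm (fourier M f \<gamma>) \<le> (LINT x|M. norm (f x * cnj (\<gamma> x)))"
    unfolding fourier_def by (rule integral_norm_bound)
  then show ?thesis by (simp add: norm_mult char_norm[OF assms(2)])
qed

lemma bessel_inequality:
  assumes f: "f \<in> borel_measurable M" "\<And>x. norm (f x) \<le> B" and A: "finite A" "A \<subseteq> characters"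
  shows "(\<Sum>\<gamma>\<in>A. (norm (fourier M f \<gamma>))\<^sup>2) \<le> \<alpha> * (LINT x|M. (norm (f x))\<^sup>2)"
proof -
  define c where "c = (\<lambda>\<gamma>. fourier M f \<gamma> / of_real \<alpha>)"
  define g where "g = (\<lambda>x. \<Sum>\<gamma>\<in>A. c \<gamma> * \<gamma> x)"
  define d where "d = (\<lambda>x. f x - g x)"
  have A': "\<gamma> \<in> characters" if "\<gamma> \<in> A" for \<gamma> using A that by auto
  have gc: "continuous_fun g" unfolding g_def by (intro continuous_intros char_continuous A')
  have sc: "integrable M (\<lambda>x. c \<gamma> * \<gamma> x)" if "\<gamma> \<in> A" for \<gamma>
    by (intro integrable_continuous continuous_intros char_continuous A' that)
  have fi: "integrable M f" by (rule integrable_bounded_measurable[OF f])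
  obtain Bg where Bg: "\<And>x. norm (g x) \<le> Bg" using continuous_bounded[OF gc] by metis
  have Bg0: "Bg \<ge> 0" by (rule order_trans[OF norm_ge_zero Bg])
  have dm: "d \<in> borel_measurable M" unfolding d_def
    by (intro borel_measurable_diff f continuous_measurable gc)
  have db: "norm (d x) \<le> B + Bg" for x
    unfolding d_def using f(2)[of x] Bg[of x] norm_triangle_ineq4[of "f x" "g x"] by linarith
  have di: "integrable M d" by (rule integrable_bounded_measurable[OF dm db])
  have d0: "fourier M d \<delta> = 0" if \<delta>: "\<delta> \<in> A" for \<delta>
  proof -
    have "fourier M d \<delta> = fourier M f \<delta> - (\<Sum>\<gamma>\<in>A. c \<gamma> * fourier M \<gamma> \<delta>)"
      unfolding d_def g_def using sc A'[OF \<delta>] fi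
      by (subst fourier_diff) (auto simp: fourier_sum fourier_scale intro!: Bochner_Integration.integrable_sum)
    also have "\<dots> = fourier M f \<delta> - (\<Sum>\<gamma>\<in>A. if \<gamma> = \<delta> then fourier M f \<gamma> else 0)"
      using mass_pos A' \<delta> by (intro arg_cong2[of _ _ _ _ "(-)"] sum.cong) (auto simp: fourier_char c_def)
    also have "\<dots> = 0" using A \<delta> by simp
    finally show ?thesis .
  qed
  have against_g: "(LINT x|M. u x * cnj (g x)) = (\<Sum>\<gamma>\<in>A. cnj (c \<gamma>) * fourier M u \<gamma>)"
    if u: "integrable M u" for u
  proof -
    have "u x * cnj (g x) = (\<Sum>\<gamma>\<in>A. cnj (c \<gamma>) * (u x * cnj (\<gamma> x)))" for x
      by (simp add: g_def sum_distrib_left mult_ac)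
    then show ?thesis
      using fourier_integrand[OF u A'] by (simp add: fourier_def Bochner_Integration.integral_sum)
  qed
  have dg: "(LINT x|M. d x * cnj (g x)) = 0" using against_g[OF di] d0 by simp
  have dgi: "integrable M (\<lambda>x. d x * cnj (g x))"
  proof (rule integrable_bounded_measurable)
    show "(\<lambda>x. d x * cnj (g x)) \<in> borel_measurable M"
      by (intro borel_measurable_times dm continuous_measurable continuous_intros gc)
    show "norm (d x * cnj (g x)) \<le> (B + Bg) * Bg" for x
      using db[of x] Bg[of x] Bg0 order_trans[OF norm_ge_zero db] unfolding norm_mult complex_mod_cnj
      by (intro mult_mono) (auto intro: order_trans)
  qed
  have gsq: "integrable M (\<lambda>x. (norm (g x))\<^sup>2)" by (rule integrable_power2_norm[OF gc])
  have sqi: "integrable M (\<lambda>x. (norm (u x))\<^sup>2)" if "u \<in> borel_measurable M" "\<And>x. norm (u x) \<le> D" for u :: "'a \<Rightarrow> complex" and D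
    using that by (intro integrable_bounded_measurable[of _ "D\<^sup>2"] borel_measurable_power borel_measurable_norm)
      (auto intro: power_mono)
  have dsq: "integrable M (\<lambda>x. (norm (d x))\<^sup>2)" by (rule sqi[OF dm db])
  define q where "q = (\<lambda>x. Re (d x * cnj (g x)))"
  have q: "integrable M q" "(LINT x|M. q x) = 0"
    using integrable_Re[OF dgi] integral_Re[OF dgi] dg unfolding q_def by auto
  have pyth: "(norm (f x))\<^sup>2 = (norm (d x))\<^sup>2 + (norm (g x))\<^sup>2 + 2 * q x" for x
    unfolding q_def d_def cmod_power2 by (simp add: power2_eq_square algebra_simps)
  have "(LINT x|M. (norm (f x))\<^sup>2) = (LINT x|M. (norm (d x))\<^sup>2) + (LINT x|M. (norm (g x))\<^sup>2)"
    unfolding pyth using dsq gsq q by simp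
  also have "\<dots> \<ge> sqnorm g" by (simp add: sqnorm_def)
  finally have le: "sqnorm g \<le> (LINT x|M. (norm (f x))\<^sup>2)" .
  \<comment> \<open>As f - g is orthogonal to g, the first factor g may be replaced by f, which
    brings in the Fourier coefficients of f.\<close>
  have "complex_of_real (sqnorm g) = (LINT x|M. g x * cnj (g x))"
    by (simp only: of_real_sqnorm[OF gc] complex_norm_square)
  also have "\<dots> = (LINT x|M. d x * cnj (g x)) + (LINT x|M. g x * cnj (g x))" using dg by simp
  also have "\<dots> = (LINT x|M. d x * cnj (g x) + g x * cnj (g x))"
    by (rule Bochner_Integration.integral_add[symmetric, OF dgi])
       (intro integrable_continuous continuous_intros gc)
  also have "\<dots> = (LINT x|M. f x * cnj (g x))" by (simp add: d_def algebra_simps)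
  also have "\<dots> = (\<Sum>\<gamma>\<in>A. cnj (c \<gamma>) * fourier M f \<gamma>)" by (rule against_g[OF fi])
  also have "\<dots> = (\<Sum>\<gamma>\<in>A. of_real ((norm (fourier M f \<gamma>))\<^sup>2 / \<alpha>))"
    unfolding of_real_divide complex_norm_square by (intro sum.cong) (auto simp: c_def mult.commute)
  also have "\<dots> = of_real ((\<Sum>\<gamma>\<in>A. (norm (fourier M f \<gamma>))\<^sup>2) / \<alpha>)"
    by (simp add: sum_divide_distrib)
  finally have "sqnorm g = (\<Sum>\<gamma>\<in>A. (norm (fourier M f \<gamma>))\<^sup>2) / \<alpha>" by (simp only: of_real_eq_iff)
  then show ?thesis using mult_left_mono[OF le, of \<alpha>] mass_pos by (simp add: field_simps)
qed

lemma simple_function_facts: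
  assumes "simple_function M f"
  shows "finite (range f)" "f -` {v} \<in> sets M" "f \<in> borel_measurable M"
  using assms simple_functionD(1)[OF assms] simple_functionD(2)[OF assms, of "{v}"]
    borel_measurable_simple_function[OF assms] by auto

text \<open>Composition with h changes the values but respects the level sets of f, so all such
  compositions live in one finite-dimensional space indexed by the values of f.\<close>

lemma simple_expand:
  fixes h :: "complex \<Rightarrow> 'b::real_vector"
  assumes "finite (range f)"
  shows "h (f x) = (\<Sum>v\<in>range f. indicat_real (f -` {v}) x *\<^sub>R h v)"
proof -
  have "(\<Sum>v\<in>range f. indicat_real (f -` {v}) x *\<^sub>R h v) = (\<Sum>v\<in>range f. if v = f x then h v else 0)"
    by (intro sum.cong) (auto simp: indicator_def)
  then show ?thesis using assms by simp
qed

lemma simple_integral: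
  fixes h :: "complex \<Rightarrow> real"
  assumes "simple_function M f"
  shows "(LINT x|M. h (f x)) = (\<Sum>v\<in>range f. measure M (f -` {v}) * h v)"
  unfolding simple_expand[OF simple_function_facts(1)[OF assms], of h]
  using simple_function_facts(2)[OF assms]
  by (subst Bochner_Integration.integral_sum) (auto simp: less_top[symmetric] intro!: sum.cong)

text \<open>On compositions h (f x) the transform is a finite matrix: c holds the coefficients of
  the indicators of level sets, w their measures. Both endpoint bounds hold for every h, as
  interpolation demands.\<close>

lemma hausdorff_young_simple:
  assumes f: "simple_function M f" and A: "finite A" "A \<subseteq> characters" and t: "0 < t" "t \<le> 1/2"
    and I: "(LINT x|M. norm (f x) powr (1 / (1 - t))) \<le> I" "I > 0"
  shows "(\<Sum>\<gamma>\<in>A. norm (fourier M f \<gamma>) powr (1 / t)) \<le> \<alpha> * I powr ((1 - t) / t)"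
proof -
  note sf = simple_function_facts[OF f]
  define w where "w = (\<lambda>v. measure M (f -` {v}))"
  define c where "c = (\<lambda>v \<gamma>. fourier M (\<lambda>x. of_real (indicat_real (f -` {v}) x)) \<gamma>)"
  have hs: "simple_function M (\<lambda>x. h (f x))" for h :: "complex \<Rightarrow> complex"
    using simple_function_compose[OF f, of h] by (simp add: o_def)
  have bd: "\<exists>B. \<forall>x. norm (h (f x)) \<le> B" for h :: "complex \<Rightarrow> complex"
    using sf(1) by (intro exI[of _ "Max (norm ` h ` range f)"]) auto
  have four: "fourier M (\<lambda>x. h (f x)) \<gamma> = (\<Sum>v\<in>range f. h v * c v \<gamma>)" if \<gamma>: "\<gamma> \<in> characters" for h \<gamma>
  proof -
    have "fourier M (\<lambda>x. h (f x)) \<gamma> = fourier M (\<lambda>x. \<Sum>v\<in>range f. h v * of_real (indicat_real (f -` {v}) x)) \<gamma>"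
      unfolding simple_expand[OF sf(1), of h] by (simp add: scaleR_conv_of_real mult.commute)
    also have "\<dots> = (\<Sum>v\<in>range f. h v * c v \<gamma>)"
      unfolding c_def using \<gamma> sf(2)
      by (subst fourier_sum) (auto simp: fourier_scale less_top[symmetric] intro!: integrable_mult_right integrable_of_real)
    finally show ?thesis .
  qed
  have "(\<Sum>\<gamma>\<in>A. norm (\<Sum>v\<in>range f. v * c v \<gamma>) powr (1 / t)) \<le> \<alpha> * I powr ((1 - t) / t)"
  proof (rule riesz_thorin_finite[OF mass_pos t, where w = w])
    show "norm (\<Sum>v\<in>range f. h v * c v \<gamma>) \<le> (\<Sum>v\<in>range f. w v * norm (h v))" if "\<gamma> \<in> A" for h \<gamma>
    proof -
      have \<gamma>: "\<gamma> \<in> characters" using that A by auto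
      obtain B where B: "\<And>x. norm (h (f x)) \<le> B" using bd by metis
      have "integrable M (\<lambda>x. h (f x))"
        by (rule integrable_bounded_measurable[where f = "\<lambda>x. h (f x)", OF simple_function_facts(3)[OF hs] B])
      from norm_fourier_le[OF this \<gamma>] show ?thesis
        using four[OF \<gamma>] simple_integral[OF f, of "\<lambda>v. norm (h v)"] by (simp add: w_def)
    qed
    show "(\<Sum>\<gamma>\<in>A. (norm (\<Sum>v\<in>range f. h v * c v \<gamma>))\<^sup>2) \<le> \<alpha> * (\<Sum>v\<in>range f. w v * (norm (h v))\<^sup>2)" for h
    proof -
      obtain B where B: "\<And>x. norm (h (f x)) \<le> B" using bd by metis
      have "(\<Sum>\<gamma>\<in>A. (norm (fourier M (\<lambda>x. h (f x)) \<gamma>))\<^sup>2) \<le> \<alpha> * (LINT x|M. (norm (h (f x)))\<^sup>2)"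
        by (rule bessel_inequality[where f = "\<lambda>x. h (f x)", OF simple_function_facts(3)[OF hs] B A])
      moreover have "(\<Sum>\<gamma>\<in>A. (norm (fourier M (\<lambda>x. h (f x)) \<gamma>))\<^sup>2) = (\<Sum>\<gamma>\<in>A. (norm (\<Sum>v\<in>range f. h v * c v \<gamma>))\<^sup>2)"
        using four A by (intro sum.cong) auto
      ultimately show ?thesis
        using simple_integral[OF f, of "\<lambda>v. (norm (h v))\<^sup>2"] by (simp add: w_def)
    qed
    show "(\<Sum>v\<in>range f. w v * norm v powr (1 / (1 - t))) \<le> I"
      using I(1) simple_integral[OF f, of "\<lambda>v. norm v powr (1 / (1 - t))"] by (simp add: w_def)
  qed (rule I)
  moreover have "fourier M f \<gamma> = (\<Sum>v\<in>range f. v * c v \<gamma>)" if "\<gamma> \<in> A" for \<gamma>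
    using four[of \<gamma> "\<lambda>v. v"] that A by auto
  ultimately show ?thesis by simp
qed

text \<open>Simple functions dominated by 2|f| approximate f. Their integrals converge to that of f,
  so the strict bound by I eventually passes to them.\<close>

lemma hausdorff_young:
  assumes f: "integrable M f" and A: "finite A" "A \<subseteq> characters" and t: "0 < t" "t \<le> 1/2"
    and Ii: "integrable M (\<lambda>x. norm (f x) powr (1 / (1 - t)))"
    and I: "(LINT x|M. norm (f x) powr (1 / (1 - t))) < I"
  shows "(\<Sum>\<gamma>\<in>A. norm (fourier M f \<gamma>) powr (1 / t)) \<le> \<alpha> * I powr ((1 - t) / t)"
proof -
  define p where "p = 1 / (1 - t)"
  have p: "p > 0" using t by (simp add: p_def)
  have fm: "f \<in> borel_measurable M" using f by (rule borel_measurable_integrable)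
  obtain g where g: "\<And>i. simple_function M (g i)" "\<And>x. (\<lambda>i. g i x) \<longlonglongrightarrow> f x"
    "\<And>i x. norm (g i x) \<le> 2 * norm (f x)"
    using borel_measurable_implies_sequence_metric[OF fm, of 0] by auto
  note gm = simple_function_facts(3)[OF g(1)]
  have I0: "I > 0" by (rule le_less_trans[OF _ I]) simp
  have "(\<lambda>i. LINT x|M. norm (g i x) powr p) \<longlonglongrightarrow> (LINT x|M. norm (f x) powr p)"
  proof (rule integral_dominated_convergence[where w = "\<lambda>x. 2 powr p * norm (f x) powr p"])
    show "integrable M (\<lambda>x. 2 powr p * norm (f x) powr p)" using Ii by (simp add: p_def)
    show "AE x in M. (\<lambda>i. norm (g i x) powr p) \<longlonglongrightarrow> norm (f x) powr p"
      using g(2) p by (intro AE_I2 tendsto_powr2 tendsto_norm) auto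
    show "AE x in M. norm (norm (g i x) powr p) \<le> 2 powr p * norm (f x) powr p" for i
      using g(3) p by (intro AE_I2) (simp add: powr_mult[symmetric] powr_mono2)
  qed (use fm gm in measurable)
  then have ev: "\<forall>\<^sub>F i in sequentially. (LINT x|M. norm (g i x) powr p) < I"
    using I by (intro order_tendstoD(2)) (auto simp: p_def)
  have four: "(\<lambda>i. fourier M (g i) \<gamma>) \<longlonglongrightarrow> fourier M f \<gamma>" if "\<gamma> \<in> A" for \<gamma>
  proof -
    have \<gamma>: "\<gamma> \<in> characters" using that A by auto
    have \<gamma>m: "(\<lambda>x. cnj (\<gamma> x)) \<in> borel_measurable M"
      by (intro continuous_measurable continuous_intros char_continuous \<gamma>)
    show ?thesis unfolding fourier_def
    proof (rule integral_dominated_convergence[where w = "\<lambda>x. 2 * norm (f x)"])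
      show "integrable M (\<lambda>x. 2 * norm (f x))" using f by simp
      show "AE x in M. (\<lambda>i. g i x * cnj (\<gamma> x)) \<longlonglongrightarrow> f x * cnj (\<gamma> x)"
        using g(2) by (intro AE_I2 tendsto_mult tendsto_const) auto
      show "AE x in M. norm (g i x * cnj (\<gamma> x)) \<le> 2 * norm (f x)" for i
        using g(3) by (intro AE_I2) (simp add: norm_mult char_norm[OF \<gamma>])
    qed (use fm gm \<gamma>m borel_measurable_times in blast)+
  qed
  have "(\<lambda>i. \<Sum>\<gamma>\<in>A. norm (fourier M (g i) \<gamma>) powr (1 / t)) \<longlonglongrightarrow> (\<Sum>\<gamma>\<in>A. norm (fourier M f \<gamma>) powr (1 / t))"
    using t by (intro tendsto_sum tendsto_powr2 tendsto_norm four tendsto_const) auto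
  moreover have "\<forall>\<^sub>F i in sequentially. (\<Sum>\<gamma>\<in>A. norm (fourier M (g i) \<gamma>) powr (1 / t)) \<le> \<alpha> * I powr ((1 - t) / t)"
    using ev by eventually_elim (intro hausdorff_young_simple g A t I0, simp add: p_def)
  ultimately show ?thesis by (intro tendsto_upperbound) auto
qed

text \<open>That the infimum is attained has to be shown: countably many bounds 1 + 1/(n+1) hold
  simultaneously almost everywhere.\<close>

lemma AE_le_one_of_lpnorm_0:
  assumes "lpnorm M 0 f = 1"
  shows "AE x in M. norm (f x) \<le> 1"
proof -
  have *: "AE x in M. norm (f x) \<le> 1 + 1 / real (Suc n)" for n
  proof -
    have "Inf {c. AE x in M. ennreal (norm (f x)) \<le> c} < ennreal (1 + 1 / real (Suc n))"
      using assms by (simp add: lpnorm_def flip: ennreal_1)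
    then obtain c where c: "AE x in M. ennreal (norm (f x)) \<le> c" "c < ennreal (1 + 1 / real (Suc n))"
      by (auto simp: Inf_less_iff)
    from c(1) show ?thesis
    proof eventually_elim
      case (elim x)
      then have "ennreal (norm (f x)) \<le> ennreal (1 + 1 / real (Suc n))" using c(2) by (metis less_imp_le order_trans)
      then show ?case using ennreal_le_iff[of "1 + 1 / real (Suc n)" "norm (f x)"] by simp
    qed
  qed
  then have "AE x in M. \<forall>n. norm (f x) \<le> 1 + 1 / real (Suc n)" by (simp add: AE_all_countable)
  then show ?thesis
  proof eventually_elim
    case (elim x)
    have "(\<lambda>n. 1 + 1 / real (Suc n)) \<longlonglongrightarrow> 1 + 0"
      by (intro tendsto_add tendsto_const LIMSEQ_Suc[OF lim_1_over_n])
    then show ?case using elim by (intro LIMSEQ_le_const) auto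
  qed
qed

text \<open>Jensen on a space of mass \<alpha>: s \<le> u means that 1/u is the smaller exponent.
  Constants give equality.\<close>

lemma integral_powr_of_lpnorm_1:
  assumes s: "s \<ge> 0" "s \<le> u" "u > 0" and f: "f \<in> borel_measurable M" and 1: "lpnorm M s f = 1"
  shows "integrable M (\<lambda>x. norm (f x) powr (1 / u))"
    "(LINT x|M. norm (f x) powr (1 / u)) \<le> \<alpha> powr (1 - s / u)"
proof -
  have fm: "(\<lambda>x. norm (f x) powr a) \<in> borel_measurable M" for a using f by measurable
  have "integrable M (\<lambda>x. norm (f x) powr (1 / u)) \<and> (LINT x|M. norm (f x) powr (1 / u)) \<le> \<alpha> powr (1 - s / u)"
  proof (cases "s = 0")
    case True
    have "AE x in M. norm (f x) \<le> 1" using AE_le_one_of_lpnorm_0 1 True by simp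
    then have ae: "AE x in M. norm (f x) powr (1 / u) \<le> 1"
      by eventually_elim (use s powr_mono2[of "1 / u" _ 1] in auto)
    then have i: "integrable M (\<lambda>x. norm (f x) powr (1 / u))"
      by (intro integrable_const_bound[of _ 1] fm) auto
    have "(LINT x|M. norm (f x) powr (1 / u)) \<le> (LINT x|M. 1)"
      using i ae by (intro integral_mono_AE) auto
    then show ?thesis using i True mass_pos by simp
  next
    case False
    then have sp: "s > 0" using s by simp
    define J where "J = (\<integral>\<^sup>+x. ennreal (norm (f x) powr (1 / s)) \<partial>M)"
    have "J \<noteq> \<infinity>" using 1 sp by (auto simp: lpnorm_def J_def Let_def)
    moreover have "ennreal (enn2real J powr s) = 1"
      using 1 sp \<open>J \<noteq> \<infinity>\<close> by (auto simp: lpnorm_def J_def Let_def)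
    then have "enn2real J powr s = 1" by (simp add: ennreal_eq_1)
    then have "enn2real J = 1" using sp by (metis enn2real_nonneg powr_one_eq_one powr_inj zero_less_one less_irrefl
          powr_eq_one_iff_gen powr_0 zero_neq_one le_less)
    ultimately have J1: "J = ennreal 1" by (metis ennreal_enn2real infinity_ennreal_def less_top)
    have i1: "integrable M (\<lambda>x. norm (f x) powr (1 / s))"
      using J1 fm by (intro integrableI_nn_integral_finite[where x = 1]) (auto simp: J_def)
    have I1: "(LINT x|M. norm (f x) powr (1 / s)) = 1"
      using J1 nn_integral_eq_integral[OF i1] by (simp add: J_def)
    define r where "r = s / u"
    have r: "0 < r" "r \<le> 1" using sp s by (auto simp: r_def)
    \<comment> \<open>The factor \<alpha> gives \<alpha> |f|^(1/s) the mean 1, the point where the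
      tangent bound is sharp.\<close>
    have pw: "\<alpha> powr r * norm (f x) powr (1 / u) \<le> (1 - r) + r * (\<alpha> * norm (f x) powr (1 / s))" for x
    proof -
      have "(\<alpha> * norm (f x) powr (1 / s)) powr r = \<alpha> powr r * norm (f x) powr (1 / u)"
        using mass_pos sp s by (simp add: powr_mult powr_powr r_def)
      then show ?thesis using bernoulli_powr[of "\<alpha> * norm (f x) powr (1 / s)" r] r mass_pos by simp
    qed
    have ri: "integrable M (\<lambda>x. (1 - r) + r * (\<alpha> * norm (f x) powr (1 / s)))" using i1 by simp
    have "integrable M (\<lambda>x. \<alpha> powr r * norm (f x) powr (1 / u))"
      by (rule Bochner_Integration.integrable_bound[OF ri])
         (use pw fm in \<open>auto intro!: AE_I2 order_trans[OF pw abs_ge_self]\<close>)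
    then have i: "integrable M (\<lambda>x. norm (f x) powr (1 / u))" using mass_pos by simp
    have "\<alpha> powr r * (LINT x|M. norm (f x) powr (1 / u)) = (LINT x|M. \<alpha> powr r * norm (f x) powr (1 / u))" by simp
    also have "\<dots> \<le> (LINT x|M. (1 - r) + r * (\<alpha> * norm (f x) powr (1 / s)))"
      using i ri pw by (intro integral_mono) auto
    also have "\<dots> = \<alpha>" using i1 I1 by (simp add: algebra_simps)
    finally have "(LINT x|M. norm (f x) powr (1 / u)) \<le> \<alpha> / \<alpha> powr r"
      using mass_pos by (simp add: field_simps)
    also have "\<dots> = \<alpha> powr (1 - r)" using mass_pos by (simp add: powr_diff)
    finally show ?thesis using i by (simp add: r_def)
  qed
  then show "integrable M (\<lambda>x. norm (f x) powr (1 / u))"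
    "(LINT x|M. norm (f x) powr (1 / u)) \<le> \<alpha> powr (1 - s / u)" by auto
qed

text \<open>1/u is the exponent conjugate to 1/t, and s + t \<le> 1 says s \<le> u, so Jensen feeds
  Hausdorff-Young; the exponents combine by (1 - s/u)(1 - t) = 1 - s - t.\<close>

lemma fourier_pq_norm_upper:
  assumes s: "s \<ge> 0" and t: "0 \<le> t" "t \<le> 1/2" and st: "s + t \<le> 1"
  shows "fourier_pq_norm M s t \<le> ennreal (\<alpha> powr (1 - s - t))"
  unfolding fourier_pq_norm_def
proof (rule Sup_least, safe)
  fix f assume fm: "f \<in> borel_measurable M" and fi: "integrable M f" and f1: "lpnorm M s f = 1"
  show "lpnorm (dual_measure M) t (fourier M f) \<le> ennreal (\<alpha> powr (1 - s - t))"
  proof (cases "t = 0")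
    case True
    have "(LINT x|M. norm (f x)) \<le> \<alpha> powr (1 - s)"
      using integral_powr_of_lpnorm_1(2)[OF s _ zero_less_one fm f1] st True by simp
    then have "norm (fourier M f \<gamma>) \<le> \<alpha> powr (1 - s)" if "\<gamma> \<in> characters" for \<gamma>
      using norm_fourier_le[OF fi that] by linarith
    then show ?thesis using True
      by (auto simp: lpnorm_def AE_dual intro!: Inf_lower ennreal_leI)
  next
    case False
    then have tp: "t > 0" using t by simp
    define u where "u = 1 - t"
    have u: "u > 0" "s \<le> u" using t st by (auto simp: u_def)
    define I where "I = \<alpha> powr (1 - s / u)"
    note ip = integral_powr_of_lpnorm_1[OF s u(2,1) fm f1]
    have "(\<Sum>\<gamma>\<in>A. norm (fourier M f \<gamma>) powr (1 / t)) \<le> \<alpha> * I powr ((1 - t) / t)"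
      if A: "finite A" "A \<subseteq> characters" for A
    \<comment> \<open>Hausdorff-Young is available under a strict bound, hence I + \<epsilon> and a
      limit from the right.\<close>
    proof (rule tendsto_lowerbound)
      show "((\<lambda>\<epsilon>. \<alpha> * (I + \<epsilon>) powr ((1 - t) / t)) \<longlongrightarrow> \<alpha> * I powr ((1 - t) / t)) (at_right 0)"
      proof -
        have "((\<lambda>\<epsilon>. \<alpha> * (I + \<epsilon>) powr ((1 - t) / t)) \<longlongrightarrow> \<alpha> * (I + 0) powr ((1 - t) / t)) (at_right 0)"
          using mass_pos by (intro tendsto_intros) (auto simp: I_def)
        then show ?thesis by simp
      qed
      show "\<forall>\<^sub>F \<epsilon> in at_right 0. (\<Sum>\<gamma>\<in>A. norm (fourier M f \<gamma>) powr (1 / t)) \<le> \<alpha> * (I + \<epsilon>) powr ((1 - t) / t)"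
      proof (rule eventually_at_rightI[of 0 1])
        fix \<epsilon> :: real assume "\<epsilon> \<in> {0<..<1}"
        then have "(LINT x|M. norm (f x) powr (1 / (1 - t))) < I + \<epsilon>" using ip(2) by (simp add: I_def u_def)
        then show "(\<Sum>\<gamma>\<in>A. norm (fourier M f \<gamma>) powr (1 / t)) \<le> \<alpha> * (I + \<epsilon>) powr ((1 - t) / t)"
          using ip(1) by (intro hausdorff_young fi A tp t) (auto simp: u_def)
      qed simp
    qed simp
    then have "lpnorm (dual_measure M) t (fourier M f) \<le> ennreal ((I powr ((1 - t) / t)) powr t)"
      by (intro lpnorm_dual_le tp) auto
    also have "(I powr ((1 - t) / t)) powr t = \<alpha> powr (1 - s - t)"
    proof -
      have "(1 - s / u) * (1 - t) = 1 - s - t" using u by (simp add: u_def field_simps)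
      then show ?thesis using tp by (simp add: I_def powr_powr)
    qed
    finally show ?thesis .
  qed
qed

section \<open>Lower bounds\<close>

text \<open>The supremum runs over functions of quasi-norm exactly 1, so a test function must be
  divided by its true quasi-norm L, of which only an upper bound C is known. A nonzero Fourier
  coefficient excludes f = 0 a.e. and gives L > 0.\<close>

lemma lpnorm_normalizable:
  assumes f: "f \<in> borel_measurable M" and B: "\<And>x. norm (f x) \<le> B"
    and \<gamma>: "\<gamma> \<in> characters" "fourier M f \<gamma> \<noteq> 0"
    and s: "s \<ge> 0" and C: "C > 0"
    and C0: "s = 0 \<Longrightarrow> (\<And>x. norm (f x) \<le> C)"
    and Cs: "s > 0 \<Longrightarrow> (LINT x|M. norm (f x) powr (1 / s)) powr s \<le> C"
  obtains L where "0 < L" "L \<le> C" "lpnorm M s (\<lambda>x. f x / of_real L) = 1"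
proof -
  have not0: "\<not> (AE x in M. f x = 0)"
  proof
    assume "AE x in M. f x = 0"
    moreover have "(\<lambda>x. cnj (\<gamma> x)) \<in> borel_measurable M"
      by (intro continuous_measurable continuous_on_cnj char_continuous \<gamma>)
    ultimately have "(LINT x|M. f x * cnj (\<gamma> x)) = (LINT x|M. 0)"
      using borel_measurable_times[OF f] by (intro integral_cong_AE) auto
    then show False using \<gamma>(2) by (simp add: fourier_def)
  qed
  show ?thesis
  proof (cases "s = 0")
    case True
    define E where "E = {c. AE x in M. ennreal (norm (f x)) \<le> c}"
    have CE: "ennreal C \<in> E" using C0[OF True] by (auto simp: E_def intro!: AE_I2 ennreal_leI)
    then have "Inf E \<le> ennreal C" by (rule Inf_lower)
    then obtain L where L: "Inf E = ennreal L" "0 \<le> L" "L \<le> C"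
      using C by (cases "Inf E") (auto simp: top_unique)
    \<comment> \<open>E is upward closed. This yields L > 0 and shows that the infimum scales with
      f.\<close>
    have up: "c \<in> E" if c: "Inf E < c" for c
    proof -
      obtain c' where c': "c' \<in> E" "c' < c" using c by (auto simp: Inf_less_iff)
      then have "AE x in M. ennreal (norm (f x)) \<le> c'" by (simp add: E_def)
      then have "AE x in M. ennreal (norm (f x)) \<le> c"
        by eventually_elim (use c'(2) in auto)
      then show ?thesis by (simp add: E_def)
    qed
    have "L \<noteq> 0"
    proof
      assume L0: "L = 0"
      have "AE x in M. ennreal (norm (f x)) \<le> ennreal (1 / real (Suc n))" for n
        using up[of "ennreal (1 / real (Suc n))"] L L0 by (simp add: E_def)
      then have "AE x in M. \<forall>n. ennreal (norm (f x)) \<le> ennreal (1 / real (Suc n))" by (simp add: AE_all_countable)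
      then have "AE x in M. f x = 0"
      proof eventually_elim
        case (elim x)
        then have "norm (f x) \<le> 1 / real (Suc n)" for n
          using ennreal_le_iff[of "1 / real (Suc n)" "norm (f x)"] by simp
        then have "norm (f x) \<le> 0"
          by (intro LIMSEQ_le_const[OF LIMSEQ_Suc[OF lim_1_over_n]]) auto
        then show ?case by simp
      qed
      then show False using not0 by simp
    qed
    then have Lp: "L > 0" using L by simp
    have scale: "ennreal (norm (f x / of_real L)) \<le> c \<longleftrightarrow> ennreal (norm (f x)) \<le> ennreal L * c" for x c
    proof -
      have "ennreal (norm (f x)) = ennreal L * ennreal (norm (f x / of_real L))"
        using Lp by (simp add: norm_divide flip: ennreal_mult)
      then show ?thesis using Lp by (simp add: ennreal_mult_le_mult_iff)
    qed
    have E': "{c. AE x in M. ennreal (norm (f x / of_real L)) \<le> c} = {c. ennreal L * c \<in> E}"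
      by (simp add: scale E_def)
    have "Inf {c. ennreal L * c \<in> E} = 1"
    proof (rule antisym)
      show "1 \<le> Inf {c. ennreal L * c \<in> E}"
      proof (rule Inf_greatest, safe)
        fix c assume "ennreal L * c \<in> E"
        then have "ennreal L * 1 \<le> ennreal L * c" using Inf_lower[of _ E] L by fastforce
        then show "1 \<le> c" using Lp by (subst (asm) ennreal_mult_le_mult_iff) auto
      qed
      show "Inf {c. ennreal L * c \<in> E} \<le> 1"
      proof (rule dense_ge)
        fix c :: ennreal assume c: "1 < c"
        have "ennreal L * 1 < ennreal L * c"
          using c Lp by (intro ennreal_mult_strict_left_mono) auto
        then have "ennreal L * c \<in> E" using up L by simp
        then show "Inf {c. ennreal L * c \<in> E} \<le> c" by (intro Inf_lower) simp
      qed
    qed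
    then have "lpnorm M s (\<lambda>x. f x / of_real L) = 1" using True E' by (simp add: lpnorm_def)
    then show ?thesis using that Lp L(3) by blast
  next
    case False
    then have sp: "s > 0" using s by simp
    define I where "I = (LINT x|M. norm (f x) powr (1 / s))"
    have i: "integrable M (\<lambda>x. norm (f x) powr (1 / s))"
    proof (rule integrable_bounded_measurable)
      show "(\<lambda>x. norm (f x) powr (1 / s)) \<in> borel_measurable M" using f by measurable
      show "norm (norm (f x) powr (1 / s)) \<le> B powr (1 / s)" for x using B sp by (auto intro: powr_mono2)
    qed
    have "I \<noteq> 0"
    proof
      assume "I = 0"
      then have "AE x in M. norm (f x) powr (1 / s) = 0"
        using i unfolding I_def by (subst (asm) integral_nonneg_eq_0_iff_AE) auto
      then show False using not0 by simp
    qed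
    moreover have "I \<ge> 0" by (simp add: I_def)
    ultimately have Ip: "I > 0" by simp
    define L where "L = I powr s"
    have Lp: "L > 0" using Ip by (simp add: L_def)
    have pw: "norm (f x / of_real L) powr (1 / s) = norm (f x) powr (1 / s) / I" for x
      using Lp Ip sp by (simp add: norm_divide powr_divide L_def powr_powr)
    have "(\<integral>\<^sup>+x. ennreal (norm (f x / of_real L) powr (1 / s)) \<partial>M) = ennreal (LINT x|M. norm (f x) powr (1 / s) / I)"
      unfolding pw using i Ip by (intro nn_integral_eq_integral) auto
    also have "\<dots> = 1" using Ip by (simp add: I_def[symmetric])
    finally have "lpnorm M s (\<lambda>x. f x / of_real L) = 1" using sp by (simp add: lpnorm_def Let_def)
    moreover have "L \<le> C" using Cs[OF sp] by (simp add: L_def I_def)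
    ultimately show ?thesis using that Lp by blast
  qed
qed

text \<open>After division by L, replacing L by C only lowers the quotient, and each character of A
  counts with mass 1/\<alpha>. All lower bounds arise from this by a choice of f and A.\<close>

lemma fourier_pq_norm_lower:
  assumes f: "f \<in> borel_measurable M" and B: "\<And>x. norm (f x) \<le> B"
    and A: "finite A" "A \<subseteq> characters" "A \<noteq> {}" and d: "d > 0" and st: "s \<ge> 0" "t \<ge> 0"
    and F: "\<And>\<gamma>. \<gamma> \<in> A \<Longrightarrow> d \<le> norm (fourier M f \<gamma>)" and C: "C > 0"
    and C0: "s = 0 \<Longrightarrow> (\<And>x. norm (f x) \<le> C)"
    and Cs: "s > 0 \<Longrightarrow> (LINT x|M. norm (f x) powr (1 / s)) powr s \<le> C"
  shows "ennreal (d / C * (card A / \<alpha>) powr t) \<le> fourier_pq_norm M s t"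
proof -
  obtain \<gamma> where \<gamma>: "\<gamma> \<in> A" using A by auto
  have "fourier M f \<gamma> \<noteq> 0" using F[OF \<gamma>] d by auto
  then obtain L where L: "0 < L" "L \<le> C" "lpnorm M s (\<lambda>x. f x / of_real L) = 1"
    using lpnorm_normalizable[OF f B _ _ st(1) C C0 Cs] \<gamma> A by blast
  define h where "h = (\<lambda>x. f x / of_real L)"
  have hm: "h \<in> borel_measurable M" unfolding h_def using f by measurable
  have hF: "fourier M h \<gamma> = fourier M f \<gamma> / of_real L" for \<gamma>
    using fourier_scale[of "1 / of_real L" f \<gamma>] by (simp add: h_def)
  have hi: "integrable M h"
    using integrable_bounded_measurable[OF f B] by (simp add: h_def)
  have "ennreal (d / C * (card A / \<alpha>) powr t) \<le> ennreal (d / L * (card A / \<alpha>) powr t)"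
    using L d C by (intro ennreal_leI mult_right_mono divide_left_mono) auto
  also have "\<dots> \<le> lpnorm (dual_measure M) t (fourier M h)"
    using F L d by (intro lpnorm_dual_ge A st) (auto simp: hF norm_divide divide_right_mono)
  also have "\<dots> \<le> fourier_pq_norm M s t"
    unfolding fourier_pq_norm_def using hm hi L(3) by (intro Sup_upper) (auto simp: h_def)
  finally show ?thesis .
qed

lemma trivial_char: "(\<lambda>_. 1) \<in> characters"
  by (simp add: characters_def)

lemma char_mult: "\<gamma> \<in> characters \<Longrightarrow> \<delta> \<in> characters \<Longrightarrow> (\<lambda>x. \<gamma> x * \<delta> x) \<in> characters"
  for \<gamma> \<delta> :: "'a \<Rightarrow> complex"
  by (auto simp: characters_def norm_mult intro!: continuous_intros)

lemma char_inverse: "\<gamma> \<in> characters \<Longrightarrow> (\<lambda>x. cnj (\<gamma> x)) \<in> characters"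
  for \<gamma> :: "'a \<Rightarrow> complex"
  by (auto simp: characters_def intro!: continuous_intros)

lemma char_power: "\<gamma> \<in> characters \<Longrightarrow> (\<lambda>x. \<gamma> x ^ n) \<in> characters"
  for \<gamma> :: "'a \<Rightarrow> complex"
  by (auto simp: characters_def norm_power power_mult_distrib intro!: continuous_intros)

text \<open>The constant 1 has coefficient \<alpha> at the trivial character, whose mass is
  1/\<alpha>, and quasi-norm \<alpha>^s.\<close>

lemma fourier_pq_norm_R1_lower:
  assumes "s \<ge> 0" "t \<ge> 0"
  shows "ennreal (\<alpha> powr (1 - s - t)) \<le> fourier_pq_norm M s t"
proof -
  have "fourier M (\<lambda>_. 1) (\<lambda>_. 1) = of_real \<alpha>"
    by (simp add: fourier_def scaleR_conv_of_real)
  then have "ennreal (\<alpha> / \<alpha> powr s * (card {\<lambda>_::'a. 1::complex} / \<alpha>) powr t) \<le> fourier_pq_norm M s t"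
    using mass_pos trivial_char by (intro fourier_pq_norm_lower[where f = "\<lambda>_. 1" and B = 1] assms) auto
  also have "\<alpha> / \<alpha> powr s * (card {\<lambda>_::'a. 1::complex} / \<alpha>) powr t = \<alpha> powr (1 - s - t)"
    using mass_pos by (simp add: powr_diff powr_divide)
  finally show ?thesis .
qed

lemma top_if_unbounded:
  fixes z :: ennreal
  assumes "\<And>K::real. K > 0 \<Longrightarrow> ennreal K \<le> z"
  shows "z = \<infinity>"
proof (cases z)
  case (real r)
  then show ?thesis using assms[of "r + 1"] by (simp add: ennreal_le_iff)
qed simp

lemma powr_unbounded:
  fixes c e K :: real
  assumes "c > 0" "e > 0" "K > 0"
  obtains n :: nat where "\<And>N. N \<ge> n \<Longrightarrow> K \<le> c * real N powr e"
proof -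
  obtain n :: nat where n: "real n > (K / c) powr (1 / e)" using reals_Archimedean2 by blast
  have "K \<le> c * real N powr e" if "N \<ge> n" for N
  proof -
    have "((K / c) powr (1 / e)) powr e \<le> real N powr e"
      using n that assms by (intro powr_mono2) auto
    then show ?thesis using assms by (simp add: powr_powr field_simps)
  qed
  then show ?thesis using that by blast
qed

text \<open>With m the measure of U, the indicator has coefficient m at the trivial character and
  quasi-norm m^s; the quotient m^(1-s) explodes as U shrinks.\<close>

lemma fourier_pq_norm_infinite_large_s:
  assumes inf: "infinite (UNIV :: 'a set)" and s: "s > 1" and t: "t \<ge> 0"
  shows "fourier_pq_norm M s t = \<infinity>"
proof (rule top_if_unbounded)
  fix K :: real assume K: "K > 0"
  define K' where "K' = K * \<alpha> powr t"
  have K': "K' > 0" using K mass_pos by (simp add: K'_def)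
  then have "K' powr (1 / (1 - s)) > 0" by simp
  then obtain U where U: "open U" "(0::'a) \<in> U" "measure M U < K' powr (1 / (1 - s))"
    using small_open_set[OF inf] by blast
  define m where "m = measure M U"
  have m: "m > 0" using open_measure_pos[OF U(1,2)] by (simp add: m_def)
  have Um: "U \<in> sets M" using U by (simp add: sets_M)
  define f where "f = (\<lambda>x. complex_of_real (indicat_real U x))"
  have fm: "f \<in> borel_measurable M" unfolding f_def using Um by measurable
  have "fourier M f (\<lambda>_. 1) = of_real m"
    using Um by (simp add: fourier_def f_def m_def)
  moreover have "(LINT x|M. norm (f x) powr (1 / s)) = m"
  proof -
    have "norm (f x) powr (1 / s) = indicat_real U x" for x by (simp add: f_def indicator_def)
    then show ?thesis using Um by (simp add: m_def)
  qed
  ultimately have "ennreal (m / m powr s * (card {\<lambda>_::'a. 1::complex} / \<alpha>) powr t) \<le> fourier_pq_norm M s t"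
    using m s t trivial_char by (intro fourier_pq_norm_lower[where f = f and B = 1] fm) (auto simp: f_def indicator_def)
  moreover have "K \<le> m / m powr s * (card {\<lambda>_::'a. 1::complex} / \<alpha>) powr t"
  proof -
    \<comment> \<open>The exponent 1 - s is negative, so the smallness of m turns into a lower
      bound.\<close>
    have "(K' powr (1 / (1 - s))) powr (1 - s) \<le> m powr (1 - s)"
      using U(3) m s by (intro powr_mono2') (auto simp: m_def)
    then have "K' \<le> m powr (1 - s)" using K' s by (simp add: powr_powr)
    then show ?thesis using mass_pos m by (simp add: K'_def powr_diff powr_divide field_simps)
  qed
  ultimately show "ennreal K \<le> fourier_pq_norm M s t" by (meson ennreal_leI order_trans)
qed

section \<open>Kernels from sets of characters with few quotients\<close>

definition char_quot :: "('a \<Rightarrow> complex) \<times> ('a \<Rightarrow> complex) \<Rightarrow> 'a \<Rightarrow> complex" where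
  "char_quot p = (\<lambda>x. fst p x * cnj (snd p x))"

lemma char_quot_char: "p \<in> A \<times> A \<Longrightarrow> A \<subseteq> characters \<Longrightarrow> char_quot p \<in> characters"
  unfolding char_quot_def by (intro char_mult char_inverse) auto

definition finite_char_subgroup :: "('a \<Rightarrow> complex) set \<Rightarrow> bool" where
  "finite_char_subgroup F \<longleftrightarrow> finite F \<and> F \<subseteq> characters \<and> (\<lambda>_. 1) \<in> F \<and>
     (\<forall>\<gamma>\<in>F. \<forall>\<delta>\<in>F. (\<lambda>x. \<gamma> x * \<delta> x) \<in> F) \<and> (\<forall>\<gamma>\<in>F. (\<lambda>x. cnj (\<gamma> x)) \<in> F)"

lemma finite_char_subgroup_extend:
  assumes F: "finite_char_subgroup F" and \<gamma>: "\<gamma> \<in> characters" and m: "m > 0" "\<And>x. \<gamma> x ^ m = 1"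
  shows "\<exists>F'. finite_char_subgroup F' \<and> F \<subseteq> F' \<and> \<gamma> \<in> F'"
proof -
  define F' where "F' = (\<lambda>(\<delta>, k) x. \<delta> x * \<gamma> x ^ k) ` (F \<times> (UNIV :: nat set))"
  have memI: "(\<lambda>x. \<delta> x * \<gamma> x ^ k) \<in> F'" if "\<delta> \<in> F" for \<delta> k
    unfolding F'_def using that by (intro image_eqI[of _ _ "(\<delta>, k)"]) auto
  have memE: "\<exists>\<delta>\<in>F. \<exists>k. \<epsilon> = (\<lambda>x. \<delta> x * \<gamma> x ^ k)" if "\<epsilon> \<in> F'" for \<epsilon>
    using that unfolding F'_def by auto
  have pmod: "\<gamma> x ^ k = \<gamma> x ^ (k mod m)" for x k
  proof -
    have "\<gamma> x ^ k = (\<gamma> x ^ m) ^ (k div m) * \<gamma> x ^ (k mod m)"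
      by (simp flip: power_mult power_add)
    then show ?thesis using m by simp
  qed
  have "F' \<subseteq> (\<lambda>(\<delta>, k) x. \<delta> x * \<gamma> x ^ k) ` (F \<times> {..<m})"
  proof
    fix \<epsilon> assume "\<epsilon> \<in> F'"
    then obtain \<delta> k where "\<delta> \<in> F" "\<epsilon> = (\<lambda>x. \<delta> x * \<gamma> x ^ k)" using memE by blast
    then have "\<epsilon> = (\<lambda>(\<delta>, k) x. \<delta> x * \<gamma> x ^ k) (\<delta>, k mod m)" "(\<delta>, k mod m) \<in> F \<times> {..<m}"
      using pmod m by auto
    then show "\<epsilon> \<in> (\<lambda>(\<delta>, k) x. \<delta> x * \<gamma> x ^ k) ` (F \<times> {..<m})" by blast
  qed
  then have fin: "finite F'"
    by (rule finite_subset) (use F in \<open>auto simp: finite_char_subgroup_def\<close>)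
  have chars: "F' \<subseteq> characters"
    using F \<gamma> memE unfolding finite_char_subgroup_def by (metis char_mult char_power subset_eq)
  have sub: "F \<subseteq> F'" using memI[of _ 0] by auto
  have mul: "(\<lambda>x. \<epsilon> x * \<eta> x) \<in> F'" if \<epsilon>: "\<epsilon> \<in> F'" and \<eta>: "\<eta> \<in> F'" for \<epsilon> \<eta>
  proof -
    obtain \<delta> k \<delta>' k' where "\<delta> \<in> F" "\<delta>' \<in> F" "\<epsilon> = (\<lambda>x. \<delta> x * \<gamma> x ^ k)" "\<eta> = (\<lambda>x. \<delta>' x * \<gamma> x ^ k')"
      using memE[OF \<epsilon>] memE[OF \<eta>] by blast
    then show ?thesis
      using memI[of "\<lambda>x. \<delta> x * \<delta>' x" "k + k'"] F by (simp add: finite_char_subgroup_def power_add mult_ac)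
  qed
  have inv: "(\<lambda>x. cnj (\<epsilon> x)) \<in> F'" if \<epsilon>: "\<epsilon> \<in> F'" for \<epsilon>
  proof -
    obtain \<delta> k where dk: "\<delta> \<in> F" "\<epsilon> = (\<lambda>x. \<delta> x * \<gamma> x ^ k)" using memE[OF \<epsilon>] by blast
    \<comment> \<open>The inverse of \<gamma> is its power m - 1, which keeps exponents
      natural.\<close>
    have "cnj (\<gamma> x ^ k) = \<gamma> x ^ (k * (m - 1))" for x
    proof -
      have "\<gamma> x ^ k * \<gamma> x ^ (k * (m - 1)) = (\<gamma> x ^ m) ^ k"
        using m(1) by (simp flip: power_add power_mult) (metis Suc_pred mult.commute mult_Suc_right)
      then have "\<gamma> x ^ k * \<gamma> x ^ (k * (m - 1)) = \<gamma> x ^ k * cnj (\<gamma> x ^ k)"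
        using m(2) char_cnj[OF char_power[OF \<gamma>, of k], of x] by simp
      moreover have "\<gamma> x ^ k \<noteq> 0" using char_norm[OF \<gamma>, of x] by auto
      ultimately show ?thesis by (metis mult_left_cancel)
    qed
    then have "(\<lambda>x. cnj (\<epsilon> x)) = (\<lambda>x. cnj (\<delta> x) * \<gamma> x ^ (k * (m - 1)))" using dk by simp
    moreover have "(\<lambda>x. cnj (\<delta> x)) \<in> F" using F dk(1) by (simp add: finite_char_subgroup_def)
    ultimately show ?thesis using memI by metis
  qed
  have "(\<lambda>_. 1) \<in> F'" "\<gamma> \<in> F'"
    using sub F memI[of "\<lambda>_. 1" 1] by (auto simp: finite_char_subgroup_def)
  then have "finite_char_subgroup F'"
    using fin chars mul inv by (simp add: finite_char_subgroup_def)
  then show ?thesis using sub \<open>\<gamma> \<in> F'\<close> by blast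
qed

text \<open>An infinite abelian group contains arbitrarily long progressions or arbitrarily large finite subgroups.\<close>
lemma small_doubling_characters:
  assumes inf: "infinite (characters :: ('a \<Rightarrow> complex) set)"
  obtains A :: "('a \<Rightarrow> complex) set" where "finite A" "A \<subseteq> characters" "card A \<ge> n" "A \<noteq> {}"
    "card (char_quot ` (A \<times> A)) \<le> 2 * card A"
proof (cases "\<exists>\<gamma>\<in>characters. inj (\<lambda>(k::nat) (x::'a). \<gamma> x ^ k)")
  case True
  then obtain \<gamma> :: "'a \<Rightarrow> complex" where \<gamma>: "\<gamma> \<in> characters" and inj: "inj (\<lambda>(k::nat) x. \<gamma> x ^ k)" by blast
  define P where "P = (\<lambda>k x. \<gamma> x ^ k)"
  define A where "A = P ` {..n}"
  have cA: "card A = Suc n"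
    using card_image[of P "{..n}"] inj_on_subset[OF inj] by (simp add: A_def P_def)
  \<comment> \<open>The quotients are powers with exponents from -n to n, covered by two halves of n
    + 1 each; this already matches twice the cardinality of A.\<close>
  have "char_quot ` (A \<times> A) \<subseteq> P ` {..n} \<union> (\<lambda>k x. cnj (P k x)) ` {..n}"
  proof safe
    fix a b assume "a \<in> A" "b \<in> A" and n: "char_quot (a, b) \<notin> (\<lambda>k x. cnj (P k x)) ` {..n}"
    then obtain i j where ij: "i \<le> n" "j \<le> n" "a = P i" "b = P j" by (auto simp: A_def)
    have unit: "P k x * cnj (P k x) = 1" for x k
      unfolding P_def using char_cnj[OF char_power[OF \<gamma>, of k], of x] .
    have le: "char_quot (a, b) = (\<lambda>x. cnj (P (j - i) x))" if "i \<le> j"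
    proof
      fix x
      have "P j x = P i x * P (j - i) x" using that by (simp add: P_def flip: power_add)
      then have "char_quot (a, b) x = (P i x * cnj (P i x)) * cnj (P (j - i) x)"
        by (simp add: char_quot_def ij)
      then show "char_quot (a, b) x = cnj (P (j - i) x)" unfolding unit by simp
    qed
    have "j < i"
    proof (rule ccontr)
      assume "\<not> j < i"
      then have "char_quot (a, b) = (\<lambda>x. cnj (P (j - i) x))" using le by simp
      moreover have "j - i \<in> {..n}" using ij by simp
      ultimately show False using n by blast
    qed
    have "char_quot (a, b) = P (i - j)"
    proof
      fix x
      have "P i x = P (i - j) x * P j x" using \<open>j < i\<close> by (simp add: P_def flip: power_add)
      then have "char_quot (a, b) x = P (i - j) x * (P j x * cnj (P j x))"
        by (simp add: char_quot_def ij)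
      then show "char_quot (a, b) x = P (i - j) x" unfolding unit by simp
    qed
    then show "char_quot (a, b) \<in> P ` {..n}" using ij by auto
  qed
  then have "card (char_quot ` (A \<times> A)) \<le> card (P ` {..n} \<union> (\<lambda>k x. cnj (P k x)) ` {..n})"
    by (intro card_mono) auto
  also have "\<dots> \<le> card (P ` {..n}) + card ((\<lambda>k x. cnj (P k x)) ` {..n})" by (rule card_Un_le)
  also have "\<dots> \<le> Suc n + Suc n"
    using card_image_le[of "{..n}" P] card_image_le[of "{..n}" "\<lambda>k x. cnj (P k x)"] by (intro add_mono) auto
  finally show ?thesis using that[of A] cA char_power[OF \<gamma>] by (force simp: A_def P_def)
next
  case False
  \<comment> \<open>In this case two distinct powers of any character coincide, so every character
    has finite order and finite subgroups can be enlarged one character at a time.\<close>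
  have torsion: "\<exists>m>0. \<forall>x. \<gamma> x ^ m = 1" if \<gamma>: "\<gamma> \<in> characters" for \<gamma> :: "'a \<Rightarrow> complex"
  proof -
    obtain i j :: nat where "i \<noteq> j" "(\<lambda>x. \<gamma> x ^ i) = (\<lambda>x. \<gamma> x ^ j)"
      using False \<gamma> by (auto simp: inj_def)
    then obtain i j :: nat where ij: "i < j" "(\<lambda>x. \<gamma> x ^ i) = (\<lambda>x. \<gamma> x ^ j)"
      by (metis nat_neq_iff)
    have "\<gamma> x ^ (j - i) = 1" for x
    proof -
      have "\<gamma> x ^ i * \<gamma> x ^ (j - i) = \<gamma> x ^ j" using ij(1) by (simp flip: power_add)
      then have "\<gamma> x ^ i * \<gamma> x ^ (j - i) = \<gamma> x ^ i * 1" using fun_cong[OF ij(2), of x] by simp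
      moreover have "\<gamma> x ^ i \<noteq> 0" using char_norm[OF \<gamma>, of x] by auto
      ultimately show ?thesis by (metis mult_left_cancel)
    qed
    then show ?thesis using ij(1) by (intro exI[of _ "j - i"]) auto
  qed
  have "\<exists>F. finite_char_subgroup F \<and> card F \<ge> n" for n
  proof (induction n)
    case 0
    have "finite_char_subgroup {\<lambda>_. 1}" using trivial_char by (simp add: finite_char_subgroup_def)
    then show ?case by auto
  next
    case (Suc n)
    then obtain F where F: "finite_char_subgroup F" "card F \<ge> n" by blast
    have "finite F" using F by (simp add: finite_char_subgroup_def)
    then have "\<not> characters \<subseteq> F" using inf finite_subset[of characters F] by auto
    then obtain \<gamma> :: "'a \<Rightarrow> complex" where \<gamma>: "\<gamma> \<in> characters" "\<gamma> \<notin> F" by blast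
    obtain m where "m > 0" "\<And>x. \<gamma> x ^ m = 1" using torsion[OF \<gamma>(1)] by blast
    then obtain F' where F': "finite_char_subgroup F'" "F \<subseteq> F'" "\<gamma> \<in> F'"
      using finite_char_subgroup_extend[OF F(1) \<gamma>(1)] by blast
    have "finite F'" using F' by (simp add: finite_char_subgroup_def)
    then have "card F < card F'" using F' \<gamma> by (intro psubset_card_mono) auto
    then show ?case using F' F(2) by (intro exI[of _ F']) auto
  qed
  then obtain F where F: "finite_char_subgroup F" "card F \<ge> n" by blast
  have "char_quot ` (F \<times> F) \<subseteq> F"
    using F(1) by (auto simp: finite_char_subgroup_def char_quot_def)
  moreover have "finite F" "F \<subseteq> characters" "F \<noteq> {}" using F(1) by (auto simp: finite_char_subgroup_def)
  ultimately show ?thesis using that[of F] F(2) card_mono[of F "char_quot ` (F \<times> F)"] by auto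
qed

text \<open>f = |S|^2 / N is nonnegative with integral \<alpha> and maximum at most N, which bounds
  its quasi-norm by \<alpha>^s N^(1-s). Its coefficient at \<eta> is \<alpha> r(\<eta>) / N, where r
  counts representations of \<eta> as a quotient; few quotients force r to be of order N on about N
  characters.\<close>

lemma fourier_pq_norm_infinite_R2:
  assumes inf: "infinite (UNIV :: 'a set)" and s: "1/2 < s" "s \<le> 1" and st: "s + t > 1"
  shows "fourier_pq_norm M s t = \<infinity>"
proof (rule top_if_unbounded)
  fix K :: real assume K: "K > 0"
  have t: "t > 0" using s st by simp
  \<comment> \<open>\<alpha>/4 bounds the coefficients from below, \<alpha>^s belongs to the
    quasi-norm, and 1/(2\<alpha>) stems from at least N/2 characters of mass 1/\<alpha>.\<close>
  define c where "c = (\<alpha> / 4) / \<alpha> powr s * (1 / (2 * \<alpha>)) powr t"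
  have c: "c > 0" using mass_pos by (simp add: c_def)
  have "s + t - 1 > 0" using st by simp
  then obtain n where n: "\<And>N. N \<ge> n \<Longrightarrow> K \<le> c * real N powr (s + t - 1)"
    using powr_unbounded[OF c _ K] by blast
  obtain A :: "('a \<Rightarrow> complex) set" where A: "finite A" "A \<subseteq> characters" "card A \<ge> n" "A \<noteq> {}"
    "card (char_quot ` (A \<times> A)) \<le> 2 * card A"
    using small_doubling_characters[OF infinite_characters[OF inf]] by blast
  define N where "N = card A"
  have N: "N > 0" using A by (simp add: N_def card_gt_0_iff)
  define f where "f = (\<lambda>x. of_real (1 / N) * (\<Sum>p\<in>A \<times> A. char_quot p x))"
  define S where "S = (\<lambda>x. \<Sum>\<gamma>\<in>A. \<gamma> x)"
  have qc: "char_quot p \<in> characters" if "p \<in> A \<times> A" for p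
    using char_quot_char[OF that A(2)] .
  have fS: "f x = of_real ((norm (S x))\<^sup>2 / N)" for x
  proof -
    have "(\<Sum>p\<in>A \<times> A. char_quot p x) = S x * cnj (S x)"
      by (simp add: S_def sum_product sum.cartesian_product char_quot_def case_prod_beta)
    then show ?thesis by (simp add: f_def complex_norm_square[symmetric])
  qed
  have SN: "norm (S x) \<le> N" for x
    unfolding S_def N_def using A char_norm by (intro order_trans[OF norm_sum]) (auto simp: subset_eq)
  have nf: "norm (f x) = (norm (S x))\<^sup>2 / N" for x
    unfolding fS norm_of_real by simp
  have fN: "norm (f x) \<le> N" for x
  proof -
    have "(norm (S x))\<^sup>2 \<le> (real N)\<^sup>2" using SN by (intro power_mono) auto
    then show ?thesis unfolding nf using N by (simp add: field_simps power2_eq_square)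
  qed
  have fc: "continuous_fun f" unfolding f_def by (intro continuous_intros char_continuous qc)
  have fm: "f \<in> borel_measurable M" by (rule continuous_measurable[OF fc])
  define r where "r = (\<lambda>\<eta>. card {p \<in> A \<times> A. char_quot p = \<eta>})"
  have ff: "fourier M f \<eta> = of_real (\<alpha> * r \<eta> / N)" if \<eta>: "\<eta> \<in> characters" for \<eta>
  proof -
    have "fourier M f \<eta> = of_real (1 / N) * (\<Sum>p\<in>A \<times> A. fourier M (char_quot p) \<eta>)"
      unfolding f_def fourier_scale using \<eta> qc
      by (subst fourier_sum) (auto intro!: integrable_continuous char_continuous)
    also have "(\<Sum>p\<in>A \<times> A. fourier M (char_quot p) \<eta>) = (\<Sum>p\<in>A \<times> A. if char_quot p = \<eta> then of_real \<alpha> else 0)"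
      using qc \<eta> by (intro sum.cong refl) (auto simp: fourier_char)
    also have "\<dots> = of_real (\<alpha> * r \<eta>)"
    proof -
      have "(\<Sum>p\<in>A \<times> A. if char_quot p = \<eta> then complex_of_real \<alpha> else 0) = (\<Sum>p\<in>{p \<in> A \<times> A. char_quot p = \<eta>}. of_real \<alpha>)"
        using A(1) by (intro sum.inter_filter[symmetric]) simp
      then show ?thesis by (simp only: r_def sum_constant of_real_mult of_real_of_nat_eq mult.commute)
    qed
    finally show ?thesis by simp
  qed
  have "(LINT x|M. f x * cnj 1) = of_real (\<alpha> * r (\<lambda>_. 1) / N)"
    using ff[OF trivial_char] by (simp add: fourier_def)
  moreover have "r (\<lambda>_. 1) = N"
  proof -
    have "{p \<in> A \<times> A. char_quot p = (\<lambda>_. 1)} = (\<lambda>\<gamma>. (\<gamma>, \<gamma>)) ` A"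
    proof safe
      fix a b assume ab: "a \<in> A" "b \<in> A" "char_quot (a, b) = (\<lambda>_. 1)"
      have "a x = b x" for x
      proof -
        have b: "b x * cnj (b x) = 1" using char_cnj[of b x] ab(2) A(2) by blast
        have q: "a x * cnj (b x) = 1" using fun_cong[OF ab(3), of x] by (simp add: char_quot_def)
        have "a x = a x * (b x * cnj (b x))" unfolding b by simp
        also have "\<dots> = b x * (a x * cnj (b x))" by (rule mult.left_commute)
        finally show ?thesis unfolding q by simp
      qed
      then show "(a, b) \<in> (\<lambda>\<gamma>. (\<gamma>, \<gamma>)) ` A" using ab by (auto simp: fun_eq_iff image_iff)
    next
      fix a assume "a \<in> A"
      then show "char_quot (a, a) = (\<lambda>_. 1)" using A char_cnj[of a] by (auto simp: char_quot_def)
    qed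
    then show ?thesis unfolding r_def N_def by (simp add: card_image inj_on_def)
  qed
  ultimately have "(LINT x|M. f x) = of_real \<alpha>" using N by simp
  moreover have "(LINT x|M. f x) = of_real (LINT x|M. norm (f x))"
  proof -
    have "f x = of_real (norm (f x))" for x using fS[of x] nf[of x] by simp
    then have "(LINT x|M. f x) = (LINT x|M. of_real (norm (f x)))" by presburger
    also have "\<dots> = of_real (LINT x|M. norm (f x))"
      by (intro integral_of_real integrable_norm integrable_continuous fc)
    finally show ?thesis .
  qed
  ultimately have mean: "(LINT x|M. norm (f x)) = \<alpha>" by (simp only: of_real_eq_iff)
  have Cs: "(LINT x|M. norm (f x) powr (1 / s)) powr s \<le> \<alpha> powr s * N powr (1 - s)"
  proof -
    \<comment> \<open>All of the power beyond the first is estimated by the maximum N; s \<le> 1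
      makes the exponent 1/s - 1 nonnegative.\<close>
    have pw: "norm (f x) powr (1 / s) \<le> N powr (1 / s - 1) * norm (f x)" for x
    proof (cases "f x = 0")
      case False
      have "norm (f x) powr (1 / s) = norm (f x) powr (1 / s - 1) * norm (f x)"
        using False by (simp add: powr_diff)
      also have "\<dots> \<le> N powr (1 / s - 1) * norm (f x)"
        using fN s by (intro mult_right_mono powr_mono2) auto
      finally show ?thesis .
    qed (use s in simp)
    have ps: "continuous_on UNIV (\<lambda>x. norm (f x) powr (1 / s))"
      using s by (intro continuous_on_powr' continuous_intros fc) auto
    have "(LINT x|M. norm (f x) powr (1 / s)) \<le> (LINT x|M. N powr (1 / s - 1) * norm (f x))"
      using pw by (intro integral_mono integrable_continuous ps continuous_intros fc) auto
    also have "\<dots> = N powr (1 / s - 1) * \<alpha>" using mean by simp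
    finally have "(LINT x|M. norm (f x) powr (1 / s)) powr s \<le> (N powr (1 / s - 1) * \<alpha>) powr s"
      using s by (intro powr_mono2) auto
    also have "\<dots> = N powr ((1 / s - 1) * s) * \<alpha> powr s" using N mass_pos by (simp add: powr_mult powr_powr)
    also have "(1 / s - 1) * s = 1 - s" using s by (simp add: field_simps)
    finally show ?thesis by (simp add: mult.commute)
  qed
  define D where "D = char_quot ` (A \<times> A)"
  \<comment> \<open>The popular quotients. At most 2N quotients share N^2 pairs, so the mean of r is
    at least N/2; the threshold N/4 is half of that.\<close>
  define A' where "A' = {\<eta>\<in>D. N \<le> 4 * r \<eta>}"
  have Df: "finite D" using A by (simp add: D_def)
  have Dc: "D \<subseteq> characters" using qc by (auto simp: D_def)
  have r_le: "r \<eta> \<le> N" for \<eta>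
  proof -
    \<comment> \<open>A quotient together with its denominator determines the numerator.\<close>
    have "inj_on snd {p \<in> A \<times> A. char_quot p = \<eta>}"
    proof (rule inj_onI)
      fix p q assume p: "p \<in> {p \<in> A \<times> A. char_quot p = \<eta>}" and q: "q \<in> {p \<in> A \<times> A. char_quot p = \<eta>}"
        and eq: "snd p = snd q"
      have "fst p x = fst q x" for x
      proof -
        have "norm (snd q x) = 1" using q A by (intro char_norm) auto
        then have "cnj (snd q x) \<noteq> 0" by auto
        moreover have "char_quot p x = char_quot q x" using p q by simp
        ultimately show ?thesis by (simp add: char_quot_def eq)
      qed
      then show "p = q" using eq by (auto simp: prod_eq_iff)
    qed
    then have "r \<eta> \<le> card A"
      unfolding r_def using A(1) by (intro card_inj_on_le[of snd]) auto
    then show ?thesis by (simp add: N_def)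
  qed
  have tot: "(\<Sum>\<eta>\<in>D. r \<eta>) = N * N"
  proof -
    have "card (A \<times> A) = (\<Sum>\<eta>\<in>char_quot ` (A \<times> A). (\<Sum>p\<in>{p \<in> A \<times> A. char_quot p = \<eta>}. 1))"
      using sum.image_gen[of "A \<times> A" "\<lambda>_. 1::nat" char_quot] A(1) by simp
    then show ?thesis by (simp add: r_def D_def N_def card_cartesian_product)
  qed
  \<comment> \<open>In the sum 4N^2 of all 4 r, unpopular quotients account for at most N each,
    hence 2N^2 together. The other 2N^2 must come from popular ones, at most 4N each.\<close>
  have A'card: "N \<le> 2 * card A'"
  proof -
    have "4 * (N * N) = (\<Sum>\<eta>\<in>D. 4 * r \<eta>)" unfolding tot[symmetric] by (rule sum_distrib_left)
    also have "\<dots> = (\<Sum>\<eta>\<in>A'. 4 * r \<eta>) + (\<Sum>\<eta>\<in>D - A'. 4 * r \<eta>)"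
      using Df by (subst sum.subset_diff[of A' D]) (auto simp: A'_def)
    also have "\<dots> \<le> (\<Sum>\<eta>\<in>A'. 4 * N) + (\<Sum>\<eta>\<in>D - A'. N)"
      using r_le by (intro add_mono sum_mono) (auto simp: A'_def)
    also have "\<dots> \<le> card A' * (4 * N) + 2 * N * N"
      using A(5) card_mono[of D "D - A'"] Df by (auto simp: D_def N_def intro!: add_mono mult_right_mono)
    finally have "2 * N * N \<le> (4 * card A') * N" by (simp add: algebra_simps)
    then show ?thesis using N by simp
  qed
  have "ennreal ((\<alpha> / 4) / (\<alpha> powr s * N powr (1 - s)) * (card A' / \<alpha>) powr t) \<le> fourier_pq_norm M s t"
  proof (rule fourier_pq_norm_lower[OF fm fN])
    show "finite A'" "A' \<subseteq> characters" using Df Dc by (auto simp: A'_def)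
    show "A' \<noteq> {}" using A'card N by auto
    show "\<alpha> / 4 \<le> norm (fourier M f \<eta>)" if "\<eta> \<in> A'" for \<eta>
    proof -
      have "N \<le> 4 * r \<eta>" using that by (simp add: A'_def)
      then have "real N \<le> real (4 * r \<eta>)" by (rule of_nat_mono)
      then have "real N \<le> 4 * real (r \<eta>)" by simp
      then have "\<alpha> * real N \<le> \<alpha> * (4 * real (r \<eta>))" using mass_pos by (intro mult_left_mono) auto
      then have "\<alpha> / 4 \<le> \<alpha> * r \<eta> / N" using N by (simp add: field_simps)
      moreover have "norm (fourier M f \<eta>) = \<alpha> * r \<eta> / N"
        using ff[of \<eta>] that Dc mass_pos unfolding A'_def by (auto simp del: of_real_divide of_real_mult)
      ultimately show ?thesis by simp
    qed
    show "(LINT x|M. norm (f x) powr (1 / s)) powr s \<le> \<alpha> powr s * N powr (1 - s)" by (rule Cs)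
  qed (use mass_pos N s t in auto)
  moreover have "K \<le> (\<alpha> / 4) / (\<alpha> powr s * N powr (1 - s)) * (card A' / \<alpha>) powr t"
  proof -
    have "K \<le> c * real N powr (s + t - 1)" using n A(3) by (simp add: N_def)
    also have "\<dots> = (\<alpha> / 4) / (\<alpha> powr s * N powr (1 - s)) * ((1 / (2 * \<alpha>)) powr t * real N powr t)"
      using N by (simp add: c_def powr_diff powr_add mult_ac)
    also have "(1 / (2 * \<alpha>)) powr t * real N powr t = (N / (2 * \<alpha>)) powr t"
      using mass_pos powr_mult[of "1 / (2 * \<alpha>)" "real N" t] by simp
    also have "(\<alpha> / 4) / (\<alpha> powr s * N powr (1 - s)) * (N / (2 * \<alpha>)) powr t \<le> (\<alpha> / 4) / (\<alpha> powr s * N powr (1 - s)) * (card A' / \<alpha>) powr t"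
    proof (intro mult_left_mono powr_mono2)
      have "real N \<le> real (2 * card A')" using A'card by (rule of_nat_mono)
      then show "real N / (2 * \<alpha>) \<le> card A' / \<alpha>" using mass_pos by (simp add: field_simps)
    qed (use mass_pos t in auto)
    finally show ?thesis .
  qed
  ultimately show "ennreal K \<le> fourier_pq_norm M s t" by (meson ennreal_leI order_trans)
qed

text \<open>Rudin--Shapiro polynomials \<open>P, Q\<close>: passing to \<open>P + \<gamma> Q, P - \<gamma> Q\<close> doubles \<open>|P|\<^sup>2 + |Q|\<^sup>2\<close> and, for
  \<open>\<gamma>\<close> outside the quotients of the current spectrum, also the spectrum.\<close>
lemma rudin_shapiro:
  assumes inf: "infinite (characters :: ('a \<Rightarrow> complex) set)"
  shows "\<exists>B (u::('a \<Rightarrow> complex) \<Rightarrow> complex) v. finite B \<and> B \<subseteq> characters \<and> card B = 2 ^ n \<and>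
    (\<forall>\<gamma>\<in>B. norm (u \<gamma>) = 1 \<and> norm (v \<gamma>) = 1) \<and>
    (\<forall>x. (norm (\<Sum>\<gamma>\<in>B. u \<gamma> * \<gamma> x))\<^sup>2 + (norm (\<Sum>\<gamma>\<in>B. v \<gamma> * \<gamma> x))\<^sup>2 = 2 ^ (n + 1))"
proof (induction n)
  case 0
  show ?case
    by (rule exI[of _ "{\<lambda>_. 1}"], intro exI[of _ "\<lambda>_. 1"]) (simp add: trivial_char)
next
  case (Suc n)
  then obtain B :: "('a \<Rightarrow> complex) set" and u v :: "('a \<Rightarrow> complex) \<Rightarrow> complex"
    where B: "finite B" "B \<subseteq> characters" "card B = 2 ^ n"
    and uv: "\<And>\<gamma>. \<gamma> \<in> B \<Longrightarrow> norm (u \<gamma>) = 1" "\<And>\<gamma>. \<gamma> \<in> B \<Longrightarrow> norm (v \<gamma>) = 1"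
    and PQ: "\<And>x. (norm (\<Sum>\<gamma>\<in>B. u \<gamma> * \<gamma> x))\<^sup>2 + (norm (\<Sum>\<gamma>\<in>B. v \<gamma> * \<gamma> x))\<^sup>2 = 2 ^ (n + 1)"
    by blast
  have "finite (char_quot ` (B \<times> B))" using B by simp
  then have "\<not> characters \<subseteq> char_quot ` (B \<times> B)" using inf finite_subset[of characters] by auto
  then obtain g :: "'a \<Rightarrow> complex" where g: "g \<in> characters" "g \<notin> char_quot ` (B \<times> B)" by blast
  define T where "T = (\<lambda>\<gamma> (x::'a). g x * \<gamma> x)"
  define T' where "T' = (\<lambda>\<gamma> (x::'a). cnj (g x) * \<gamma> x)"
  have T'T: "T' (T \<gamma>) = \<gamma>" for \<gamma>
    using char_cnj[OF g(1)] by (simp add: T_def T'_def fun_eq_iff mult.commute[of "cnj _"] flip: mult.assoc)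
  have injT: "inj_on T B" by (metis T'T inj_onI)
  have disj: "B \<inter> T ` B = {}"
  proof (rule ccontr)
    assume "B \<inter> T ` B \<noteq> {}"
    then obtain \<gamma> \<delta> where gd: "\<gamma> \<in> B" "\<delta> \<in> B" "\<gamma> = T \<delta>" by auto
    have "g = char_quot (\<gamma>, \<delta>)"
      using gd(3) char_cnj[of \<delta>] gd(2) B(2) by (auto simp: char_quot_def T_def fun_eq_iff mult.assoc)
    then show False using g(2) gd by auto
  qed
  define B' where "B' = B \<union> T ` B"
  define u' where "u' = (\<lambda>\<gamma>. if \<gamma> \<in> B then u \<gamma> else v (T' \<gamma>))"
  define v' where "v' = (\<lambda>\<gamma>. if \<gamma> \<in> B then u \<gamma> else - v (T' \<gamma>))"
  have notB: "T \<gamma> \<notin> B" if "\<gamma> \<in> B" for \<gamma> using disj that by blast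
  have split: "(\<Sum>\<gamma>\<in>B'. w \<gamma> * \<gamma> x) = (\<Sum>\<gamma>\<in>B. w \<gamma> * \<gamma> x) + (\<Sum>\<gamma>\<in>B. w (T \<gamma>) * (g x * \<gamma> x))" for w x
  proof -
    have "(\<Sum>\<gamma>\<in>T ` B. w \<gamma> * \<gamma> x) = (\<Sum>\<gamma>\<in>B. w (T \<gamma>) * T \<gamma> x)"
      using sum.reindex[OF injT, of "\<lambda>\<gamma>. w \<gamma> * \<gamma> x"] by (simp add: o_def)
    then show ?thesis
      unfolding B'_def using B(1) disj by (subst sum.union_disjoint) (auto simp: T_def)
  qed
  have us: "(\<Sum>\<gamma>\<in>B'. u' \<gamma> * \<gamma> x) = (\<Sum>\<gamma>\<in>B. u \<gamma> * \<gamma> x) + g x * (\<Sum>\<gamma>\<in>B. v \<gamma> * \<gamma> x)" for x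
    unfolding split sum_distrib_left
    by (intro arg_cong2[of _ _ _ _ "(+)"] sum.cong) (auto simp: u'_def notB T'T mult_ac)
  have vs: "(\<Sum>\<gamma>\<in>B'. v' \<gamma> * \<gamma> x) = (\<Sum>\<gamma>\<in>B. u \<gamma> * \<gamma> x) - g x * (\<Sum>\<gamma>\<in>B. v \<gamma> * \<gamma> x)" for x
    unfolding split sum_distrib_left diff_conv_add_uminus sum_negf[symmetric]
    by (intro arg_cong2[of _ _ _ _ "(+)"] sum.cong) (auto simp: v'_def notB T'T mult_ac)
  \<comment> \<open>Parallelogram law; as |g| = 1, it doubles the sum of squares exactly.\<close>
  have par: "(norm (a + b))\<^sup>2 + (norm (a - b))\<^sup>2 = 2 * ((norm a)\<^sup>2 + (norm b)\<^sup>2)" for a b :: complex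
    unfolding cmod_power2 by (simp add: power2_eq_square algebra_simps)
  have "(norm (\<Sum>\<gamma>\<in>B'. u' \<gamma> * \<gamma> x))\<^sup>2 + (norm (\<Sum>\<gamma>\<in>B'. v' \<gamma> * \<gamma> x))\<^sup>2 = 2 ^ (Suc n + 1)" for x
    unfolding us vs par using PQ[of x] by (simp add: norm_mult char_norm[OF g(1)])
  moreover have "card B' = 2 ^ Suc n"
    unfolding B'_def using B disj by (subst card_Un_disjoint) (auto simp: card_image[OF injT])
  moreover have "finite B'" "B' \<subseteq> characters"
    using B char_mult[OF g(1)] by (auto simp: B'_def T_def)
  moreover have "norm (u' \<gamma>) = 1 \<and> norm (v' \<gamma>) = 1" if "\<gamma> \<in> B'" for \<gamma>
    using that uv by (auto simp: u'_def v'_def B'_def T'T)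
  ultimately show ?case by blast
qed

text \<open>On finite mass the sup norm controls every quasi-norm, so a single sup bound sqrt (2N)
  serves all s. The companion polynomial only certifies that bound and is then dropped.\<close>

lemma fourier_pq_norm_infinite_R3:
  assumes inf: "infinite (UNIV :: 'a set)" and s: "0 \<le> s" and t: "t > 1/2"
  shows "fourier_pq_norm M s t = \<infinity>"
proof (rule top_if_unbounded)
  fix K :: real assume K: "K > 0"
  define c where "c = \<alpha> / (\<alpha> powr s * sqrt 2) * (1 / \<alpha>) powr t"
  have c: "c > 0" using mass_pos by (simp add: c_def)
  have "t - 1/2 > 0" using t by simp
  then obtain n where n: "\<And>N. N \<ge> n \<Longrightarrow> K \<le> c * real N powr (t - 1/2)"
    using powr_unbounded[OF c _ K] by blast
  obtain B :: "('a \<Rightarrow> complex) set" and u v :: "('a \<Rightarrow> complex) \<Rightarrow> complex"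
    where B: "finite B" "B \<subseteq> characters" "card B = 2 ^ n"
    and uv: "\<And>\<gamma>. \<gamma> \<in> B \<Longrightarrow> norm (u \<gamma>) = 1"
    and PQ: "\<And>x. (norm (\<Sum>\<gamma>\<in>B. u \<gamma> * \<gamma> x))\<^sup>2 + (norm (\<Sum>\<gamma>\<in>B. v \<gamma> * \<gamma> x))\<^sup>2 = 2 ^ (n + 1)"
    using rudin_shapiro[OF infinite_characters[OF inf], of n] by blast
  \<comment> \<open>Since 2^n \<ge> n, the threshold n for the growth in N also serves as the number
    of doubling steps.\<close>
  define N where "N = (2::nat) ^ n"
  have N: "N \<ge> n" "N > 0" by (auto simp: N_def less_imp_le)
  define f where "f = (\<lambda>x. \<Sum>\<gamma>\<in>B. u \<gamma> * \<gamma> x)"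
  define R where "R = sqrt (2 * N)"
  have R: "R > 0" using N by (simp add: R_def)
  have Bc: "\<gamma> \<in> characters" if "\<gamma> \<in> B" for \<gamma> using that B by auto
  have fc: "continuous_fun f" unfolding f_def by (intro continuous_intros char_continuous Bc)
  have fR: "norm (f x) \<le> R" for x
  proof -
    have "(norm (f x))\<^sup>2 \<le> (norm (f x))\<^sup>2 + (norm (\<Sum>\<gamma>\<in>B. v \<gamma> * \<gamma> x))\<^sup>2" by simp
    also have "\<dots> = 2 * N" unfolding f_def PQ by (simp add: N_def)
    finally show ?thesis unfolding R_def by (rule real_le_rsqrt)
  qed
  have ff: "norm (fourier M f \<eta>) = \<alpha>" if \<eta>: "\<eta> \<in> B" for \<eta>
  proof -
    have "fourier M f \<eta> = (\<Sum>\<gamma>\<in>B. u \<gamma> * fourier M \<gamma> \<eta>)"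
    proof -
      have "integrable M (\<lambda>x. u \<gamma> * \<gamma> x)" if "\<gamma> \<in> B" for \<gamma>
        by (intro integrable_continuous continuous_on_mult_left char_continuous Bc that)
      then show ?thesis unfolding f_def using Bc \<eta> by (simp add: fourier_sum fourier_scale)
    qed
    also have "\<dots> = (\<Sum>\<gamma>\<in>B. if \<gamma> = \<eta> then u \<gamma> * of_real \<alpha> else 0)"
      using Bc \<eta> by (intro sum.cong) (auto simp: fourier_char)
    also have "\<dots> = u \<eta> * of_real \<alpha>" using B \<eta> by simp
    finally show ?thesis using uv[OF \<eta>] mass_pos by (simp add: norm_mult)
  qed
  have "ennreal (\<alpha> / (\<alpha> powr s * R) * (card B / \<alpha>) powr t) \<le> fourier_pq_norm M s t"
  proof (rule fourier_pq_norm_lower[OF continuous_measurable[OF fc] fR B(1,2)])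
    show "B \<noteq> {}" using B(3) by auto
    show "(LINT x|M. norm (f x) powr (1 / s)) powr s \<le> \<alpha> powr s * R" if sp: "s > 0"
    proof -
      have ps: "continuous_on UNIV (\<lambda>x. norm (f x) powr (1 / s))"
        using sp by (intro continuous_on_powr' continuous_intros fc) auto
      have "norm (LINT x|M. norm (f x) powr (1 / s)) \<le> R powr (1 / s) * \<alpha>"
        using fR sp by (intro norm_integral_le integrable_continuous ps) (auto intro: powr_mono2)
      then have "(LINT x|M. norm (f x) powr (1 / s)) powr s \<le> (R powr (1 / s) * \<alpha>) powr s"
        using sp by (intro powr_mono2) auto
      also have "\<dots> = \<alpha> powr s * R" using sp R mass_pos by (simp add: powr_mult powr_powr)
      finally show ?thesis .
    qed
    show "norm (f x) \<le> \<alpha> powr s * R" if "s = 0" for x using fR that mass_pos by simp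
  qed (use mass_pos s t R ff in auto)
  moreover have "K \<le> \<alpha> / (\<alpha> powr s * R) * (card B / \<alpha>) powr t"
  proof -
    have "K \<le> c * real N powr (t - 1/2)" using n N by simp
    also have "real N powr (t - 1/2) = real N powr t / sqrt N" using N by (simp add: powr_diff powr_half_sqrt)
    also have "c * (real N powr t / sqrt N) = \<alpha> / (\<alpha> powr s * R) * ((1 / \<alpha>) powr t * real N powr t)"
      by (simp add: c_def R_def real_sqrt_mult)
    also have "(1 / \<alpha>) powr t * real N powr t = (card B / \<alpha>) powr t"
      using mass_pos powr_mult[of "1 / \<alpha>" "real N" t] B(3) by (simp add: N_def)
    finally show ?thesis .
  qed
  ultimately show "ennreal K \<le> fourier_pq_norm M s t" by (meson ennreal_leI order_trans)
qed

end

theorem theorem3p1: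
  fixes M :: "'a::{topological_ab_group_add,t2_space} measure"
    and s t :: real
  assumes "compact (UNIV :: 'a set)"
    and "infinite (UNIV :: 'a set)"
    and "haar_measure M"
    and "s \<ge> 0" and "t \<ge> 0"
  shows "(s + t \<le> 1 \<and> t \<le> 1/2 \<longrightarrow>
            fourier_pq_norm M s t = ennreal (measure M UNIV powr (1 - s - t)))
       \<and> ((s + t > 1 \<and> s > 1/2) \<or> (s \<le> 1/2 \<and> t > 1/2) \<longrightarrow>
            fourier_pq_norm M s t = \<infinity>)"
proof -
  interpret compact_haar M
    using assms(1,3) by unfold_locales
  show ?thesis
  proof (intro conjI impI)
    assume "s + t \<le> 1 \<and> t \<le> 1/2"
    then show "fourier_pq_norm M s t = ennreal (measure M UNIV powr (1 - s - t))"
      using fourier_pq_norm_upper[of s t] fourier_pq_norm_R1_lower[of s t] assms(4,5) by (simp add: antisym)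
  next
    assume "(s + t > 1 \<and> s > 1/2) \<or> (s \<le> 1/2 \<and> t > 1/2)"
    \<comment> \<open>The case t > 1/2 is taken for all s: it contains R3 and overlaps R2, which the
      first two cases already exhaust.\<close>
    then consider "s > 1" | "1/2 < s" "s \<le> 1" "s + t > 1" | "t > 1/2" by linarith
    then show "fourier_pq_norm M s t = \<infinity>"
      using fourier_pq_norm_infinite_large_s fourier_pq_norm_infinite_R2 fourier_pq_norm_infinite_R3
        assms(2,4,5) by cases auto
  qed
qed

end
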